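(* Let $(G,M)$ be a measure graph over a groupoid $\mathcal G$, and let $D\ge 1$ be the maximal vertex degree of $G$. Put $R:=\frac{D+\sqrt{D^2+4D}}{2}$. Then for every $u\in\mathbb C$ with $|u|<R^{-1}$ the Ihara Zeta function satisfies $$Z_{(G,M)}(u)^{-1}=(1-u^2)^{-\chi_{(G,M)}}\;{\det}_\tau\bigl(I-uA_G+u^2Q_G\bigr),$$ where $A_G$ is the adjacency operator, $Q_G=\mathrm{Deg}_G-I$, $\chi_{(G,M)}=\frac12\tau(I-Q_G)$ is the $L^2$-Euler characteristic, $\tau$ is the canonical trace on the von Neumann algebra $\mathcal N(\mathcal G,G)$, and ${\det}_\tau$ is the associated determinant.
   Context: GRAPHS. A graph $G=(V,E)$ has a nonempty vertex set $V$ (of arbitrary cardinality), a symmetric edge set $E\subseteq V\times V$ containing no $(x,x)$, and uniformly bounded vertex degree $\deg(x)=\#\{y:(x,y)\in E\}$. Write $x\sim y$ if $(x,y)\in E$, $x\approx y$ if $x,y$ lie in the same connected component, and $d$ for the combinatorial distance. $B^G_r(x)$ is the graph induced on $\{y:d(x,y)\le r\}$, rooted at $x$. $\mathcal A^D$ is the countable set of isomorphism classes of finite connected rooted graphs with degrees at most $D$, with the discrete $\sigma$-algebra, and $\pi_r:V\to\mathcal A^D$, $\pi_r(x)=[B_r^G(x)]$. $V^{(2)}=\{(x,y)\in V\times V:x\approx y\}$, and $a_G:V^{(2)}\to\{0,1\}$ is the adjacency matrix. MEASURABLE GRAPH: a graph with a $\sigma$-algebra on $V$ (and $V^{(2)}$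 with the $\sigma$-algebra induced from the product) such that all $\pi_r$ and $a_G$ are measurable and for all measurable $a,b:V^{(2)}\to[0,\infty]$ the product $(a*b)(x,y)=\sum_{z\approx x}a(x,z)b(z,y)$ is measurable. GROUPOID: $\mathcal G$ is a groupoid (small category with all morphisms invertible) with range $r(g)=gg^{-1}$, source $s(g)=g^{-1}g$, unit set $\Omega=\mathcal G^{(0)}$, $\mathcal G^\omega=r^{-1}(\{\omega\})$; it is measurable: it carries a $\sigma$-algebra for which multiplication, inversion, $r,s$ are measurable and singletons in $\Omega$ are measurable. A transversal function is a family $\nu=(\nu^\omega)_{\omega\in\Omega}$ of measures on $\mathcal G$ with $\nu^\omega$ supported on $\mathcal G^\omega$, $\omega\mapsto\nu^\omega(f)$ measurable for measurable $f\ge0$, and $\int f(gh)\,d\nu^{s(g)}(h)=\int f(k)\,d\nu^{r(g)}(k)$ for all $g$ and measurable $f\ge 0$ on $\mathcal G^{r(g)}$. A measure $m$ on $\Omega$ is $\nu$-invariant if $m\circ\nu=\int\nu^\omega dm(\omega)$ is invariant under $g\mapsto g^{-1}$. GRAPH OVER $\mathcal G$: a measurable graph $G$ with a measurable map $\pi:V\to\Omega$ with countable fibers $V^\omega=\pi^{-1}(\omega)$, such that $\eta^\omega:=\sum_{y\in V^\omega}\delta_y$ (the canonical random variable) satisfies that $\omega\mapsto\eta^\omega(F)$ is measurable for each measurable $F:V\to[0,\infty]$, and with graph isomorphisms $J(g):G^{s(g)}\to G^{r(g)}$ between the induced graphs on fibers, $J(g^{-1})=J(g)^{-1}$, $J(g_1g_2)=J(g_1)J(g_2)$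 if $s(g_1)=r(g_2)$; write $gx=J(g)x$. The action $(g,x)\mapsto gx$ is measurable and edges of $G$ only join vertices in the same fiber. AVERAGING FUNCTION: measurable $\mathfrak u:V\to[0,\infty]$ with $\int_{\mathcal G^{\pi(x)}}\mathfrak u(g^{-1}x)\,d\nu^{\pi(x)}(g)=1$ for all $x\in V$. MEASURE GRAPH over $\mathcal G$: a pair $(G,M)$ where $G$ is a graph over the measurable groupoid $\mathcal G$ with transversal function $\nu$ and $\nu$-invariant measure $m$, $M=m\circ\eta=\int\eta^\omega\,dm(\omega)$, the $\sigma$-algebras of $V$ and $\Omega$ have countable bases of sets of finite $M$- resp. $m$-measure, there is a strictly positive averaging function $\mathfrak u$, and $\int_V\mathfrak u\,dM<\infty$. ZETA FUNCTION. A path of length $n$ is a sequence of edges $(e_1,\dots,e_n)$ with terminal vertex of $e_i$ equal to origin of $e_{i+1}$; it is closed if the terminal vertex of $e_n$ is the origin of $e_1$. With $\bar e$ the reversed edge, a closed path is reduced if $e_{i+1}\ne\bar e_i$ for $1\le i\le n-1$ (no backtrack) and $\bar e_1\neq e_n$ (no tail). $N_j(x)$ is the number of reduced closed paths of length $j$ starting at $x$; $\overline N_j=\int_VN_j\,\mathfrak u\,dM$ (independent of the averaging function $\mathfrak u$); $Z_{(G,M)}(u)=\exp\bigl(\sum_{j\ge1}\frac{\overline N_j}{j}u^j\bigr)$. VON NEUMANN ALGEBRA. For $g\in\mathcal G$ let $U_g:\ell^2(V^{s(g)})\to\ell^2(V^{r(g)})$, $U_gf(x)=f(g^{-1}x)$.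 $\mathcal N(\mathcal G,G)$ is the algebra of families $A=(A_\omega)_{\omega\in\Omega}$ of bounded operators on $\ell^2(V^\omega)$, essentially uniformly bounded in norm, with $\omega\mapsto\langle g_\omega,A_\omega f_\omega\rangle$ measurable for $f,g\in L^2(V,M)$ (subscript = restriction to $V^\omega$), and $A_{r(g)}=U_gA_{s(g)}U_g^*$ for all $g$, modulo $m$-a.e. equality; the norm is the essential supremum of $\|A_\omega\|$. For $A\ge0$, $\tau(A)=\int_\Omega\mathrm{tr}(A_\omega^{1/2}M_{\mathfrak u_\omega}A_\omega^{1/2})\,dm(\omega)$, where $M_{\mathfrak u_\omega}$ is multiplication by $\mathfrak u|_{V^\omega}$, i.e. $\tau(A)=\int_\Omega\sum_{x\in V^\omega}\mathfrak u(x)\langle\delta_x,A_\omega\delta_x\rangle\,dm(\omega)$; it is independent of the averaging function, $\tau(I)<\infty$, and $\tau$ extends uniquely to a norm-continuous linear functional on $\mathcal N(\mathcal G,G)$. $A_G$ acts on each fiber by $(A_Gf)(x)=\sum_{y\sim x}f(y)$; $\mathrm{Deg}_G$ is multiplication by $\deg$. For $\|I-T\|<1$: $\log T=-\sum_{k\ge1}\frac1k(I-T)^k$ and ${\det}_\tau(T)=\exp(\tau(\log T))$. The power of $1-u^2$ is taken with the principal branch. *)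

theory Defs
  imports "HOL-Analysis.Analysis"
begin

section \<open>Graphs\<close>

locale simple_graph =
  fixes V :: "'v set" and E :: "'v rel"
  assumes nonempty: "V \<noteq> {}"
    and edges_subset: "E \<subseteq> V \<times> V"
    and sym_edges: "sym E"
    and irrefl_edges: "irrefl E"
    and bounded_degree: "\<exists>D. \<forall>x\<in>V. finite (E `` {x}) \<and> card (E `` {x}) \<le> D"

definition vertex_degree :: "'v rel \<Rightarrow> 'v \<Rightarrow> nat" where
  "vertex_degree E x = card (E `` {x})"

definition max_degree :: "'v set \<Rightarrow> 'v rel \<Rightarrow> nat" where
  "max_degree V E = Max (vertex_degree E ` V)"

definition same_component :: "'v set \<Rightarrow> 'v rel \<Rightarrow> ('v \<times> 'v) set" where
  "same_component V E = {(x, y). x \<in> V \<and> y \<in> V \<and> (x, y) \<in> E\<^sup>*}"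

subsection \<open>Isomorphism classes of rooted balls\<close>

text \<open>A rooted graph is a triple of vertex set, edge set and root. Every finite rooted graph is
  isomorphic to one with vertices in \<open>nat\<close>, so an isomorphism class is represented by the set of
  its members that live on \<open>nat\<close>.\<close>

type_synonym 'a rooted_graph = "'a set \<times> 'a rel \<times> 'a"

definition finite_connected_rooted :: "'a rooted_graph \<Rightarrow> bool" where
  "finite_connected_rooted = (\<lambda>(A, F, o'). finite A \<and> o' \<in> A \<and> F \<subseteq> A \<times> A \<and> sym F \<and> irrefl F
     \<and> (\<forall>x\<in>A. (o', x) \<in> F\<^sup>*))"

definition rooted_iso :: "'a rooted_graph \<Rightarrow> 'b rooted_graph \<Rightarrow> bool" where
  "rooted_iso = (\<lambda>(A, F, a) (B, H, b). \<exists>\<phi>. bij_betw \<phi> A B \<and> \<phi> a = b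
     \<and> (\<forall>x\<in>A. \<forall>y\<in>A. (x, y) \<in> F \<longleftrightarrow> (\<phi> x, \<phi> y) \<in> H))"

definition rooted_class :: "'a rooted_graph \<Rightarrow> nat rooted_graph set" where
  "rooted_class H = {K. finite_connected_rooted K \<and> rooted_iso H K}"

definition rooted_classes :: "nat \<Rightarrow> nat rooted_graph set set" where
  "rooted_classes D = rooted_class ` {H :: nat rooted_graph.
     finite_connected_rooted H \<and> (\<forall>x \<in> fst H. vertex_degree (fst (snd H)) x \<le> D)}"

definition graph_ball :: "'v rel \<Rightarrow> nat \<Rightarrow> 'v \<Rightarrow> 'v rooted_graph" where
  "graph_ball E r x = (let B = {y. \<exists>n\<le>r. (x, y) \<in> E ^^ n} in (B, E \<inter> B \<times> B, x))"

subsection \<open>Measurable graphs\<close>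

text \<open>Measurable spaces are given as measures of which only the \<open>\<sigma>\<close>-algebra is used.\<close>

definition pair_space :: "'v measure \<Rightarrow> 'v rel \<Rightarrow> ('v \<times> 'v) measure" where
  "pair_space V E = restrict_space (V \<Otimes>\<^sub>M V) (same_component (space V) E)"

definition adjacency :: "'v rel \<Rightarrow> 'v \<times> 'v \<Rightarrow> nat" where
  "adjacency E = indicator E"

definition convolution ::
  "'v rel \<Rightarrow> ('v \<times> 'v \<Rightarrow> ennreal) \<Rightarrow> ('v \<times> 'v \<Rightarrow> ennreal) \<Rightarrow> 'v \<times> 'v \<Rightarrow> ennreal" where
  "convolution E a b = (\<lambda>(x, y). \<integral>\<^sup>+z. a (x, z) * b (z, y) \<partial>count_space {z. (x, z) \<in> E\<^sup>*})"

locale measurable_graph = simple_graph "space V" E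
  for V :: "'v measure" and E :: "'v rel" +
  assumes ball_measurable:
      "\<And>r. (\<lambda>x. rooted_class (graph_ball E r x))
             \<in> measurable V (count_space (rooted_classes (max_degree (space V) E)))"
    and adjacency_measurable: "adjacency E \<in> measurable (pair_space V E) (count_space {0, 1})"
    and convolution_measurable:
      "\<And>a b. a \<in> borel_measurable (pair_space V E) \<Longrightarrow> b \<in> borel_measurable (pair_space V E)
         \<Longrightarrow> convolution E a b \<in> borel_measurable (pair_space V E)"

subsection \<open>Reduced closed paths\<close>

definition is_path :: "'v rel \<Rightarrow> ('v \<times> 'v) list \<Rightarrow> bool" where
  "is_path E es \<longleftrightarrow> set es \<subseteq> E \<and> (\<forall>i. Suc i < length es \<longrightarrow> snd (es ! i) = fst (es ! Suc i))"

definition is_closed_path :: "'v rel \<Rightarrow> ('v \<times> 'v) list \<Rightarrow> bool" where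
  "is_closed_path E es \<longleftrightarrow> is_path E es \<and> es \<noteq> [] \<and> snd (last es) = fst (hd es)"

definition is_reduced :: "('v \<times> 'v) list \<Rightarrow> bool" where
  "is_reduced es \<longleftrightarrow> (\<forall>i. Suc i < length es \<longrightarrow> es ! Suc i \<noteq> prod.swap (es ! i))
     \<and> prod.swap (hd es) \<noteq> last es"

definition num_reduced_closed :: "'v rel \<Rightarrow> nat \<Rightarrow> 'v \<Rightarrow> nat" where
  "num_reduced_closed E j x =
     card {es. length es = j \<and> is_closed_path E es \<and> is_reduced es \<and> fst (hd es) = x}"

section \<open>Groupoids\<close>

text \<open>A groupoid is single-sorted: objects are identified with their unit arrows. The product
  \<open>mult\<close> is meaningful for pairs with \<open>s(g) = r(h)\<close> only.\<close>

record 'g groupoid =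
  arrows :: "'g measure"
  mult :: "'g \<Rightarrow> 'g \<Rightarrow> 'g" (infixl "\<cdot>\<index>" 70)
  ginv :: "'g \<Rightarrow> 'g"

definition grange :: "('g, 'z) groupoid_scheme \<Rightarrow> 'g \<Rightarrow> 'g" where
  "grange X g = mult X g (ginv X g)"

definition gsource :: "('g, 'z) groupoid_scheme \<Rightarrow> 'g \<Rightarrow> 'g" where
  "gsource X g = mult X (ginv X g) g"

definition units :: "('g, 'z) groupoid_scheme \<Rightarrow> 'g set" where
  "units X = {g \<in> space (arrows X). grange X g = g}"

definition unit_space :: "('g, 'z) groupoid_scheme \<Rightarrow> 'g measure" where
  "unit_space X = restrict_space (arrows X) (units X)"

definition arrows_to :: "('g, 'z) groupoid_scheme \<Rightarrow> 'g \<Rightarrow> 'g set" where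
  "arrows_to X \<omega> = {g \<in> space (arrows X). grange X g = \<omega>}"

locale groupoid =
  fixes X :: "('g, 'z) groupoid_scheme" (structure)
  assumes inv_closed: "g \<in> space (arrows X) \<Longrightarrow> ginv X g \<in> space (arrows X)"
    and inv_inv: "g \<in> space (arrows X) \<Longrightarrow> ginv X (ginv X g) = g"
    and mult_closed: "\<lbrakk>g \<in> space (arrows X); h \<in> space (arrows X); gsource X g = grange X h\<rbrakk>
          \<Longrightarrow> g \<cdot> h \<in> space (arrows X)"
    and range_mult: "\<lbrakk>g \<in> space (arrows X); h \<in> space (arrows X); gsource X g = grange X h\<rbrakk>
          \<Longrightarrow> grange X (g \<cdot> h) = grange X g"
    and source_mult: "\<lbrakk>g \<in> space (arrows X); h \<in> space (arrows X); gsource X g = grange X h\<rbrakk>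
          \<Longrightarrow> gsource X (g \<cdot> h) = gsource X h"
    and mult_assoc: "\<lbrakk>g \<in> space (arrows X); h \<in> space (arrows X); k \<in> space (arrows X);
            gsource X g = grange X h; gsource X h = grange X k\<rbrakk>
          \<Longrightarrow> g \<cdot> h \<cdot> k = g \<cdot> (h \<cdot> k)"
    and range_unit: "g \<in> space (arrows X) \<Longrightarrow> grange X g \<cdot> g = g"
    and source_unit: "g \<in> space (arrows X) \<Longrightarrow> g \<cdot> gsource X g = g"

locale measurable_groupoid = groupoid +
  assumes mult_measurable:
      "(\<lambda>(g, h). g \<cdot> h) \<in> measurable
         (restrict_space (arrows X \<Otimes>\<^sub>M arrows X) {(g, h). gsource X g = grange X h}) (arrows X)"
    and inv_measurable: "ginv X \<in> measurable (arrows X) (arrows X)"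
    and range_measurable: "grange X \<in> measurable (arrows X) (unit_space X)"
    and source_measurable: "gsource X \<in> measurable (arrows X) (unit_space X)"
    and unit_singleton: "\<omega> \<in> units X \<Longrightarrow> {\<omega>} \<in> sets (unit_space X)"

definition transversal_function ::
  "('g, 'z) groupoid_scheme \<Rightarrow> ('g \<Rightarrow> 'g measure) \<Rightarrow> bool" where
  "transversal_function X \<nu> \<longleftrightarrow>
     (\<forall>\<omega>\<in>units X. sets (\<nu> \<omega>) = sets (arrows X)
        \<and> emeasure (\<nu> \<omega>) (space (arrows X) - arrows_to X \<omega>) = 0)
   \<and> (\<forall>f \<in> borel_measurable (arrows X).
        (\<lambda>\<omega>. \<integral>\<^sup>+g. f g \<partial>\<nu> \<omega>) \<in> borel_measurable (unit_space X))
   \<and> (\<forall>g \<in> space (arrows X).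
        \<forall>f \<in> borel_measurable (restrict_space (arrows X) (arrows_to X (grange X g))).
          (\<integral>\<^sup>+h \<in> arrows_to X (gsource X g). f (mult X g h) \<partial>\<nu> (gsource X g))
            = (\<integral>\<^sup>+k \<in> arrows_to X (grange X g). f k \<partial>\<nu> (grange X g)))"

text \<open>The measure \<open>\<integral> K\<^sup>\<omega> dm(\<omega>)\<close> on the measurable space \<open>N\<close>.\<close>

definition integrate_kernel :: "'a measure \<Rightarrow> ('a \<Rightarrow> 'b measure) \<Rightarrow> 'b measure \<Rightarrow> 'b measure" where
  "integrate_kernel m K N =
     measure_of (space N) (sets N) (\<lambda>A. \<integral>\<^sup>+\<omega>. emeasure (K \<omega>) A \<partial>m)"

definition invariant_measure ::
  "('g, 'z) groupoid_scheme \<Rightarrow> ('g \<Rightarrow> 'g measure) \<Rightarrow> 'g measure \<Rightarrow> bool" where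
  "invariant_measure X \<nu> m \<longleftrightarrow> sets m = sets (unit_space X)
     \<and> distr (integrate_kernel m \<nu> (arrows X)) (arrows X) (ginv X)
         = integrate_kernel m \<nu> (arrows X)"

section \<open>Graphs over groupoids\<close>

record ('g, 'v) graph_over = "'g groupoid" +
  verts :: "'v measure"
  edges :: "'v rel"
  proj :: "'v \<Rightarrow> 'g"
  act :: "'g \<Rightarrow> 'v \<Rightarrow> 'v"

definition fiber :: "('g, 'v, 'z) graph_over_scheme \<Rightarrow> 'g \<Rightarrow> 'v set" where
  "fiber X \<omega> = {x \<in> space (verts X). proj X x = \<omega>}"

text \<open>As an image of counting measure this is the sum of the Dirac measures at the points of the
  fiber.\<close>

definition canonical_rv :: "('g, 'v, 'z) graph_over_scheme \<Rightarrow> 'g \<Rightarrow> 'v measure" where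
  "canonical_rv X \<omega> = distr (count_space (fiber X \<omega>)) (verts X) (\<lambda>x. x)"

locale graph_over =
  measurable_groupoid X + measurable_graph "verts X" "edges X"
  for X :: "('g, 'v, 'z) graph_over_scheme" (structure) +
  assumes proj_measurable: "proj X \<in> measurable (verts X) (unit_space X)"
    and fiber_countable: "\<omega> \<in> units X \<Longrightarrow> countable (fiber X \<omega>)"
    and canonical_rv_measurable:
      "\<And>F. F \<in> borel_measurable (verts X)
         \<Longrightarrow> (\<lambda>\<omega>. \<integral>\<^sup>+x. F x \<partial>canonical_rv X \<omega>) \<in> borel_measurable (unit_space X)"
    and act_bij: "g \<in> space (arrows X)
         \<Longrightarrow> bij_betw (act X g) (fiber X (gsource X g)) (fiber X (grange X g))"
    and act_edges: "\<lbrakk>g \<in> space (arrows X); x \<in> fiber X (gsource X g); y \<in> fiber X (gsource X g)\<rbrakk>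
         \<Longrightarrow> (act X g x, act X g y) \<in> edges X \<longleftrightarrow> (x, y) \<in> edges X"
    and act_inv: "\<lbrakk>g \<in> space (arrows X); x \<in> fiber X (gsource X g)\<rbrakk>
         \<Longrightarrow> act X (ginv X g) (act X g x) = x"
    and act_mult: "\<lbrakk>g \<in> space (arrows X); h \<in> space (arrows X); gsource X g = grange X h;
           x \<in> fiber X (gsource X h)\<rbrakk> \<Longrightarrow> act X (g \<cdot> h) x = act X g (act X h x)"
    and act_measurable:
      "(\<lambda>(g, x). act X g x) \<in> measurable
         (restrict_space (arrows X \<Otimes>\<^sub>M verts X) {(g, x). gsource X g = proj X x}) (verts X)"
    and edges_in_fibers: "(x, y) \<in> edges X \<Longrightarrow> proj X x = proj X y"

record ('g, 'v) measure_graph = "('g, 'v) graph_over" +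
  transversal :: "'g \<Rightarrow> 'g measure"
  base_measure :: "'g measure"

definition averaging_function ::
  "('g, 'v, 'z) measure_graph_scheme \<Rightarrow> ('v \<Rightarrow> ennreal) \<Rightarrow> bool" where
  "averaging_function X u \<longleftrightarrow> u \<in> borel_measurable (verts X)
     \<and> (\<forall>x \<in> space (verts X).
          (\<integral>\<^sup>+g \<in> arrows_to X (proj X x). u (act X (ginv X g) x) \<partial>transversal X (proj X x)) = 1)"

definition vertex_measure :: "('g, 'v, 'z) measure_graph_scheme \<Rightarrow> 'v measure" where
  "vertex_measure X = integrate_kernel (base_measure X) (canonical_rv X) (verts X)"

definition countable_finite_basis :: "'a measure \<Rightarrow> bool" where
  "countable_finite_basis N \<longleftrightarrow> (\<exists>B. countable B \<and> B \<subseteq> sets N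
     \<and> sets N = sigma_sets (space N) B \<and> (\<forall>A\<in>B. emeasure N A < \<infinity>))"

locale measure_graph = graph_over X
  for X :: "('g, 'v, 'z) measure_graph_scheme" (structure) +
  assumes transversal: "transversal_function X (transversal X)"
    and invariant: "invariant_measure X (transversal X) (base_measure X)"
    and verts_basis: "countable_finite_basis (vertex_measure X)"
    and units_basis: "countable_finite_basis (base_measure X)"
    and positive_averaging: "\<exists>u. averaging_function X u \<and> (\<forall>x \<in> space (verts X). 0 < u x)
          \<and> (\<integral>\<^sup>+x. u x \<partial>vertex_measure X) < \<infinity>"

section \<open>The Ihara zeta function\<close>

definition mean_num_reduced_closed ::
  "('g, 'v, 'z) measure_graph_scheme \<Rightarrow> ('v \<Rightarrow> ennreal) \<Rightarrow> nat \<Rightarrow> ennreal" where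
  "mean_num_reduced_closed X u j =
     (\<integral>\<^sup>+x. of_nat (num_reduced_closed (edges X) j x) * u x \<partial>vertex_measure X)"

definition zeta_term ::
  "('g, 'v, 'z) measure_graph_scheme \<Rightarrow> ('v \<Rightarrow> ennreal) \<Rightarrow> complex \<Rightarrow> nat \<Rightarrow> complex" where
  "zeta_term X u z j = of_real (enn2real (mean_num_reduced_closed X u j)) / of_nat j * z ^ j"

definition ihara_zeta ::
  "('g, 'v, 'z) measure_graph_scheme \<Rightarrow> ('v \<Rightarrow> ennreal) \<Rightarrow> complex \<Rightarrow> complex" where
  "ihara_zeta X u z = exp (\<Sum>j. zeta_term X u z (Suc j))"

section \<open>Operators on \<open>\<ell>\<^sup>2\<close>\<close>

text \<open>Elements of \<open>\<ell>\<^sup>2(S)\<close> are functions on the whole type that vanish outside \<open>S\<close>.\<close>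

definition ell2 :: "'v set \<Rightarrow> ('v \<Rightarrow> complex) set" where
  "ell2 S = {f. (\<forall>x. x \<notin> S \<longrightarrow> f x = 0) \<and> (\<lambda>x. (cmod (f x))\<^sup>2) summable_on S}"

definition l2_norm :: "'v set \<Rightarrow> ('v \<Rightarrow> complex) \<Rightarrow> real" where
  "l2_norm S f = sqrt (\<Sum>\<^sub>\<infinity>x\<in>S. (cmod (f x))\<^sup>2)"

definition l2_inner :: "'v set \<Rightarrow> ('v \<Rightarrow> complex) \<Rightarrow> ('v \<Rightarrow> complex) \<Rightarrow> complex" where
  "l2_inner S f g = (\<Sum>\<^sub>\<infinity>x\<in>S. cnj (f x) * g x)"

definition l2_delta :: "'v \<Rightarrow> 'v \<Rightarrow> complex" where
  "l2_delta x = (\<lambda>y. of_bool (y = x))"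

definition l2_restrict :: "'v set \<Rightarrow> ('v \<Rightarrow> complex) \<Rightarrow> 'v \<Rightarrow> complex" where
  "l2_restrict S f = (\<lambda>x. if x \<in> S then f x else 0)"

definition l2_bounded_op :: "'v set \<Rightarrow> (('v \<Rightarrow> complex) \<Rightarrow> 'v \<Rightarrow> complex) \<Rightarrow> bool" where
  "l2_bounded_op S T \<longleftrightarrow>
     (\<forall>f \<in> ell2 S. T f \<in> ell2 S)
   \<and> (\<forall>f \<in> ell2 S. \<forall>g \<in> ell2 S. \<forall>c. T (\<lambda>x. c * f x + g x) = (\<lambda>x. c * T f x + T g x))
   \<and> (\<exists>C. \<forall>f \<in> ell2 S. l2_norm S (T f) \<le> C * l2_norm S f)"

definition l2_opnorm :: "'v set \<Rightarrow> (('v \<Rightarrow> complex) \<Rightarrow> 'v \<Rightarrow> complex) \<Rightarrow> real" where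
  "l2_opnorm S T = Inf {C. 0 \<le> C \<and> (\<forall>f \<in> ell2 S. l2_norm S (T f) \<le> C * l2_norm S f)}"

section \<open>The von Neumann algebra\<close>

text \<open>Elements of the algebra are represented by families of operators indexed by the units;
  norm, trace and determinant do not see changes of a family on a null set of units.\<close>

type_synonym ('g, 'v) op_family = "'g \<Rightarrow> ('v \<Rightarrow> complex) \<Rightarrow> 'v \<Rightarrow> complex"

definition translation ::
  "('g, 'v, 'z) graph_over_scheme \<Rightarrow> 'g \<Rightarrow> ('v \<Rightarrow> complex) \<Rightarrow> 'v \<Rightarrow> complex" where
  "translation X g f = l2_restrict (fiber X (grange X g)) (\<lambda>x. f (act X (ginv X g) x))"

text \<open>In the last clause the adjoint of the unitary operator \<open>translation X g\<close> appears as its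
  inverse \<open>translation X (ginv X g)\<close>, see \<open>translation_adjoint\<close>. In the measurability clause the restriction of a function
  from \<open>L\<^sup>2(V,M)\<close> to a fiber is square summable for almost every unit only; the exceptional units
  form a measurable set, on which the inner product is set to 0.\<close>

definition vn_algebra :: "('g, 'v, 'z) measure_graph_scheme \<Rightarrow> ('g, 'v) op_family set" where
  "vn_algebra X = {A.
     (\<forall>\<omega> \<in> units X. l2_bounded_op (fiber X \<omega>) (A \<omega>))
   \<and> (\<exists>C. AE \<omega> in base_measure X. l2_opnorm (fiber X \<omega>) (A \<omega>) \<le> C)
   \<and> (\<forall>f \<in> borel_measurable (verts X). \<forall>h \<in> borel_measurable (verts X).
        integrable (vertex_measure X) (\<lambda>x. (cmod (f x))\<^sup>2) \<longrightarrow>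
        integrable (vertex_measure X) (\<lambda>x. (cmod (h x))\<^sup>2) \<longrightarrow>
        (\<lambda>\<omega>. let f' = l2_restrict (fiber X \<omega>) f; h' = l2_restrict (fiber X \<omega>) h in
           if f' \<in> ell2 (fiber X \<omega>) \<and> h' \<in> ell2 (fiber X \<omega>)
           then l2_inner (fiber X \<omega>) h' (A \<omega> f') else 0) \<in> borel_measurable (base_measure X))
   \<and> (\<forall>g \<in> space (arrows X). \<forall>f \<in> ell2 (fiber X (grange X g)).
        A (grange X g) f = translation X g (A (gsource X g) (translation X (ginv X g) f)))}"

definition vn_norm :: "('g, 'v, 'z) measure_graph_scheme \<Rightarrow> ('g, 'v) op_family \<Rightarrow> real" where
  "vn_norm X A =
     Inf {C. 0 \<le> C \<and> (AE \<omega> in base_measure X. l2_opnorm (fiber X \<omega>) (A \<omega>) \<le> C)}"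

definition op_id :: "('g, 'v) op_family" where
  "op_id = (\<lambda>\<omega> f. f)"

definition op_add :: "('g, 'v) op_family \<Rightarrow> ('g, 'v) op_family \<Rightarrow> ('g, 'v) op_family" where
  "op_add A B = (\<lambda>\<omega> f x. A \<omega> f x + B \<omega> f x)"

definition op_scale :: "complex \<Rightarrow> ('g, 'v) op_family \<Rightarrow> ('g, 'v) op_family" where
  "op_scale c A = (\<lambda>\<omega> f x. c * A \<omega> f x)"

definition op_diff :: "('g, 'v) op_family \<Rightarrow> ('g, 'v) op_family \<Rightarrow> ('g, 'v) op_family" where
  "op_diff A B = op_add A (op_scale (-1) B)"

definition op_power :: "('g, 'v) op_family \<Rightarrow> nat \<Rightarrow> ('g, 'v) op_family" where
  "op_power A k = (\<lambda>\<omega>. A \<omega> ^^ k)"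

subsection \<open>Trace and determinant\<close>

definition op_positive :: "('g, 'v, 'z) measure_graph_scheme \<Rightarrow> ('g, 'v) op_family \<Rightarrow> bool" where
  "op_positive X A \<longleftrightarrow> (AE \<omega> in base_measure X. \<forall>f \<in> ell2 (fiber X \<omega>).
     l2_inner (fiber X \<omega>) f (A \<omega> f) \<in> \<real> \<and> 0 \<le> Re (l2_inner (fiber X \<omega>) f (A \<omega> f)))"

definition vn_trace_pos ::
  "('g, 'v, 'z) measure_graph_scheme \<Rightarrow> ('v \<Rightarrow> ennreal) \<Rightarrow> ('g, 'v) op_family \<Rightarrow> ennreal" where
  "vn_trace_pos X u A = (\<integral>\<^sup>+\<omega>. (\<integral>\<^sup>+x. u x *
       ennreal (Re (l2_inner (fiber X \<omega>) (l2_delta x) (A \<omega> (l2_delta x))))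
     \<partial>count_space (fiber X \<omega>)) \<partial>base_measure X)"

definition weighted_diagonal ::
  "('g, 'v, 'z) measure_graph_scheme \<Rightarrow> ('v \<Rightarrow> ennreal) \<Rightarrow> ('g, 'v) op_family \<Rightarrow> 'g \<Rightarrow> complex" where
  "weighted_diagonal X u A \<omega> = (\<Sum>\<^sub>\<infinity>x\<in>fiber X \<omega>.
     of_real (enn2real (u x)) * l2_inner (fiber X \<omega>) (l2_delta x) (A \<omega> (l2_delta x)))"

text \<open>The trace is given on positive elements by \<open>vn_trace_pos\<close> and extended to a norm
  continuous linear functional; as the positive elements span the algebra, this extension is
  unique. It is obtained by reading the same formula as a Bochner integral; see \<open>vn_trace_linear\<close>,
  \<open>vn_trace_bound\<close> and \<open>vn_trace_positive\<close> below. Since \<open>u\<close> has finite integral, it is finite on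
  almost every fiber, so that \<open>enn2real\<close> loses nothing. The completion makes the integral
  insensitive to changes of \<open>A\<close> on null sets of units.\<close>

definition vn_trace ::
  "('g, 'v, 'z) measure_graph_scheme \<Rightarrow> ('v \<Rightarrow> ennreal) \<Rightarrow> ('g, 'v) op_family \<Rightarrow> complex" where
  "vn_trace X u A = (LINT \<omega>|completion (base_measure X). weighted_diagonal X u A \<omega>)"

definition op_log_sum :: "('g, 'v) op_family \<Rightarrow> nat \<Rightarrow> ('g, 'v) op_family" where
  "op_log_sum T n = (\<lambda>\<omega> f x. - (\<Sum>k=1..n. 1 / of_nat k * op_power (op_diff op_id T) k \<omega> f x))"

text \<open>The norm limit is determined up to equality almost everywhere.\<close>

definition vn_log :: "('g, 'v, 'z) measure_graph_scheme \<Rightarrow> ('g, 'v) op_family \<Rightarrow> ('g, 'v) op_family"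
  where
  "vn_log X T = (SOME L. L \<in> vn_algebra X
     \<and> (\<lambda>n. vn_norm X (op_diff L (op_log_sum T n))) \<longlonglongrightarrow> 0)"

definition vn_det ::
  "('g, 'v, 'z) measure_graph_scheme \<Rightarrow> ('v \<Rightarrow> ennreal) \<Rightarrow> ('g, 'v) op_family \<Rightarrow> complex" where
  "vn_det X u T = exp (vn_trace X u (vn_log X T))"

subsection \<open>Adjacency and degree operators\<close>

definition adjacency_op :: "('g, 'v, 'z) graph_over_scheme \<Rightarrow> ('g, 'v) op_family" where
  "adjacency_op X = (\<lambda>\<omega>. \<lambda>f. l2_restrict (fiber X \<omega>) (\<lambda>x. \<Sum>y \<in> edges X `` {x}. f y))"

definition degree_op :: "('g, 'v, 'z) graph_over_scheme \<Rightarrow> ('g, 'v) op_family" where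
  "degree_op X =
     (\<lambda>\<omega>. \<lambda>f. l2_restrict (fiber X \<omega>) (\<lambda>x. of_nat (vertex_degree (edges X) x) * f x))"

definition Q_op :: "('g, 'v, 'z) graph_over_scheme \<Rightarrow> ('g, 'v) op_family" where
  "Q_op X = op_diff (degree_op X) op_id"

definition ihara_op :: "('g, 'v, 'z) graph_over_scheme \<Rightarrow> complex \<Rightarrow> ('g, 'v) op_family" where
  "ihara_op X z =
     op_add (op_diff op_id (op_scale z (adjacency_op X))) (op_scale (z\<^sup>2) (Q_op X))"

definition euler_char ::
  "('g, 'v, 'z) measure_graph_scheme \<Rightarrow> ('v \<Rightarrow> ennreal) \<Rightarrow> complex" where
  "euler_char X u = vn_trace X u (op_diff op_id (Q_op X)) / 2"

section \<open>Adjoint of the translations and extension of the trace\<close>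

text \<open>Under the measurability requirement implicit in the formula for the trace, \<open>vn_trace\<close> is
  linear (\<open>vn_trace_linear\<close>), norm continuous (\<open>vn_trace_bound\<close>) and agrees with the formula
  on positive elements (\<open>vn_trace_positive\<close>).\<close>

lemma (in graph_over) translation_adjoint:
  assumes "g \<in> space (arrows X)"
  shows "l2_inner (fiber X (grange X g)) h (translation X g f)
           = l2_inner (fiber X (gsource X g)) (translation X (ginv X g) h) f"
proof -
  let ?S = "fiber X (gsource X g)" and ?R = "fiber X (grange X g)"
  have r: "grange X (ginv X g) = gsource X g"
    by (simp add: grange_def gsource_def inv_inv assms)
  have mem: "act X g x \<in> ?R" if "x \<in> ?S" for x
    using act_bij[OF assms] that by (auto simp: bij_betw_def)
  have "l2_inner ?R h (translation X g f) = (\<Sum>\<^sub>\<infinity>x\<in>?R. cnj (h x) * translation X g f x)"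
    by (simp add: l2_inner_def)
  also have "\<dots> = (\<Sum>\<^sub>\<infinity>x\<in>?S. cnj (h (act X g x)) * translation X g f (act X g x))"
    by (rule infsum_reindex_bij_betw[OF act_bij[OF assms], symmetric])
  also have "\<dots> = (\<Sum>\<^sub>\<infinity>x\<in>?S. cnj (translation X (ginv X g) h x) * f x)"
    by (intro infsum_cong)
      (simp add: translation_def l2_restrict_def r mem act_inv inv_inv assms)
  finally show ?thesis by (simp add: l2_inner_def)
qed

lemma sets_integrate_kernel [simp]: "sets (integrate_kernel m K N) = sets N"
  unfolding integrate_kernel_def by (simp add: sets.space_closed sets.sigma_sets_eq)

lemma nn_integral_integrate_kernel:
  assumes K: "\<And>\<omega>. \<omega> \<in> space m \<Longrightarrow> sets (K \<omega>) = sets N"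
    and meas: "\<And>F. F \<in> borel_measurable N \<Longrightarrow> (\<lambda>\<omega>. \<integral>\<^sup>+x. F x \<partial>K \<omega>) \<in> borel_measurable m"
    and f: "f \<in> borel_measurable N"
  shows "(\<integral>\<^sup>+x. f x \<partial>integrate_kernel m K N) = (\<integral>\<^sup>+\<omega>. \<integral>\<^sup>+x. f x \<partial>K \<omega> \<partial>m)"
proof -
  have measA: "(\<lambda>\<omega>. emeasure (K \<omega>) A) \<in> borel_measurable m" if "A \<in> sets N" for A
  proof -
    have "(\<lambda>\<omega>. \<integral>\<^sup>+x. indicator A x \<partial>K \<omega>) \<in> borel_measurable m"
      using that by (intro meas) simp
    also have "?this \<longleftrightarrow> ?thesis"
      by (intro measurable_cong nn_integral_indicator) (simp add: K that)
    finally show ?thesis .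
  qed
  have em: "emeasure (integrate_kernel m K N) A = (\<integral>\<^sup>+\<omega>. emeasure (K \<omega>) A \<partial>m)"
    if "A \<in> sets N" for A
  proof (rule emeasure_measure_of[OF integrate_kernel_def])
    show "sets N \<subseteq> Pow (space N)" by (rule sets.space_closed)
    show "positive (sets (integrate_kernel m K N)) (\<lambda>A. \<integral>\<^sup>+\<omega>. emeasure (K \<omega>) A \<partial>m)"
      by (simp add: positive_def)
    show "countably_additive (sets (integrate_kernel m K N)) (\<lambda>A. \<integral>\<^sup>+\<omega>. emeasure (K \<omega>) A \<partial>m)"
      unfolding countably_additive_def sets_integrate_kernel
    proof safe
      fix A :: "nat \<Rightarrow> _" assume A: "range A \<subseteq> sets N" "disjoint_family A"
      have "(\<Sum>i. \<integral>\<^sup>+\<omega>. emeasure (K \<omega>) (A i) \<partial>m) = (\<integral>\<^sup>+\<omega>. (\<Sum>i. emeasure (K \<omega>) (A i)) \<partial>m)"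
        using A by (intro nn_integral_suminf[symmetric] measA) auto
      also have "\<dots> = (\<integral>\<^sup>+\<omega>. emeasure (K \<omega>) (\<Union>(range A)) \<partial>m)"
        using A by (intro nn_integral_cong suminf_emeasure) (auto simp: K)
      finally show "(\<Sum>i. \<integral>\<^sup>+\<omega>. emeasure (K \<omega>) (A i) \<partial>m) = (\<integral>\<^sup>+\<omega>. emeasure (K \<omega>) (\<Union>(range A)) \<partial>m)" .
    qed
  qed (simp add: that)
  have borel_eq: "borel_measurable (integrate_kernel m K N) = (borel_measurable N :: (_ \<Rightarrow> ennreal) set)"
    by (rule measurable_cong_sets) auto
  have borelK: "g \<in> borel_measurable (K \<omega>)"
    if "g \<in> borel_measurable N" "\<omega> \<in> space m" for g :: "_ \<Rightarrow> ennreal" and \<omega>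
    using that measurable_cong_sets[OF K[OF that(2)] refl] by blast
  have space_eq: "space (integrate_kernel m K N) = space N"
    by (rule sets_eq_imp_space_eq) simp
  have "f \<in> borel_measurable (integrate_kernel m K N)" using f borel_eq by simp
  then show ?thesis
  proof induct
    case (cong f g)
    have "(\<integral>\<^sup>+\<omega>. \<integral>\<^sup>+x. f x \<partial>K \<omega> \<partial>m) = (\<integral>\<^sup>+\<omega>. \<integral>\<^sup>+x. g x \<partial>K \<omega> \<partial>m)"
      by (intro nn_integral_cong)
        (use cong(3) K[THEN sets_eq_imp_space_eq] space_eq in auto)
    moreover have "(\<integral>\<^sup>+x. f x \<partial>integrate_kernel m K N) = (\<integral>\<^sup>+x. g x \<partial>integrate_kernel m K N)"
      by (intro nn_integral_cong) (use cong(3) in auto)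
    ultimately show ?case using cong by simp
  next
    case (set A)
    then show ?case
      by (simp add: em) (intro nn_integral_cong, simp add: K)
  next
    case (mult g c)
    have "(\<integral>\<^sup>+\<omega>. \<integral>\<^sup>+x. c * g x \<partial>K \<omega> \<partial>m) = (\<integral>\<^sup>+\<omega>. c * (\<integral>\<^sup>+x. g x \<partial>K \<omega>) \<partial>m)"
      using mult(2) borel_eq by (intro nn_integral_cong nn_integral_cmult borelK) auto
    also have "\<dots> = c * (\<integral>\<^sup>+\<omega>. \<integral>\<^sup>+x. g x \<partial>K \<omega> \<partial>m)"
      using mult(2) borel_eq by (intro nn_integral_cmult meas) auto
    finally show ?case using mult by (simp add: nn_integral_cmult)
  next
    case (add g h)
    have "(\<integral>\<^sup>+\<omega>. \<integral>\<^sup>+x. h x + g x \<partial>K \<omega> \<partial>m) = (\<integral>\<^sup>+\<omega>. (\<integral>\<^sup>+x. h x \<partial>K \<omega>) + (\<integral>\<^sup>+x. g x \<partial>K \<omega>) \<partial>m)"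
      using add borel_eq by (intro nn_integral_cong nn_integral_add borelK) auto
    also have "\<dots> = (\<integral>\<^sup>+\<omega>. \<integral>\<^sup>+x. h x \<partial>K \<omega> \<partial>m) + (\<integral>\<^sup>+\<omega>. \<integral>\<^sup>+x. g x \<partial>K \<omega> \<partial>m)"
      using add borel_eq by (intro nn_integral_add meas) auto
    finally show ?case using add by (simp add: nn_integral_add)
  next
    case (seq U)
    have "(\<integral>\<^sup>+\<omega>. \<integral>\<^sup>+x. (SUP i. U i x) \<partial>K \<omega> \<partial>m) = (\<integral>\<^sup>+\<omega>. (SUP i. \<integral>\<^sup>+x. U i x \<partial>K \<omega>) \<partial>m)"
      using seq borel_eq
      by (intro nn_integral_cong nn_integral_monotone_convergence_SUP borelK) auto
    also have "\<dots> = (SUP i. \<integral>\<^sup>+\<omega>. \<integral>\<^sup>+x. U i x \<partial>K \<omega> \<partial>m)"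
      using seq borel_eq
      by (intro nn_integral_monotone_convergence_SUP meas)
        (auto simp: incseq_def le_fun_def intro!: nn_integral_mono)
    also have "\<dots> = (SUP i. \<integral>\<^sup>+x. U i x \<partial>integrate_kernel m K N)"
      using seq by simp
    also have "\<dots> = (\<integral>\<^sup>+x. (SUP i. U i x) \<partial>integrate_kernel m K N)"
      using seq by (intro nn_integral_monotone_convergence_SUP[symmetric]) auto
    finally show ?case by (simp add: image_comp SUP_apply)
  qed
qed

lemma (in measure_graph) nn_integral_vertex_measure:
  assumes f: "f \<in> borel_measurable (verts X)"
  shows "(\<integral>\<^sup>+x. f x \<partial>vertex_measure X)
           = (\<integral>\<^sup>+\<omega>. \<integral>\<^sup>+x. f x \<partial>count_space (fiber X \<omega>) \<partial>base_measure X)"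
    and "(\<lambda>\<omega>. \<integral>\<^sup>+x. f x \<partial>count_space (fiber X \<omega>)) \<in> borel_measurable (base_measure X)"
proof -
  have sb: "sets (base_measure X) = sets (unit_space X)"
    using invariant unfolding invariant_measure_def by blast
  have borel_eq: "borel_measurable (base_measure X) = borel_measurable (unit_space X)"
    by (rule measurable_cong_sets[OF sb refl])
  have rv: "(\<integral>\<^sup>+x. g x \<partial>canonical_rv X \<omega>) = (\<integral>\<^sup>+x. g x \<partial>count_space (fiber X \<omega>))"
    if "g \<in> borel_measurable (verts X)" for g \<omega>
    unfolding canonical_rv_def using that
    by (intro nn_integral_distr) (auto simp: fiber_def)
  have "(\<integral>\<^sup>+x. f x \<partial>vertex_measure X)
          = (\<integral>\<^sup>+\<omega>. \<integral>\<^sup>+x. f x \<partial>canonical_rv X \<omega> \<partial>base_measure X)"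
    unfolding vertex_measure_def
    by (rule nn_integral_integrate_kernel)
      (auto simp: canonical_rv_def[of X] f borel_eq
        intro: canonical_rv_measurable[unfolded canonical_rv_def])
  then show "(\<integral>\<^sup>+x. f x \<partial>vertex_measure X)
           = (\<integral>\<^sup>+\<omega>. \<integral>\<^sup>+x. f x \<partial>count_space (fiber X \<omega>) \<partial>base_measure X)"
    by (simp add: rv[OF f])
  show "(\<lambda>\<omega>. \<integral>\<^sup>+x. f x \<partial>count_space (fiber X \<omega>)) \<in> borel_measurable (base_measure X)"
    using canonical_rv_measurable[OF f] by (simp add: rv[OF f] borel_eq)
qed

lemma l2_norm_ge_component:
  assumes "f \<in> ell2 S" "x \<in> S"
  shows "cmod (f x) \<le> l2_norm S f"
proof -
  have "(\<Sum>\<^sub>\<infinity>y\<in>{x}. (cmod (f y))\<^sup>2) \<le> (\<Sum>\<^sub>\<infinity>y\<in>S. (cmod (f y))\<^sup>2)"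
    using assms by (intro infsum_mono_neutral) (auto simp: ell2_def)
  then show ?thesis
    unfolding l2_norm_def by (intro real_le_rsqrt) simp
qed

lemma l2_norm_nonneg: "0 \<le> l2_norm S f"
  unfolding l2_norm_def by (intro real_sqrt_ge_zero infsum_nonneg) simp

lemma l2_delta:
  assumes "x \<in> S"
  shows "l2_delta x \<in> ell2 S" "l2_norm S (l2_delta x) = 1" "l2_inner S (l2_delta x) f = f x"
proof -
  have *: "(\<lambda>y. (cmod (l2_delta x y))\<^sup>2) = (\<lambda>y. of_bool (y = x))"
    by (auto simp: l2_delta_def)
  have "(\<lambda>y. of_bool (y = x) :: real) summable_on S \<longleftrightarrow> (\<lambda>y. 1 :: real) summable_on {x}"
    using assms by (intro summable_on_cong_neutral) auto
  then show "l2_delta x \<in> ell2 S"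
    using assms unfolding ell2_def mem_Collect_eq * by (auto simp: l2_delta_def)
  have "(\<Sum>\<^sub>\<infinity>y\<in>S. of_bool (y = x) :: real) = (\<Sum>\<^sub>\<infinity>y\<in>{x}. 1)"
    using assms by (intro infsum_cong_neutral) auto
  then show "l2_norm S (l2_delta x) = 1" unfolding l2_norm_def * by simp
  have "(\<Sum>\<^sub>\<infinity>y\<in>S. cnj (l2_delta x y) * f y) = (\<Sum>\<^sub>\<infinity>y\<in>{x}. f y)"
    using assms by (intro infsum_cong_neutral) (auto simp: l2_delta_def)
  then show "l2_inner S (l2_delta x) f = f x" unfolding l2_inner_def by simp
qed

lemma l2_opnorm_bound:
  assumes "l2_bounded_op S T" "f \<in> ell2 S"
  shows "l2_norm S (T f) \<le> l2_opnorm S T * l2_norm S f"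
proof -
  let ?B = "{C. 0 \<le> C \<and> (\<forall>f \<in> ell2 S. l2_norm S (T f) \<le> C * l2_norm S f)}"
  obtain C where C: "\<forall>f \<in> ell2 S. l2_norm S (T f) \<le> C * l2_norm S f"
    using assms unfolding l2_bounded_op_def by blast
  have "max C 0 \<in> ?B"
    using C by (auto intro: order_trans[OF _ mult_right_mono[OF max.cobounded1 l2_norm_nonneg]])
  then have ne: "?B \<noteq> {}" by blast
  show ?thesis
  proof (cases "l2_norm S f = 0")
    case True
    then show ?thesis using C assms by fastforce
  next
    case False
    then have pos: "0 < l2_norm S f" using l2_norm_nonneg[of S f] by simp
    have "l2_norm S (T f) / l2_norm S f \<le> l2_opnorm S T"
      unfolding l2_opnorm_def
      by (rule cInf_greatest[OF ne]) (use assms pos in \<open>auto simp: divide_le_eq\<close>)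
    then show ?thesis using pos by (simp add: divide_le_eq)
  qed
qed

lemma infsum_ennreal_count_space:
  fixes f :: "'a \<Rightarrow> real"
  assumes "\<And>x. x \<in> S \<Longrightarrow> 0 \<le> f x" "(\<integral>\<^sup>+x. ennreal (f x) \<partial>count_space S) < \<infinity>"
  shows "f summable_on S" "ennreal (\<Sum>\<^sub>\<infinity>x\<in>S. f x) = (\<integral>\<^sup>+x. ennreal (f x) \<partial>count_space S)"
proof -
  have "integrable (count_space S) f"
    using assms by (intro integrableI_nonneg) (auto simp: AE_count_space)
  then have a: "Infinite_Set_Sum.abs_summable_on f S"
    by (simp add: Infinite_Set_Sum.abs_summable_on_def)
  then have b: "Infinite_Sum.abs_summable_on f S" by (simp only: abs_summable_equivalent)
  then show "f summable_on S" by (rule abs_summable_summable)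
  show "ennreal (\<Sum>\<^sub>\<infinity>x\<in>S. f x) = (\<integral>\<^sup>+x. ennreal (f x) \<partial>count_space S)"
    using nn_integral_conv_infsetsum[OF a] infsetsum_infsum[OF a] assms by simp
qed

context measure_graph
begin

context
  fixes u :: "'v \<Rightarrow> ennreal"
  assumes u: "u \<in> borel_measurable (verts X)" "(\<integral>\<^sup>+x. u x \<partial>vertex_measure X) < \<infinity>"
begin

lemma space_base_measure: "space (base_measure X) = units X"
proof -
  have "space (base_measure X) = space (unit_space X)"
    using invariant unfolding invariant_measure_def by (intro sets_eq_imp_space_eq) blast
  then show ?thesis by (auto simp: unit_space_def space_restrict_space units_def)
qed

lemma AE_fiber_weight_finite:
  "AE \<omega> in base_measure X. (\<integral>\<^sup>+x. u x \<partial>count_space (fiber X \<omega>)) < \<infinity>"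
  using nn_integral_PInf_AE[OF nn_integral_vertex_measure(2)[OF u(1)]]
    nn_integral_vertex_measure(1)[OF u(1)] u(2)
  by (auto simp: top.not_eq_extremum)

lemma weighted_diagonal_summable:
  assumes "\<omega> \<in> units X" "(\<integral>\<^sup>+x. u x \<partial>count_space (fiber X \<omega>)) < \<infinity>"
    and "l2_bounded_op (fiber X \<omega>) (A \<omega>)" "l2_opnorm (fiber X \<omega>) (A \<omega>) \<le> C"
  shows "\<And>x. x \<in> fiber X \<omega> \<Longrightarrow> ennreal (enn2real (u x)) = u x"
    and "\<And>x. x \<in> fiber X \<omega> \<Longrightarrow> cmod (A \<omega> (l2_delta x) x) \<le> C"
    and "(\<lambda>x. cmod (of_real (enn2real (u x)) * A \<omega> (l2_delta x) x)) summable_on fiber X \<omega>"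
    and "weighted_diagonal X u A \<omega>
      = (\<Sum>\<^sub>\<infinity>x\<in>fiber X \<omega>. of_real (enn2real (u x)) * A \<omega> (l2_delta x) x)"
    and "ennreal (cmod (weighted_diagonal X u A \<omega>))
      \<le> ennreal C * (\<integral>\<^sup>+x. u x \<partial>count_space (fiber X \<omega>))"
proof -
  let ?S = "fiber X \<omega>"
  show ufin: "ennreal (enn2real (u x)) = u x" if "x \<in> ?S" for x
  proof -
    have "u x \<le> (\<integral>\<^sup>+x. u x \<partial>count_space ?S)"
      using that by (rule nn_integral_ge_point)
    then show ?thesis using assms(2) by (intro ennreal_enn2real) (auto simp: less_top[symmetric] top_unique)
  qed
  show dC: "cmod (A \<omega> (l2_delta x) x) \<le> C" if "x \<in> ?S" for x
  proof -
    have "A \<omega> (l2_delta x) \<in> ell2 ?S"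
      using assms(3) l2_delta(1)[OF that] unfolding l2_bounded_op_def by blast
    then have "cmod (A \<omega> (l2_delta x) x) \<le> l2_norm ?S (A \<omega> (l2_delta x))"
      using that by (rule l2_norm_ge_component)
    also have "\<dots> \<le> l2_opnorm ?S (A \<omega>)"
      using l2_opnorm_bound[OF assms(3) l2_delta(1)[OF that]] l2_delta(2)[OF that] by simp
    finally show ?thesis using assms(4) by simp
  qed
  let ?w = "\<lambda>x. enn2real (u x)"
  have eqw: "(\<integral>\<^sup>+x. ennreal (?w x) \<partial>count_space ?S) = (\<integral>\<^sup>+x. u x \<partial>count_space ?S)"
    by (intro nn_integral_cong) (simp add: ufin)
  have ws: "?w summable_on ?S"
      "ennreal (\<Sum>\<^sub>\<infinity>x\<in>?S. ?w x) = (\<integral>\<^sup>+x. u x \<partial>count_space ?S)"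
    using infsum_ennreal_count_space[of ?S ?w] assms(2) eqw by auto
  have Cws: "(\<lambda>x. C * ?w x) summable_on ?S"
    by (rule summable_on_cmult_right[OF ws(1)])
  show sm: "(\<lambda>x. cmod (of_real (?w x) * A \<omega> (l2_delta x) x)) summable_on ?S"
    by (rule summable_on_comparison_test[OF Cws])
      (auto simp: norm_mult mult.commute[of C] intro!: mult_left_mono dC)
  show wd: "weighted_diagonal X u A \<omega> = (\<Sum>\<^sub>\<infinity>x\<in>?S. of_real (?w x) * A \<omega> (l2_delta x) x)"
    unfolding weighted_diagonal_def by (intro infsum_cong) (simp add: l2_delta(3))
  show "ennreal (cmod (weighted_diagonal X u A \<omega>)) \<le> ennreal C * (\<integral>\<^sup>+x. u x \<partial>count_space ?S)"
  proof (cases "?S = {}")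
    case True
    then show ?thesis by (simp add: wd)
  next
    case False
    then have C0: "0 \<le> C" using dC norm_ge_zero order_trans by blast
    have "cmod (weighted_diagonal X u A \<omega>) \<le> (\<Sum>\<^sub>\<infinity>x\<in>?S. cmod (of_real (?w x) * A \<omega> (l2_delta x) x))"
      unfolding wd by (rule norm_infsum_bound[OF sm])
    also have "\<dots> \<le> (\<Sum>\<^sub>\<infinity>x\<in>?S. C * ?w x)"
      by (rule infsum_mono[OF sm Cws])
        (auto simp: norm_mult mult.commute[of C] intro!: mult_left_mono dC)
    also have "\<dots> = C * (\<Sum>\<^sub>\<infinity>x\<in>?S. ?w x)"
      by (rule infsum_cmult_right')
    finally show ?thesis
      using C0 by (simp add: ws(2)[symmetric] ennreal_mult'[symmetric] ennreal_leI)
  qed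
qed

lemma vn_bounded:
  assumes "A \<in> vn_algebra X"
  obtains C where "0 \<le> C" "AE \<omega> in base_measure X. l2_opnorm (fiber X \<omega>) (A \<omega>) \<le> C"
proof -
  obtain C where C: "AE \<omega> in base_measure X. l2_opnorm (fiber X \<omega>) (A \<omega>) \<le> C"
    using assms unfolding vn_algebra_def by blast
  then have "AE \<omega> in base_measure X. l2_opnorm (fiber X \<omega>) (A \<omega>) \<le> max C 0"
    by (rule AE_mp) (simp add: le_max_iff_disj)
  then show ?thesis by (intro that[of "max C 0"]) auto
qed

lemma vn_op: "A \<in> vn_algebra X \<Longrightarrow> \<omega> \<in> units X \<Longrightarrow> l2_bounded_op (fiber X \<omega>) (A \<omega>)"
  unfolding vn_algebra_def by blast

lemma weighted_diagonal_bound: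
  assumes "A \<in> vn_algebra X" "0 \<le> C" "AE \<omega> in base_measure X. l2_opnorm (fiber X \<omega>) (A \<omega>) \<le> C"
  shows "(\<integral>\<^sup>+\<omega>. cmod (weighted_diagonal X u A \<omega>) \<partial>base_measure X)
           \<le> ennreal C * (\<integral>\<^sup>+x. u x \<partial>vertex_measure X)"
proof -
  have "(\<integral>\<^sup>+\<omega>. cmod (weighted_diagonal X u A \<omega>) \<partial>base_measure X)
      \<le> (\<integral>\<^sup>+\<omega>. ennreal C * (\<integral>\<^sup>+x. u x \<partial>count_space (fiber X \<omega>)) \<partial>base_measure X)"
  proof (rule nn_integral_mono_AE)
    show "AE \<omega> in base_measure X. ennreal (cmod (weighted_diagonal X u A \<omega>))
        \<le> ennreal C * (\<integral>\<^sup>+x. u x \<partial>count_space (fiber X \<omega>))"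
      using AE_fiber_weight_finite assms(3) AE_space
    proof eventually_elim
      case (elim \<omega>)
      then show ?case
        using weighted_diagonal_summable(5)[of \<omega> A C] vn_op[OF assms(1)] space_base_measure by blast
    qed
  qed
  also have "\<dots> = ennreal C * (\<integral>\<^sup>+x. u x \<partial>vertex_measure X)"
    by (simp add: nn_integral_cmult nn_integral_vertex_measure[OF u(1)])
  finally show ?thesis .
qed

lemma weighted_diagonal_integrable:
  assumes "A \<in> vn_algebra X" "weighted_diagonal X u A \<in> borel_measurable (completion (base_measure X))"
  shows "integrable (completion (base_measure X)) (weighted_diagonal X u A)"
proof -
  obtain C where C: "0 \<le> C" "AE \<omega> in base_measure X. l2_opnorm (fiber X \<omega>) (A \<omega>) \<le> C"
    using vn_bounded[OF assms(1)] .
  have "(\<integral>\<^sup>+\<omega>. cmod (weighted_diagonal X u A \<omega>) \<partial>base_measure X) < \<infinity>"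
    by (rule le_less_trans[OF weighted_diagonal_bound[OF assms(1) C]])
      (use u(2) in \<open>simp add: ennreal_mult_less_top\<close>)
  then show ?thesis using assms(2) by (intro integrableI_bounded) (auto simp: nn_integral_completion)
qed

lemma vn_trace_linear:
  assumes "A \<in> vn_algebra X" "B \<in> vn_algebra X"
    and "weighted_diagonal X u A \<in> borel_measurable (completion (base_measure X))"
    and "weighted_diagonal X u B \<in> borel_measurable (completion (base_measure X))"
    and "weighted_diagonal X u (op_add (op_scale c A) B) \<in> borel_measurable (completion (base_measure X))"
  shows "vn_trace X u (op_add (op_scale c A) B) = c * vn_trace X u A + vn_trace X u B"
proof -
  obtain C where C: "AE \<omega> in base_measure X. l2_opnorm (fiber X \<omega>) (A \<omega>) \<le> C"
    using vn_bounded[OF assms(1)] .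
  obtain C' where C': "AE \<omega> in base_measure X. l2_opnorm (fiber X \<omega>) (B \<omega>) \<le> C'"
    using vn_bounded[OF assms(2)] .
  have "AE \<omega> in base_measure X. weighted_diagonal X u (op_add (op_scale c A) B) \<omega>
      = c * weighted_diagonal X u A \<omega> + weighted_diagonal X u B \<omega>"
    using AE_fiber_weight_finite C C' AE_space
  proof eventually_elim
    case (elim \<omega>)
    then have \<omega>: "\<omega> \<in> units X" using space_base_measure by simp
    note a = weighted_diagonal_summable[where A = A and \<omega> = \<omega>, OF \<omega> elim(1) vn_op[OF assms(1) \<omega>] elim(2)]
    note b = weighted_diagonal_summable[where A = B and \<omega> = \<omega>, OF \<omega> elim(1) vn_op[OF assms(2) \<omega>] elim(3)]
    let ?S = "fiber X \<omega>" and ?w = "\<lambda>x. complex_of_real (enn2real (u x))"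
    have "weighted_diagonal X u (op_add (op_scale c A) B) \<omega>
        = (\<Sum>\<^sub>\<infinity>x\<in>?S. c * (?w x * A \<omega> (l2_delta x) x) + ?w x * B \<omega> (l2_delta x) x)"
      unfolding weighted_diagonal_def
      by (intro infsum_cong) (simp add: l2_delta(3) op_add_def op_scale_def algebra_simps)
    also have "\<dots> = (\<Sum>\<^sub>\<infinity>x\<in>?S. c * (?w x * A \<omega> (l2_delta x) x))
        + (\<Sum>\<^sub>\<infinity>x\<in>?S. ?w x * B \<omega> (l2_delta x) x)"
      by (rule infsum_add[OF summable_on_cmult_right[OF abs_summable_summable[OF a(3)]]
            abs_summable_summable[OF b(3)]])
    also have "\<dots> = c * weighted_diagonal X u A \<omega> + weighted_diagonal X u B \<omega>"
      by (simp add: a(4) b(4) infsum_cmult_right')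
    finally show ?case .
  qed
  note eq = this
  note [measurable] = assms(3,4,5)
  have "vn_trace X u (op_add (op_scale c A) B)
      = (LINT \<omega>|completion (base_measure X). c * weighted_diagonal X u A \<omega> + weighted_diagonal X u B \<omega>)"
    unfolding vn_trace_def by (rule integral_cong_AE[OF _ _ AE_completion[OF eq]]) measurable
  also have "\<dots> = c * vn_trace X u A + vn_trace X u B"
    unfolding vn_trace_def
    by (simp add: Bochner_Integration.integral_add integrable_mult_right
        weighted_diagonal_integrable[OF assms(1,3)] weighted_diagonal_integrable[OF assms(2,4)])
  finally show ?thesis .
qed

lemma vn_trace_bound:
  assumes "A \<in> vn_algebra X" "weighted_diagonal X u A \<in> borel_measurable (completion (base_measure X))"
  shows "cmod (vn_trace X u A) \<le> vn_norm X A * enn2real (\<integral>\<^sup>+x. u x \<partial>vertex_measure X)"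
proof -
  let ?E = "enn2real (\<integral>\<^sup>+x. u x \<partial>vertex_measure X)"
  have E: "ennreal ?E = (\<integral>\<^sup>+x. u x \<partial>vertex_measure X)" "0 \<le> ?E"
    using u(2) by (auto intro: ennreal_enn2real)
  let ?B = "{C. 0 \<le> C \<and> (AE \<omega> in base_measure X. l2_opnorm (fiber X \<omega>) (A \<omega>) \<le> C)}"
  have B: "cmod (vn_trace X u A) \<le> C * ?E" if "C \<in> ?B" for C
  proof -
    have "ennreal (cmod (vn_trace X u A)) \<le> (\<integral>\<^sup>+\<omega>. cmod (weighted_diagonal X u A \<omega>) \<partial>base_measure X)"
      unfolding vn_trace_def
      by (rule integral_norm_bound_ennreal[OF weighted_diagonal_integrable[OF assms],
            unfolded nn_integral_completion])
    also have "\<dots> \<le> ennreal C * ennreal ?E"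
      unfolding E using that by (intro weighted_diagonal_bound assms) auto
    also have "\<dots> = ennreal (C * ?E)" using that by (simp add: ennreal_mult')
    finally show ?thesis using that E(2) by (subst (asm) ennreal_le_iff) auto
  qed
  obtain C where C: "C \<in> ?B" using vn_bounded[OF assms(1)] by auto
  show ?thesis
  proof (cases "?E = 0")
    case True
    then show ?thesis using B[OF C] by simp
  next
    case False
    then have pos: "0 < ?E" using E(2) by linarith
    have "cmod (vn_trace X u A) / ?E \<le> C" if "C \<in> ?B" for C
      using B[OF that] pos by (simp only: pos_divide_le_eq)
    then have "cmod (vn_trace X u A) / ?E \<le> vn_norm X A"
      unfolding vn_norm_def using C by (intro cInf_greatest) blast+
    then show ?thesis using pos by (simp only: pos_divide_le_eq)
  qed
qed

lemma vn_trace_positive: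
  assumes "A \<in> vn_algebra X" "weighted_diagonal X u A \<in> borel_measurable (completion (base_measure X))"
    and "op_positive X A"
  shows "vn_trace X u A = of_real (enn2real (vn_trace_pos X u A))"
proof -
  obtain C where C: "AE \<omega> in base_measure X. l2_opnorm (fiber X \<omega>) (A \<omega>) \<le> C"
    using vn_bounded[OF assms(1)] .
  let ?d = "weighted_diagonal X u A"
  have *: "AE \<omega> in base_measure X. ?d \<omega> = of_real (Re (?d \<omega>)) \<and> 0 \<le> Re (?d \<omega>) \<and>
      ennreal (Re (?d \<omega>)) = (\<integral>\<^sup>+x. u x *
       ennreal (Re (l2_inner (fiber X \<omega>) (l2_delta x) (A \<omega> (l2_delta x)))) \<partial>count_space (fiber X \<omega>))"
    using AE_fiber_weight_finite C assms(3)[unfolded op_positive_def] AE_space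
  proof eventually_elim
    case (elim \<omega>)
    then have \<omega>: "\<omega> \<in> units X" using space_base_measure by simp
    note a = weighted_diagonal_summable[where A = A and \<omega> = \<omega>, OF \<omega> elim(1) vn_op[OF assms(1) \<omega>] elim(2)]
    let ?S = "fiber X \<omega>" and ?w = "\<lambda>x. enn2real (u x)" and ?e = "\<lambda>x. Re (A \<omega> (l2_delta x) x)"
    have e: "A \<omega> (l2_delta x) x = of_real (?e x)" "0 \<le> ?e x" if "x \<in> ?S" for x
      using elim(3)[rule_format, OF l2_delta(1)[OF that]]
      by (auto simp: l2_delta(3)[OF that] of_real_Re)
    have n: "(\<integral>\<^sup>+x. ennreal (?w x * ?e x) \<partial>count_space ?S)
        = (\<integral>\<^sup>+x. u x * ennreal (Re (l2_inner ?S (l2_delta x) (A \<omega> (l2_delta x)))) \<partial>count_space ?S)"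
      by (intro nn_integral_cong) (simp add: ennreal_mult' a(1) l2_delta(3))
    have "(\<integral>\<^sup>+x. ennreal (?w x * ?e x) \<partial>count_space ?S) \<le> (\<integral>\<^sup>+x. ennreal C * u x \<partial>count_space ?S)"
    proof (intro nn_integral_mono)
      fix x assume "x \<in> space (count_space ?S)"
      then have x: "x \<in> ?S" by simp
      have "?w x * ?e x \<le> C * ?w x"
        using a(2)[OF x] complex_Re_le_cmod[of "A \<omega> (l2_delta x) x"]
        by (subst mult.commute) (intro mult_right_mono, auto)
      moreover have "0 \<le> C" using a(2)[OF x] norm_ge_zero order_trans by blast
      ultimately show "ennreal (?w x * ?e x) \<le> ennreal C * u x"
        using a(1)[OF x] by (metis ennreal_leI ennreal_mult')
    qed
    also have "\<dots> < \<infinity>"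
      using elim(1) by (simp add: nn_integral_cmult ennreal_mult_less_top)
    finally have fin: "(\<integral>\<^sup>+x. ennreal (?w x * ?e x) \<partial>count_space ?S) < \<infinity>" .
    have "?w x * ?e x \<ge> 0" if "x \<in> ?S" for x using e(2)[OF that] by simp
    then have sm: "(\<lambda>x. ?w x * ?e x) summable_on ?S"
      using infsum_ennreal_count_space(1)[OF _ fin] by blast
    have "?d \<omega> = (\<Sum>\<^sub>\<infinity>x\<in>?S. complex_of_real (?w x * ?e x))"
      unfolding a(4) by (intro infsum_cong) (simp only: of_real_mult e(1)[symmetric])
    also have "\<dots> = of_real (\<Sum>\<^sub>\<infinity>x\<in>?S. ?w x * ?e x)"
      using sm by (intro infsumI) (simp only: has_sum_of_real_iff has_sum_infsum)
    finally have d: "?d \<omega> = of_real (\<Sum>\<^sub>\<infinity>x\<in>?S. ?w x * ?e x)" .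
    have s: "ennreal (\<Sum>\<^sub>\<infinity>x\<in>?S. ?w x * ?e x) = (\<integral>\<^sup>+x. ennreal (?w x * ?e x) \<partial>count_space ?S)"
      using infsum_ennreal_count_space(2)[OF _ fin] e(2) by simp
    have "0 \<le> (\<Sum>\<^sub>\<infinity>x\<in>?S. ?w x * ?e x)" using e(2) by (intro infsum_nonneg) simp
    then show ?case using d n s by simp
  qed
  have d1: "AE \<omega> in base_measure X. ?d \<omega> = of_real (Re (?d \<omega>))"
    using * by (rule AE_mp) (intro AE_I2 impI, elim conjE)
  have d2: "AE \<omega> in base_measure X. 0 \<le> Re (?d \<omega>)"
    using * by (rule AE_mp) (intro AE_I2 impI, elim conjE)
  have d3: "AE \<omega> in base_measure X. ennreal (Re (?d \<omega>)) = (\<integral>\<^sup>+x. u x *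
       ennreal (Re (l2_inner (fiber X \<omega>) (l2_delta x) (A \<omega> (l2_delta x)))) \<partial>count_space (fiber X \<omega>))"
    using * by (rule AE_mp) (intro AE_I2 impI, elim conjE)
  have [measurable]: "?d \<in> borel_measurable (completion (base_measure X))" by (rule assms(2))
  have "vn_trace X u A = (LINT \<omega>|completion (base_measure X). complex_of_real (Re (?d \<omega>)))"
    unfolding vn_trace_def by (rule integral_cong_AE[OF _ _ AE_completion[OF d1]]) measurable
  also have "\<dots> = of_real (LINT \<omega>|completion (base_measure X). Re (?d \<omega>))"
    by (rule integral_complex_of_real)
  also have "(LINT \<omega>|completion (base_measure X). Re (?d \<omega>)) = enn2real (\<integral>\<^sup>+\<omega>. ennreal (Re (?d \<omega>)) \<partial>base_measure X)"
    by (rule integral_eq_nn_integral[OF _ AE_completion[OF d2], unfolded nn_integral_completion]) measurable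
  also have "(\<integral>\<^sup>+\<omega>. ennreal (Re (?d \<omega>)) \<partial>base_measure X) = vn_trace_pos X u A"
    unfolding vn_trace_pos_def by (rule nn_integral_cong_AE[OF d3])
  finally show ?thesis .
qed

end

end

end

theory Submission
  imports Defs "HOL-Probability.Giry_Monad"
begin

text \<open>Write \<open>A\<close> for the adjacency operator, \<open>q = degree - 1\<close> for the function by which \<open>Q\<close> multiplies, and
call \<open>\<integral> f u dM\<close> the mean of a function \<open>f\<close> on the vertices. The logarithms of the zeta function and
of the determinant are power series in \<open>z\<close>, and the theorem compares their coefficients.

Determinant. With \<open>B = z A - z\<^sup>2 Q\<close> the trace of the logarithm is \<open>- (\<Sum>k. \<tau>(B\<^sup>k) / k)\<close>. Expanding
\<open>B\<^sup>k\<close> into words in the letters \<open>A\<close> (of weight 1) and \<open>-Q\<close> (of weight 2) turns this into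
\<open>- (\<Sum>w. z\<^sup>n T(w) / length w)\<close>, where \<open>n\<close> is the weight of the word \<open>w\<close> and \<open>T(w)\<close> the mean of the
diagonal of its kernel. On each fiber \<open>B\<close> has norm at most \<open>\<bar>z\<bar> D + \<bar>z\<bar>\<^sup>2 D\<close>, and the inverse of \<open>R\<close> is
the positive root of \<open>D t + D t\<^sup>2 = 1\<close>; so the bound on \<open>z\<close> makes the sum over all words converge
absolutely (\<open>local_operator_hop\<close>, \<open>word_term_summable\<close>).

Counting. The sum \<open>W\<^sub>n\<close> of the kernels of all words of weight \<open>n\<close> is the coefficient of \<open>z\<^sup>n\<close> in the
inverse of \<open>I - z A + z\<^sup>2 Q\<close>. Non-backtracking walks with \<open>n + 2\<close> edges are counted by
\<open>W\<^sub>n\<^sub>+\<^sub>2 - W\<^sub>n\<close> (\<open>nb_walks_Suc_eq\<close>). A reduced closed path is a closed non-backtracking walk without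
tail, and a walk with a tail is a shorter closed walk at a neighbour together with the edge to it.
Counting the tails from the neighbour instead of the start shows that the mean number of reduced
closed paths of length \<open>n + 2\<close> is the mean of the diagonal of \<open>W\<^sub>n\<^sub>+\<^sub>2 - Q W\<^sub>n\<close>, minus the mean of
\<open>1 - q\<close> if \<open>n\<close> is even (\<open>mean_closed_weighted_walks\<close>). Since \<open>T\<close> does not change under rotation of
words, averaging the weight of the first letter over all rotations shows that the mean of the
diagonal of \<open>W\<^sub>n\<^sub>+\<^sub>2 - Q W\<^sub>n\<close> is \<open>n + 2\<close> times the sum of \<open>T(w) / length w\<close> over the words of weight
\<open>n + 2\<close> (\<open>cyclic_word_sum\<close>). Hence the words account for the determinant, and the remaining terms of
even degree sum to the Euler characteristic times the logarithm of \<open>1 - z\<^sup>2\<close>.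

Transport. Moving tails to a neighbour and rotating words are both instances of one identity: for
an invariant kernel \<open>\<phi>\<close>, the functions \<open>\<Sum>y\<sim>x. \<phi> x y\<close> and \<open>\<Sum>y\<sim>x. \<phi> y x\<close> of \<open>x\<close> have the same mean
(\<open>edge_transport\<close>). This is where the groupoid enters: inserting \<open>1 = \<integral> u(g\<inverse>y) d\<nu>(g)\<close> and inverting
\<open>g\<close>, which preserves \<open>m \<circ> \<nu>\<close>, moves the weight \<open>u\<close> from one vertex to the other
(\<open>mass_transport_nonneg\<close>). The same argument with the identity kernel shows that all averaging
functions have the same integral, which is therefore finite.

Measurability. The \<open>\<sigma>\<close>-algebra of the vertices may fail to separate points, as can happen for two
vertices with the same neighbours, and then the diagonal is not a measurable set of pairs. Kernels
such as \<open>W\<^sub>n\<close> are therefore only measurable up to a function on the diagonal. This class is stable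
under multiplication by \<open>A\<close> and \<open>Q\<close>, contains what the recursions for non-backtracking walks
produce, and suffices because edges avoid the diagonal.\<close>

section \<open>Groupoid actions on fibers\<close>

context groupoid
begin

lemma grange_ginv [simp]: "g \<in> space (arrows X) \<Longrightarrow> grange X (ginv X g) = gsource X g"
  by (simp add: grange_def gsource_def inv_inv)

lemma gsource_ginv [simp]: "g \<in> space (arrows X) \<Longrightarrow> gsource X (ginv X g) = grange X g"
  by (simp add: grange_def gsource_def inv_inv)

end

context graph_over
begin

lemma space_unit_space: "space (unit_space X) = units X"
  by (auto simp: unit_space_def space_restrict_space units_def)

lemma grange_units: "g \<in> space (arrows X) \<Longrightarrow> grange X g \<in> units X"
  using measurable_space[OF range_measurable] space_unit_space by blast

lemma gsource_units: "g \<in> space (arrows X) \<Longrightarrow> gsource X g \<in> units X"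
  using measurable_space[OF source_measurable] space_unit_space by blast

lemma proj_units: "x \<in> space (verts X) \<Longrightarrow> proj X x \<in> units X"
  using measurable_space[OF proj_measurable] space_unit_space by blast

abbreviation \<eta> :: "'g \<Rightarrow> 'v measure" where
  "\<eta> \<omega> \<equiv> count_space (fiber X \<omega>)"

lemma act_fiber:
  "g \<in> space (arrows X) \<Longrightarrow> x \<in> fiber X (gsource X g) \<Longrightarrow> act X g x \<in> fiber X (grange X g)"
  using act_bij by (auto simp: bij_betw_def)

lemma act_ginv_fiber:
  "g \<in> space (arrows X) \<Longrightarrow> x \<in> fiber X (grange X g) \<Longrightarrow> act X (ginv X g) x \<in> fiber X (gsource X g)"
  using act_fiber[of "ginv X g" x] by (simp add: inv_closed)

lemma act_act_ginv:
  "g \<in> space (arrows X) \<Longrightarrow> x \<in> fiber X (grange X g) \<Longrightarrow> act X g (act X (ginv X g) x) = x"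
  using act_inv[of "ginv X g" x] by (simp add: inv_closed inv_inv)

lemma fiber_subset: "fiber X \<omega> \<subseteq> space (verts X)"
  by (auto simp: fiber_def)

lemma fiber_proj: "x \<in> space (verts X) \<Longrightarrow> x \<in> fiber X (proj X x)"
  by (simp add: fiber_def)

lemma in_fiber_iff: "x \<in> fiber X \<omega> \<longleftrightarrow> x \<in> space (verts X) \<and> proj X x = \<omega>"
  by (simp add: fiber_def)

lemma nn_integral_canonical_rv:
  "f \<in> borel_measurable (verts X)
    \<Longrightarrow> (\<integral>\<^sup>+x. f x \<partial>canonical_rv X \<omega>) = (\<integral>\<^sup>+x. f x \<partial>\<eta> \<omega>)"
  unfolding canonical_rv_def by (intro nn_integral_distr) (auto simp: fiber_def)

lemma arrows_to_sets: "\<omega> \<in> units X \<Longrightarrow> arrows_to X \<omega> \<in> sets (arrows X)"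
proof -
  assume \<omega>: "\<omega> \<in> units X"
  have "grange X -` {\<omega>} \<inter> space (arrows X) \<in> sets (arrows X)"
    by (rule measurable_sets[OF range_measurable unit_singleton[OF \<omega>]])
  also have "grange X -` {\<omega>} \<inter> space (arrows X) = arrows_to X \<omega>"
    by (auto simp: arrows_to_def)
  finally show ?thesis .
qed

end

context measure_graph
begin

lemma sets_base_measure: "sets (base_measure X) = sets (unit_space X)"
  using invariant unfolding invariant_measure_def by blast

lemma space_base: "space (base_measure X) = units X"
  using sets_eq_imp_space_eq[OF sets_base_measure] space_unit_space by simp

lemma borel_base: "borel_measurable (base_measure X) = borel_measurable (unit_space X)"
  by (rule measurable_cong_sets[OF sets_base_measure refl])

lemma sets_vertex_measure [simp]: "sets (vertex_measure X) = sets (verts X)"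
  by (simp add: vertex_measure_def)

lemma space_vertex_measure [simp]: "space (vertex_measure X) = space (verts X)"
  by (rule sets_eq_imp_space_eq) simp

lemma borel_vertex: "borel_measurable (vertex_measure X) = borel_measurable (verts X)"
  by (rule measurable_cong_sets) auto

lemma sets_transversal: "\<omega> \<in> units X \<Longrightarrow> sets (transversal X \<omega>) = sets (arrows X)"
  using transversal unfolding transversal_function_def by blast

lemma space_transversal: "\<omega> \<in> units X \<Longrightarrow> space (transversal X \<omega>) = space (arrows X)"
  by (rule sets_eq_imp_space_eq) (rule sets_transversal)

lemma borel_transversal:
  "\<omega> \<in> units X \<Longrightarrow> borel_measurable (transversal X \<omega>) = borel_measurable (arrows X)"
  by (rule measurable_cong_sets) (auto simp: sets_transversal)

lemma AE_transversal:
  assumes "\<omega> \<in> units X" shows "AE g in transversal X \<omega>. g \<in> arrows_to X \<omega>"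
proof (rule AE_I')
  have "emeasure (transversal X \<omega>) (space (arrows X) - arrows_to X \<omega>) = 0"
    using transversal assms unfolding transversal_function_def by blast
  then show "space (arrows X) - arrows_to X \<omega> \<in> null_sets (transversal X \<omega>)"
    using arrows_to_sets[OF assms] by (intro null_setsI) (auto simp: sets_transversal assms)
qed (auto simp: space_transversal assms)

text \<open>The measure \<open>m \<circ> \<nu>\<close> on the arrows.\<close>

definition total_measure where
  "total_measure = integrate_kernel (base_measure X) (transversal X) (arrows X)"

lemma sets_total_measure [simp]: "sets total_measure = sets (arrows X)"
  by (simp add: total_measure_def)

lemma space_total_measure [simp]: "space total_measure = space (arrows X)"
  by (rule sets_eq_imp_space_eq) simp

lemma borel_total: "borel_measurable total_measure = borel_measurable (arrows X)"
  by (rule measurable_cong_sets) auto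

lemma nn_integral_total_measure:
  assumes "f \<in> borel_measurable (arrows X)"
  shows "(\<integral>\<^sup>+g. f g \<partial>total_measure) = (\<integral>\<^sup>+\<omega>. \<integral>\<^sup>+g. f g \<partial>transversal X \<omega> \<partial>base_measure X)"
  unfolding total_measure_def
  using transversal assms unfolding transversal_function_def
  by (intro nn_integral_integrate_kernel) (auto simp: space_base borel_base)

lemma nn_integral_total_measure_ginv:
  assumes "f \<in> borel_measurable (arrows X)"
  shows "(\<integral>\<^sup>+g. f (ginv X g) \<partial>total_measure) = (\<integral>\<^sup>+g. f g \<partial>total_measure)"
proof -
  have inv: "distr total_measure (arrows X) (ginv X) = total_measure"
    using invariant unfolding invariant_measure_def total_measure_def by blast
  have m: "ginv X \<in> measurable total_measure (arrows X)"
    using inv_measurable measurable_cong_sets[OF sets_total_measure refl] by blast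
  have "(\<integral>\<^sup>+g. f g \<partial>total_measure) = (\<integral>\<^sup>+g. f g \<partial>distr total_measure (arrows X) (ginv X))"
    by (simp add: inv)
  also have "\<dots> = (\<integral>\<^sup>+g. f (ginv X g) \<partial>total_measure)"
    by (rule nn_integral_distr[OF m]) (use assms in simp)
  finally show ?thesis by simp
qed

section \<open>Mass transport\<close>

text \<open>A countable family generating the \<open>\<sigma>\<close>-algebra of the units separates them, because singletons are
  measurable; so equality of two units is a countable combination of measurable conditions.\<close>

lemma composable_sets:
  "{p \<in> space (arrows X \<Otimes>\<^sub>M verts X). grange X (fst p) = proj X (snd p)} \<in> sets (arrows X \<Otimes>\<^sub>M verts X)"
proof -
  obtain B where B: "countable B" "B \<subseteq> sets (base_measure X)"
      "sets (base_measure X) = sigma_sets (units X) B"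
    using units_basis space_base unfolding countable_finite_basis_def by metis
  have sep: "\<exists>b\<in>B. (\<omega> \<in> b) \<noteq> (\<omega>' \<in> b)" if "\<omega> \<in> units X" "\<omega>' \<in> units X" "\<omega> \<noteq> \<omega>'" for \<omega> \<omega>'
  proof (rule ccontr)
    assume H: "\<not> ?thesis"
    have "(\<omega> \<in> A) = (\<omega>' \<in> A)" if "A \<in> sigma_sets (units X) B" for A
      using that by induction (use H \<open>\<omega> \<in> units X\<close> \<open>\<omega>' \<in> units X\<close> in auto)
    moreover have "{\<omega>} \<in> sigma_sets (units X) B"
      using unit_singleton[OF that(1)] B(3) sets_base_measure by auto
    ultimately show False using that(3) by blast
  qed
  let ?P = "arrows X \<Otimes>\<^sub>M verts X"
  have [measurable]: "grange X \<in> measurable (arrows X) (base_measure X)"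
      "proj X \<in> measurable (verts X) (base_measure X)"
    using range_measurable proj_measurable measurable_cong_sets[OF refl sets_base_measure] by blast+
  let ?C = "\<lambda>b. {p \<in> space ?P. (grange X (fst p) \<in> b) \<noteq> (proj X (snd p) \<in> b)}"
  have "?C b \<in> sets ?P" if "b \<in> B" for b
  proof -
    have [measurable]: "b \<in> sets (base_measure X)" using that B by blast
    show ?thesis by measurable
  qed
  then have "(\<Union>b\<in>B. ?C b) \<in> sets ?P"
    using B(1) by (intro sets.countable_UN') auto
  then have "space ?P - (\<Union>b\<in>B. ?C b) \<in> sets ?P" by (rule sets.compl_sets)
  also have "space ?P - (\<Union>b\<in>B. ?C b)
      = {p \<in> space ?P. grange X (fst p) = proj X (snd p)}"
    using sep by (auto simp: space_pair_measure) (metis grange_units proj_units)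
  finally show ?thesis .
qed

lemma translate_measurable:
  fixes f :: "'v \<Rightarrow> ennreal"
  assumes f: "f \<in> borel_measurable (verts X)"
  shows "(\<lambda>(g, x). if grange X g = proj X x then f (act X (ginv X g) x) else 0)
    \<in> borel_measurable (arrows X \<Otimes>\<^sub>M verts X)"
proof -
  let ?P = "arrows X \<Otimes>\<^sub>M verts X"
  let ?D = "{p \<in> space ?P. grange X (fst p) = proj X (snd p)}"
  let ?S = "{(g, x). gsource X g = proj X x}"
  note [measurable] = inv_measurable
  have "(\<lambda>p. (ginv X (fst p), snd p)) \<in> measurable (restrict_space ?P ?D) (restrict_space ?P ?S)"
    by (rule measurable_restrict_space3) (auto simp: space_pair_measure)
  from measurable_compose[OF measurable_compose[OF this act_measurable] f]
  have "(\<lambda>p. f (act X (ginv X (fst p)) (snd p))) \<in> borel_measurable (restrict_space ?P ?D)"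
    by simp
  then have "(\<lambda>p. f (act X (ginv X (fst p)) (snd p)) * indicator ?D p) \<in> borel_measurable ?P"
    using borel_measurable_restrict_space_iff_ennreal[of ?D ?P] composable_sets by simp
  then show ?thesis
    by (subst measurable_cong) (auto simp: indicator_def space_pair_measure)
qed

lemma positive_weight:
  obtains v where "averaging_function X v" "v \<in> borel_measurable (verts X)"
    "\<And>x. x \<in> space (verts X) \<Longrightarrow> 0 < v x" "(\<integral>\<^sup>+x. v x \<partial>vertex_measure X) < \<infinity>"
  using positive_averaging unfolding averaging_function_def by blast

definition fiber_weight :: "('v \<Rightarrow> ennreal) \<Rightarrow> 'g \<Rightarrow> ennreal" where
  "fiber_weight v \<omega> = (\<integral>\<^sup>+x. v x \<partial>\<eta> \<omega>)"

text \<open>Where the weight \<open>v\<close> has a finite sum over a fiber, dividing by this sum turns the fibers into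
  a kernel of subprobability measures, for which joint measurability is known. The factor \<open>1 / v\<close>
  in the integrand undoes the weight.\<close>

lemma arrow_fiber_sum_measurable:
  assumes v: "v \<in> borel_measurable (verts X)" "\<And>x. x \<in> space (verts X) \<Longrightarrow> 0 < v x"
    and h: "h \<in> borel_measurable (arrows X \<Otimes>\<^sub>M verts X)"
  shows "(\<lambda>g. if fiber_weight v (grange X g) < \<infinity>
            then \<integral>\<^sup>+y. h (g, y) \<partial>\<eta> (grange X g) else (0::ennreal))
          \<in> borel_measurable (arrows X)"
proof -
  let ?S = "\<lambda>g. fiber_weight v (grange X g)"
  define w where "w g x = (if ?S g < \<infinity> then v x / ?S g else 0)" for g x
  define L where "L g = density (canonical_rv X (grange X g)) (w g)" for g
  note [measurable] = v(1) h
  have rm: "grange X \<in> measurable (arrows X) (base_measure X)"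
    using range_measurable measurable_cong_sets[OF refl sets_base_measure] by blast
  have sum_m: "(\<lambda>g. \<integral>\<^sup>+x. f x \<partial>\<eta> (grange X g)) \<in> borel_measurable (arrows X)"
    if "f \<in> borel_measurable (verts X)" for f :: "'v \<Rightarrow> ennreal"
    by (rule measurable_compose[OF rm nn_integral_vertex_measure(2)[OF that]])
  have [measurable]: "?S \<in> borel_measurable (arrows X)"
    unfolding fiber_weight_def by (rule sum_m) measurable
  have [measurable]: "w g \<in> borel_measurable (verts X)" for g
    unfolding w_def by measurable
  have crv [simp]: "sets (canonical_rv X \<omega>) = sets (verts X)" "space (canonical_rv X \<omega>) = space (verts X)" for \<omega>
    by (auto simp: canonical_rv_def)
  have crv_m: "borel_measurable (canonical_rv X \<omega>) = (borel_measurable (verts X) :: ('v \<Rightarrow> ennreal) set)" for \<omega>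
    by (rule measurable_cong_sets) auto
  have int_L: "(\<integral>\<^sup>+x. f x \<partial>L g) = (\<integral>\<^sup>+x. w g x * f x \<partial>\<eta> (grange X g))"
    if [measurable]: "f \<in> borel_measurable (verts X)" for f g
    unfolding L_def
    by (subst nn_integral_density) (auto simp: crv_m nn_integral_canonical_rv)
  have em_L: "emeasure (L g) A = (if ?S g < \<infinity>
      then (\<integral>\<^sup>+x. v x * indicator A x \<partial>\<eta> (grange X g)) / ?S g else 0)"
    if [measurable]: "A \<in> sets (verts X)" for g A
  proof -
    have "emeasure (L g) A = (\<integral>\<^sup>+x. indicator A x \<partial>L g)"
      by (simp add: L_def)
    also have "\<dots> = (\<integral>\<^sup>+x. w g x * indicator A x \<partial>\<eta> (grange X g))"
      by (rule int_L) measurable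
    also have "\<dots> = (if ?S g < \<infinity>
      then (\<integral>\<^sup>+x. v x * indicator A x / ?S g \<partial>\<eta> (grange X g)) else 0)"
      by (auto simp: w_def divide_ennreal_def mult_ac intro!: nn_integral_cong)
    also have "(\<integral>\<^sup>+x. v x * indicator A x / ?S g \<partial>\<eta> (grange X g))
        = (\<integral>\<^sup>+x. v x * indicator A x \<partial>\<eta> (grange X g)) / ?S g"
      by (rule nn_integral_divide) simp
    finally show ?thesis .
  qed
  have sub: "subprob_space (L g)" for g
  proof (rule subprob_spaceI)
    have "emeasure (L g) (space (L g)) = (if ?S g < \<infinity> then ?S g / ?S g else 0)"
      by (subst em_L) (auto simp: L_def fiber_weight_def intro!: arg_cong2[where f="(/)"] nn_integral_cong
          split: split_indicator simp: in_fiber_iff)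
    also have "\<dots> \<le> 1" by (cases "?S g = 0") (auto simp: ennreal_divide_self)
    finally show "emeasure (L g) (space (L g)) \<le> 1" .
    show "space (L g) \<noteq> {}" using nonempty by (simp add: L_def)
  qed
  have L: "L \<in> measurable (arrows X) (subprob_algebra (verts X))"
  proof (rule measurable_subprob_algebra)
    show "subprob_space (L g)" for g by (rule sub)
    show "sets (L g) = sets (verts X)" for g by (simp add: L_def)
    fix A assume [measurable]: "A \<in> sets (verts X)"
    have [measurable]: "(\<lambda>g. \<integral>\<^sup>+x. v x * indicator A x \<partial>\<eta> (grange X g))
        \<in> borel_measurable (arrows X)" by (rule sum_m) measurable
    show "(\<lambda>g. emeasure (L g) A) \<in> borel_measurable (arrows X)"
      by (subst em_L) measurable
  qed
  have "(\<lambda>g. \<integral>\<^sup>+y. h (g, y) / v y * ?S g \<partial>L g) \<in> borel_measurable (arrows X)"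
    by (rule nn_integral_measurable_subprob_algebra2[OF _ L]) measurable
  also have "?this \<longleftrightarrow> ?thesis"
  proof (rule measurable_cong)
    fix g assume g: "g \<in> space (arrows X)"
    have hg: "(\<lambda>y. h (g, y) / v y * ?S g) \<in> borel_measurable (verts X)"
      using g by measurable
    have "(\<integral>\<^sup>+y. h (g, y) / v y * ?S g \<partial>L g)
        = (\<integral>\<^sup>+y. w g y * (h (g, y) / v y * ?S g) \<partial>\<eta> (grange X g))"
      by (rule int_L[OF hg])
    also have "\<dots> = (\<integral>\<^sup>+y. (if ?S g < \<infinity> then h (g, y) else 0) \<partial>\<eta> (grange X g))"
    proof (intro nn_integral_cong)
      fix y assume "y \<in> space (\<eta> (grange X g))"
      then have y: "y \<in> fiber X (grange X g)" by simp
      then have pos: "0 < v y" using v(2) fiber_subset by blast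
      have le: "v y \<le> ?S g" unfolding fiber_weight_def using y by (rule nn_integral_ge_point)
      show "w g y * (h (g, y) / v y * ?S g) = (if ?S g < \<infinity> then h (g, y) else 0)"
      proof (cases "?S g < \<infinity>")
        case True
        have S: "?S g \<noteq> 0" "?S g \<noteq> \<infinity>" "v y \<noteq> 0" "v y \<noteq> \<infinity>"
          using True pos le by (auto simp: top_unique)
        have "w g y * (h (g, y) / v y * ?S g) = h (g, y) * (v y / v y) * (?S g / ?S g)"
          using True by (simp add: w_def divide_ennreal_def mult_ac)
        also have "\<dots> = h (g, y)" using S by (simp add: ennreal_divide_self top.not_eq_extremum)
        finally show ?thesis using True by simp
      qed (simp add: w_def)
    qed
    also have "\<dots> = (if ?S g < \<infinity>
            then \<integral>\<^sup>+y. h (g, y) \<partial>\<eta> (grange X g) else 0)"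
      by simp
    finally show "(\<integral>\<^sup>+y. h (g, y) / v y * ?S g \<partial>L g) = \<dots>" .
  qed
  finally show ?thesis .
qed

lemma nn_integral_fiber_swap:
  assumes h: "h \<in> borel_measurable (arrows X \<Otimes>\<^sub>M verts X)" and \<omega>: "\<omega> \<in> units X"
  shows "(\<integral>\<^sup>+y. \<integral>\<^sup>+g. h (g, y) \<partial>transversal X \<omega> \<partial>\<eta> \<omega>)
    = (\<integral>\<^sup>+g. \<integral>\<^sup>+y. h (g, y) \<partial>\<eta> (grange X g) \<partial>transversal X \<omega>)"
proof -
  have "(\<integral>\<^sup>+y. \<integral>\<^sup>+g. h (g, y) \<partial>transversal X \<omega> \<partial>\<eta> \<omega>)
    = (\<integral>\<^sup>+g. \<integral>\<^sup>+y. h (g, y) \<partial>\<eta> \<omega> \<partial>transversal X \<omega>)"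
  proof (rule nn_integral_count_space_nn_integral[OF fiber_countable[OF \<omega>], symmetric])
    fix y assume "y \<in> fiber X \<omega>"
    then have "y \<in> space (verts X)" using fiber_subset by blast
    then have "(\<lambda>g. h (g, y)) \<in> borel_measurable (arrows X)" using h by measurable
    then show "(\<lambda>g. h (g, y)) \<in> borel_measurable (transversal X \<omega>)" by (simp add: borel_transversal[OF \<omega>])
  qed
  also have "\<dots> = (\<integral>\<^sup>+g. \<integral>\<^sup>+y. h (g, y) \<partial>\<eta> (grange X g) \<partial>transversal X \<omega>)"
    by (rule nn_integral_cong_AE, use AE_transversal[OF \<omega>] in eventually_elim)
      (simp add: arrows_to_def)
  finally show ?thesis .
qed

lemma AE_fiber_weight:
  assumes "v \<in> borel_measurable (verts X)" "(\<integral>\<^sup>+x. v x \<partial>vertex_measure X) < \<infinity>"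
  shows "AE \<omega> in base_measure X. fiber_weight v \<omega> < \<infinity>"
  unfolding fiber_weight_def by (rule AE_fiber_weight_finite[OF assms])

text \<open>Invariance of \<open>m \<circ> \<nu>\<close> under inversion, for functions of an arrow \<open>g\<close> and a vertex in the fiber over
  its range. The range of the inverse is the source, so the vertex has to be moved along.\<close>

lemma groupoid_inversion:
  assumes h: "h \<in> borel_measurable (arrows X \<Otimes>\<^sub>M verts X)"
    and h': "h' \<in> borel_measurable (arrows X \<Otimes>\<^sub>M verts X)"
    and eq: "\<And>g y. g \<in> space (arrows X) \<Longrightarrow> y \<in> fiber X (grange X g)
      \<Longrightarrow> h' (g, y) = h (ginv X g, act X (ginv X g) y)"
  shows "(\<integral>\<^sup>+\<omega>. \<integral>\<^sup>+y. \<integral>\<^sup>+g. h (g, y) \<partial>transversal X \<omega> \<partial>\<eta> \<omega> \<partial>base_measure X)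
    = (\<integral>\<^sup>+\<omega>. \<integral>\<^sup>+y. \<integral>\<^sup>+g. h' (g, y) \<partial>transversal X \<omega> \<partial>\<eta> \<omega> \<partial>base_measure X)"
proof -
  obtain v where v: "v \<in> borel_measurable (verts X)" "\<And>x. x \<in> space (verts X) \<Longrightarrow> 0 < v x"
      "(\<integral>\<^sup>+x. v x \<partial>vertex_measure X) < \<infinity>"
    using positive_weight by metis
  define H where "H k g = (if fiber_weight v (grange X g) < \<infinity>
      then \<integral>\<^sup>+y. k (g, y) \<partial>\<eta> (grange X g) else (0::ennreal))" for k g
  have Hm: "H k \<in> borel_measurable (arrows X)" if "k \<in> borel_measurable (arrows X \<Otimes>\<^sub>M verts X)" for k
    unfolding H_def by (rule arrow_fiber_sum_measurable[OF v(1,2) that])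
  have int_H: "(\<integral>\<^sup>+\<omega>. \<integral>\<^sup>+y. \<integral>\<^sup>+g. k (g, y) \<partial>transversal X \<omega> \<partial>\<eta> \<omega> \<partial>base_measure X)
      = (\<integral>\<^sup>+g. H k g \<partial>total_measure)" if k: "k \<in> borel_measurable (arrows X \<Otimes>\<^sub>M verts X)" for k
    unfolding nn_integral_total_measure[OF Hm[OF k]]
  proof (rule nn_integral_cong_AE)
    show "AE \<omega> in base_measure X.
        (\<integral>\<^sup>+y. \<integral>\<^sup>+g. k (g, y) \<partial>transversal X \<omega> \<partial>\<eta> \<omega>) = (\<integral>\<^sup>+g. H k g \<partial>transversal X \<omega>)"
      using AE_fiber_weight[OF v(1,3)] AE_space
    proof eventually_elim
      case (elim \<omega>)
      then have \<omega>: "\<omega> \<in> units X" by (simp add: space_base)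
      show ?case unfolding nn_integral_fiber_swap[OF k \<omega>]
        by (rule nn_integral_cong_AE, use AE_transversal[OF \<omega>] in eventually_elim)
          (use elim in \<open>simp add: H_def arrows_to_def\<close>)
    qed
  qed
  have fwm: "(\<lambda>g. fiber_weight v (grange X g)) \<in> borel_measurable (arrows X)"
  proof -
    have rm: "grange X \<in> measurable (arrows X) (base_measure X)"
      using range_measurable measurable_cong_sets[OF refl sets_base_measure] by blast
    show ?thesis unfolding fiber_weight_def
      by (rule measurable_compose[OF rm nn_integral_vertex_measure(2)[OF v(1)]])
  qed
  \<comment> \<open>The arrows over the exceptional units form a null set; by invariance so do their inverses.\<close>
  define b where "b g = (if fiber_weight v (grange X g) < \<infinity> then 0 else 1 :: ennreal)" for g
  have bm: "b \<in> borel_measurable (arrows X)" unfolding b_def using fwm by measurable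
  have b0: "(\<integral>\<^sup>+g. b g \<partial>total_measure) = 0"
    unfolding nn_integral_total_measure[OF bm]
  proof (subst nn_integral_0_iff_AE)
    show "(\<lambda>\<omega>. \<integral>\<^sup>+g. b g \<partial>transversal X \<omega>) \<in> borel_measurable (base_measure X)"
      using transversal bm unfolding transversal_function_def borel_base by blast
    show "AE \<omega> in base_measure X. (\<integral>\<^sup>+g. b g \<partial>transversal X \<omega>) = 0"
      using AE_fiber_weight[OF v(1,3)] AE_space
    proof eventually_elim
      case (elim \<omega>)
      then have \<omega>: "\<omega> \<in> units X" by (simp add: space_base)
      have "(\<integral>\<^sup>+g. b g \<partial>transversal X \<omega>) = (\<integral>\<^sup>+g. 0 \<partial>transversal X \<omega>)"
        by (rule nn_integral_cong_AE, use AE_transversal[OF \<omega>] in eventually_elim)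
          (use elim in \<open>simp add: b_def arrows_to_def\<close>)
      then show ?case by simp
    qed
  qed
  have range_fin: "AE g in total_measure. fiber_weight v (grange X g) < \<infinity>"
  proof -
    have "AE g in total_measure. b g = 0"
      using b0 bm by (subst (asm) nn_integral_0_iff_AE) (auto simp: borel_total)
    then show ?thesis by (rule AE_mp) (auto simp: b_def split: if_splits)
  qed
  have source_fin: "AE g in total_measure. fiber_weight v (gsource X g) < \<infinity>"
  proof -
    have bi: "(\<lambda>g. b (ginv X g)) \<in> borel_measurable (arrows X)"
      by (rule measurable_compose[OF inv_measurable bm])
    have "(\<integral>\<^sup>+g. b (ginv X g) \<partial>total_measure) = 0"
      unfolding nn_integral_total_measure_ginv[OF bm] by (rule b0)
    then have "AE g in total_measure. b (ginv X g) = 0"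
      using bi by (subst (asm) nn_integral_0_iff_AE) (auto simp: borel_total)
    then show ?thesis by (rule AE_mp) (auto simp: b_def split: if_splits)
  qed
  \<comment> \<open>For the remaining arrows the inner sum is reindexed by the bijection between the two fibers.\<close>
  have "(\<integral>\<^sup>+g. H h g \<partial>total_measure) = (\<integral>\<^sup>+g. H h (ginv X g) \<partial>total_measure)"
    by (rule nn_integral_total_measure_ginv[OF Hm[OF h], symmetric])
  also have "\<dots> = (\<integral>\<^sup>+g. H h' g \<partial>total_measure)"
  proof (rule nn_integral_cong_AE)
    show "AE g in total_measure. H h (ginv X g) = H h' g"
      using range_fin source_fin AE_space
    proof eventually_elim
      case (elim g)
      then have g: "g \<in> space (arrows X)" by simp
      have bij: "bij_betw (act X (ginv X g)) (fiber X (grange X g)) (fiber X (gsource X g))"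
        using act_bij[OF inv_closed[OF g]] by (simp add: g)
      have "H h (ginv X g) = (\<integral>\<^sup>+y. h (ginv X g, y) \<partial>\<eta> (gsource X g))"
        using elim g by (simp add: H_def)
      also have "\<dots> = (\<integral>\<^sup>+y. h (ginv X g, act X (ginv X g) y) \<partial>\<eta> (grange X g))"
        by (rule nn_integral_bij_count_space[OF bij, symmetric])
      also have "\<dots> = H h' g"
        using elim by (auto simp: H_def eq[OF g] intro!: nn_integral_cong)
      finally show ?case .
    qed
  qed
  finally show ?thesis unfolding int_H[OF h] int_H[OF h'] .
qed

lemma translate_section_measurable:
  fixes f :: "'v \<Rightarrow> ennreal"
  assumes f: "f \<in> borel_measurable (verts X)" and \<omega>: "\<omega> \<in> units X" and y: "y \<in> fiber X \<omega>"
  shows "(\<lambda>g. f (act X (ginv X g) y) * indicator (arrows_to X \<omega>) g) \<in> borel_measurable (arrows X)"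
proof -
  have "y \<in> space (verts X)" using y fiber_subset by blast
  then have "(\<lambda>g. (\<lambda>(g, x). if grange X g = proj X x then f (act X (ginv X g) x) else 0) (g, y))
      \<in> borel_measurable (arrows X)"
    using translate_measurable[OF f] by measurable
  also have "?this \<longleftrightarrow> ?thesis"
    by (rule measurable_cong) (use y in \<open>auto simp: arrows_to_def in_fiber_iff indicator_def\<close>)
  finally show ?thesis .
qed

text \<open>Inserting \<open>1 = \<integral> u(g\<inverse>y) d\<nu>(g)\<close> and inverting \<open>g\<close> exchanges the roles of the two functions: now
  \<open>\<psi>\<close> is averaged over the groupoid and \<open>u\<close> is evaluated at the vertex itself.\<close>

lemma averaging_transport:
  assumes u: "averaging_function X u" and \<psi>: "\<psi> \<in> borel_measurable (verts X)"
  shows "(\<integral>\<^sup>+x. \<psi> x \<partial>vertex_measure X)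
    = (\<integral>\<^sup>+\<omega>. \<integral>\<^sup>+y. u y * (\<integral>\<^sup>+g\<in>arrows_to X \<omega>. \<psi> (act X (ginv X g) y) \<partial>transversal X \<omega>)
        \<partial>\<eta> \<omega> \<partial>base_measure X)"
proof -
  have um: "u \<in> borel_measurable (verts X)"
    and u1: "\<And>x. x \<in> space (verts X) \<Longrightarrow>
      (\<integral>\<^sup>+g \<in> arrows_to X (proj X x). u (act X (ginv X g) x) \<partial>transversal X (proj X x)) = 1"
    using u unfolding averaging_function_def by auto
  define lift where "lift f = (\<lambda>(g, x). if grange X g = proj X x then f (act X (ginv X g) x) else (0::ennreal))" for f
  define h where "h p = \<psi> (snd p) * lift u p" for p
  define h' where "h' p = u (snd p) * lift \<psi> p" for p
  note [measurable] = um \<psi> translate_measurable[OF um, folded lift_def] translate_measurable[OF \<psi>, folded lift_def]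
  have hm: "h \<in> borel_measurable (arrows X \<Otimes>\<^sub>M verts X)" unfolding h_def by measurable
  have h'm: "h' \<in> borel_measurable (arrows X \<Otimes>\<^sub>M verts X)" unfolding h'_def by measurable
  have sect: "(\<integral>\<^sup>+g. a * lift f (g, y) \<partial>transversal X \<omega>)
      = a * (\<integral>\<^sup>+g\<in>arrows_to X \<omega>. f (act X (ginv X g) y) \<partial>transversal X \<omega>)"
    if "f \<in> borel_measurable (verts X)" "\<omega> \<in> units X" "y \<in> fiber X \<omega>" for a f \<omega> y
  proof -
    have "(\<integral>\<^sup>+g. a * lift f (g, y) \<partial>transversal X \<omega>)
        = (\<integral>\<^sup>+g. a * (f (act X (ginv X g) y) * indicator (arrows_to X \<omega>) g) \<partial>transversal X \<omega>)"
      using that by (intro nn_integral_cong) (auto simp: space_transversal lift_def arrows_to_def in_fiber_iff)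
    also have "\<dots> = a * (\<integral>\<^sup>+g\<in>arrows_to X \<omega>. f (act X (ginv X g) y) \<partial>transversal X \<omega>)"
      using translate_section_measurable[OF that] by (intro nn_integral_cmult) (simp add: borel_transversal that)
    finally show ?thesis .
  qed
  have "(\<integral>\<^sup>+x. \<psi> x \<partial>vertex_measure X) = (\<integral>\<^sup>+\<omega>. \<integral>\<^sup>+x. \<psi> x \<partial>\<eta> \<omega> \<partial>base_measure X)"
    by (rule nn_integral_vertex_measure[OF \<psi>])
  also have "\<dots> = (\<integral>\<^sup>+\<omega>. \<integral>\<^sup>+y. \<integral>\<^sup>+g. h (g, y) \<partial>transversal X \<omega> \<partial>\<eta> \<omega> \<partial>base_measure X)"
  proof (intro nn_integral_cong)
    fix \<omega> y assume "\<omega> \<in> space (base_measure X)" "y \<in> space (\<eta> \<omega>)"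
    then have *: "\<omega> \<in> units X" "y \<in> fiber X \<omega>" by (auto simp: space_base)
    then show "\<psi> y = (\<integral>\<^sup>+g. h (g, y) \<partial>transversal X \<omega>)"
      using sect[OF um *, of "\<psi> y"] u1[of y] by (simp add: h_def in_fiber_iff)
  qed
  also have "\<dots> = (\<integral>\<^sup>+\<omega>. \<integral>\<^sup>+y. \<integral>\<^sup>+g. h' (g, y) \<partial>transversal X \<omega> \<partial>\<eta> \<omega> \<partial>base_measure X)"
  proof (rule groupoid_inversion[OF hm h'm])
    fix g y assume g: "g \<in> space (arrows X)" and y: "y \<in> fiber X (grange X g)"
    show "h' (g, y) = h (ginv X g, act X (ginv X g) y)"
      using act_ginv_fiber[OF g y] act_act_ginv[OF g y] y g
      by (simp add: h_def h'_def lift_def inv_inv in_fiber_iff mult.commute)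
  qed
  also have "\<dots> = (\<integral>\<^sup>+\<omega>. \<integral>\<^sup>+y. u y * (\<integral>\<^sup>+g\<in>arrows_to X \<omega>. \<psi> (act X (ginv X g) y) \<partial>transversal X \<omega>)
        \<partial>\<eta> \<omega> \<partial>base_measure X)"
    by (intro nn_integral_cong) (simp add: h'_def sect[OF \<psi>] space_base)
  finally show ?thesis .
qed

text \<open>The mass transport principle: the mass sent out equals the mass received, even when the two sides
  are weighted by different averaging functions. It is \<open>averaging_transport\<close> for the function that
  collects at \<open>y\<close> what is sent there; since \<open>\<phi>\<close> is invariant, averaging this function only averages
  \<open>u\<close>, which gives 1.\<close>

lemma mass_transport_nonneg:
  fixes \<phi> :: "'v \<Rightarrow> 'v \<Rightarrow> ennreal"
  assumes u: "averaging_function X u" and u': "averaging_function X u'"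
    and inv: "\<And>g x y. \<lbrakk>g \<in> space (arrows X); x \<in> fiber X (gsource X g); y \<in> fiber X (gsource X g)\<rbrakk>
      \<Longrightarrow> \<phi> (act X g x) (act X g y) = \<phi> x y"
    and m1: "(\<lambda>x. \<integral>\<^sup>+y. \<phi> x y \<partial>\<eta> (proj X x)) \<in> borel_measurable (verts X)"
    and m2: "(\<lambda>y. \<integral>\<^sup>+x. \<phi> x y \<partial>\<eta> (proj X y)) \<in> borel_measurable (verts X)"
    and m3: "(\<lambda>y. \<integral>\<^sup>+x. u x * \<phi> x y \<partial>\<eta> (proj X y)) \<in> borel_measurable (verts X)"
  shows "(\<integral>\<^sup>+x. u x * (\<integral>\<^sup>+y. \<phi> x y \<partial>\<eta> (proj X x)) \<partial>vertex_measure X)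
    = (\<integral>\<^sup>+y. u' y * (\<integral>\<^sup>+x. \<phi> x y \<partial>\<eta> (proj X y)) \<partial>vertex_measure X)"
proof -
  have um: "u \<in> borel_measurable (verts X)" "u' \<in> borel_measurable (verts X)"
    and u1: "\<And>x. x \<in> space (verts X) \<Longrightarrow>
      (\<integral>\<^sup>+g \<in> arrows_to X (proj X x). u (act X (ginv X g) x) \<partial>transversal X (proj X x)) = 1"
    using u u' unfolding averaging_function_def by auto
  have m0: "(\<lambda>x. u x * (\<integral>\<^sup>+y. \<phi> x y \<partial>\<eta> (proj X x))) \<in> borel_measurable (verts X)"
    using um(1) m1 by (rule borel_measurable_times_ennreal)
  have m4: "(\<lambda>y. u' y * (\<integral>\<^sup>+x. \<phi> x y \<partial>\<eta> (proj X y))) \<in> borel_measurable (verts X)"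
    using um(2) m2 by (rule borel_measurable_times_ennreal)
  let ?\<psi> = "\<lambda>y. \<integral>\<^sup>+x. u x * \<phi> x y \<partial>\<eta> (proj X y)"
  have "(\<integral>\<^sup>+x. u x * (\<integral>\<^sup>+y. \<phi> x y \<partial>\<eta> (proj X x)) \<partial>vertex_measure X)
    = (\<integral>\<^sup>+\<omega>. \<integral>\<^sup>+x. \<integral>\<^sup>+y. u x * \<phi> x y \<partial>\<eta> \<omega> \<partial>\<eta> \<omega> \<partial>base_measure X)"
    by (subst nn_integral_vertex_measure(1)[OF m0])
      (auto simp: in_fiber_iff nn_integral_cmult intro!: nn_integral_cong)
  also have "\<dots> = (\<integral>\<^sup>+\<omega>. \<integral>\<^sup>+y. \<integral>\<^sup>+x. u x * \<phi> x y \<partial>\<eta> \<omega> \<partial>\<eta> \<omega> \<partial>base_measure X)"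
    by (intro nn_integral_cong nn_integral_count_space_nn_integral)
      (auto simp: space_base fiber_countable)
  also have "\<dots> = (\<integral>\<^sup>+y. ?\<psi> y \<partial>vertex_measure X)"
    by (subst nn_integral_vertex_measure[OF m3]) (auto simp: in_fiber_iff intro!: nn_integral_cong)
  also have "\<dots> = (\<integral>\<^sup>+\<omega>. \<integral>\<^sup>+y. u' y * (\<integral>\<^sup>+g\<in>arrows_to X \<omega>. ?\<psi> (act X (ginv X g) y) \<partial>transversal X \<omega>)
        \<partial>\<eta> \<omega> \<partial>base_measure X)"
    by (rule averaging_transport[OF u' m3])
  also have "\<dots> = (\<integral>\<^sup>+\<omega>. \<integral>\<^sup>+y. u' y * (\<integral>\<^sup>+x. \<phi> x y \<partial>\<eta> (proj X y))
        \<partial>\<eta> \<omega> \<partial>base_measure X)"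
  proof (intro nn_integral_cong arg_cong2[where f="(*)"] refl)
    fix \<omega> y assume "\<omega> \<in> space (base_measure X)" "y \<in> space (\<eta> \<omega>)"
    then have \<omega>: "\<omega> \<in> units X" and y: "y \<in> fiber X \<omega>" by (auto simp: space_base)
    have "(\<integral>\<^sup>+g\<in>arrows_to X \<omega>. ?\<psi> (act X (ginv X g) y) \<partial>transversal X \<omega>)
       = (\<integral>\<^sup>+g. \<integral>\<^sup>+x. \<phi> x y * (u (act X (ginv X g) x) * indicator (arrows_to X \<omega>) g)
           \<partial>\<eta> \<omega> \<partial>transversal X \<omega>)"
    proof (intro nn_integral_cong)
      fix g assume "g \<in> space (transversal X \<omega>)"
      then have g: "g \<in> space (arrows X)" by (simp add: space_transversal \<omega>)
      show "?\<psi> (act X (ginv X g) y) * indicator (arrows_to X \<omega>) g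
         = (\<integral>\<^sup>+x. \<phi> x y * (u (act X (ginv X g) x) * indicator (arrows_to X \<omega>) g) \<partial>\<eta> \<omega>)"
      proof (cases "g \<in> arrows_to X \<omega>")
        case True
        then have r: "grange X g = \<omega>" by (simp add: arrows_to_def)
        have yg: "y \<in> fiber X (grange X g)" using y r by simp
        have bij: "bij_betw (act X (ginv X g)) (fiber X (grange X g)) (fiber X (gsource X g))"
          using act_bij[OF inv_closed[OF g]] by (simp add: g)
        have "?\<psi> (act X (ginv X g) y)
            = (\<integral>\<^sup>+x. u x * \<phi> x (act X (ginv X g) y) \<partial>\<eta> (gsource X g))"
          using act_ginv_fiber[OF g yg] by (simp add: in_fiber_iff)
        also have "\<dots> = (\<integral>\<^sup>+x. u (act X (ginv X g) x) * \<phi> (act X (ginv X g) x) (act X (ginv X g) y)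
            \<partial>\<eta> (grange X g))"
          by (rule nn_integral_bij_count_space[OF bij, symmetric])
        also have "\<dots> = (\<integral>\<^sup>+x. u (act X (ginv X g) x) * \<phi> x y \<partial>\<eta> \<omega>)"
          unfolding r[symmetric]
          using inv[OF inv_closed[OF g]] yg g by (intro nn_integral_cong) simp
        finally show ?thesis using True by (simp add: mult.commute)
      qed simp
    qed
    also have "\<dots> = (\<integral>\<^sup>+x. \<integral>\<^sup>+g. \<phi> x y * (u (act X (ginv X g) x) * indicator (arrows_to X \<omega>) g)
           \<partial>transversal X \<omega> \<partial>\<eta> \<omega>)"
      using translate_section_measurable[OF um(1) \<omega>]
      by (intro nn_integral_count_space_nn_integral fiber_countable \<omega>)
        (simp add: borel_transversal \<omega> borel_measurable_times)
    also have "\<dots> = (\<integral>\<^sup>+x. \<phi> x y * 1 \<partial>\<eta> \<omega>)"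
    proof (intro nn_integral_cong)
      fix x assume "x \<in> space (\<eta> \<omega>)"
      then have x: "x \<in> fiber X \<omega>" by simp
      show "(\<integral>\<^sup>+g. \<phi> x y * (u (act X (ginv X g) x) * indicator (arrows_to X \<omega>) g) \<partial>transversal X \<omega>) = \<phi> x y * 1"
        using u1[of x] x translate_section_measurable[OF um(1) \<omega> x]
        by (subst nn_integral_cmult) (auto simp: borel_transversal \<omega> in_fiber_iff)
    qed
    finally show "(\<integral>\<^sup>+g\<in>arrows_to X \<omega>. ?\<psi> (act X (ginv X g) y) \<partial>transversal X \<omega>)
        = (\<integral>\<^sup>+x. \<phi> x y \<partial>\<eta> (proj X y))"
      using y by (simp add: in_fiber_iff)
  qed
  also have "\<dots> = (\<integral>\<^sup>+y. u' y * (\<integral>\<^sup>+x. \<phi> x y \<partial>\<eta> (proj X y)) \<partial>vertex_measure X)"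
    by (rule nn_integral_vertex_measure(1)[OF m4, symmetric])
  finally show ?thesis .
qed

lemma nn_integral_count_space_point:
  fixes f :: "'a \<Rightarrow> ennreal"
  assumes "x \<in> A" "\<And>y. y \<in> A \<Longrightarrow> y \<noteq> x \<Longrightarrow> f y = 0"
  shows "(\<integral>\<^sup>+y. f y \<partial>count_space A) = f x"
  using assms by (subst nn_integral_count_space'[of "{x}"]) auto

text \<open>Mass transport for the identity kernel, where every vertex keeps its mass.\<close>

lemma averaging_integral_eq:
  assumes u: "averaging_function X u" and u': "averaging_function X u'"
  shows "(\<integral>\<^sup>+x. u x \<partial>vertex_measure X) = (\<integral>\<^sup>+x. u' x \<partial>vertex_measure X)"
proof -
  let ?\<phi> = "\<lambda>x y :: 'v. of_bool (x = y) :: ennreal"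
  have um: "u \<in> borel_measurable (verts X)" using u unfolding averaging_function_def by auto
  have p1: "(\<integral>\<^sup>+y. ?\<phi> x y \<partial>\<eta> (proj X x)) = 1" if "x \<in> space (verts X)" for x
    by (subst nn_integral_count_space_point[of x]) (auto simp: in_fiber_iff that)
  have p2: "(\<integral>\<^sup>+y. ?\<phi> y x \<partial>\<eta> (proj X x)) = 1" if "x \<in> space (verts X)" for x
    by (subst nn_integral_count_space_point[of x]) (auto simp: in_fiber_iff that)
  have p3: "(\<integral>\<^sup>+y. u y * ?\<phi> y x \<partial>\<eta> (proj X x)) = u x" if "x \<in> space (verts X)" for x
    by (subst nn_integral_count_space_point[of x]) (auto simp: in_fiber_iff that)
  have "(\<integral>\<^sup>+x. u x * (\<integral>\<^sup>+y. ?\<phi> x y \<partial>\<eta> (proj X x)) \<partial>vertex_measure X)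
    = (\<integral>\<^sup>+y. u' y * (\<integral>\<^sup>+x. ?\<phi> x y \<partial>\<eta> (proj X y)) \<partial>vertex_measure X)"
  proof (rule mass_transport_nonneg[OF u u', where \<phi> = ?\<phi>])
    fix g x y assume *: "g \<in> space (arrows X)" "x \<in> fiber X (gsource X g)" "y \<in> fiber X (gsource X g)"
    then show "?\<phi> (act X g x) (act X g y) = ?\<phi> x y"
      using inj_on_eq_iff[OF bij_betw_imp_inj_on[OF act_bij[OF *(1)]] *(2,3)] by simp
  next
    have "(\<lambda>x. \<integral>\<^sup>+y. ?\<phi> x y \<partial>\<eta> (proj X x)) \<in> borel_measurable (verts X)
        \<longleftrightarrow> (\<lambda>x. 1 :: ennreal) \<in> borel_measurable (verts X)"
      by (rule measurable_cong) (rule p1)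
    then show "(\<lambda>x. \<integral>\<^sup>+y. ?\<phi> x y \<partial>\<eta> (proj X x)) \<in> borel_measurable (verts X)"
      by simp
  next
    have "(\<lambda>x. \<integral>\<^sup>+y. ?\<phi> y x \<partial>\<eta> (proj X x)) \<in> borel_measurable (verts X)
        \<longleftrightarrow> (\<lambda>x. 1 :: ennreal) \<in> borel_measurable (verts X)"
      by (rule measurable_cong) (rule p2)
    then show "(\<lambda>x. \<integral>\<^sup>+y. ?\<phi> y x \<partial>\<eta> (proj X x)) \<in> borel_measurable (verts X)"
      by simp
  next
    have "(\<lambda>x. \<integral>\<^sup>+y. u y * ?\<phi> y x \<partial>\<eta> (proj X x)) \<in> borel_measurable (verts X)
        \<longleftrightarrow> u \<in> borel_measurable (verts X)"
      by (rule measurable_cong) (rule p3)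
    then show "(\<lambda>x. \<integral>\<^sup>+y. u y * ?\<phi> y x \<partial>\<eta> (proj X x)) \<in> borel_measurable (verts X)"
      using um by simp
  qed
  also have "(\<integral>\<^sup>+x. u x * (\<integral>\<^sup>+y. ?\<phi> x y \<partial>\<eta> (proj X x)) \<partial>vertex_measure X)
      = (\<integral>\<^sup>+x. u x \<partial>vertex_measure X)"
    by (intro nn_integral_cong, subst p1) auto
  also have "(\<integral>\<^sup>+y. u' y * (\<integral>\<^sup>+x. ?\<phi> x y \<partial>\<eta> (proj X y)) \<partial>vertex_measure X)
      = (\<integral>\<^sup>+x. u' x \<partial>vertex_measure X)"
    by (intro nn_integral_cong, subst p2) auto
  finally show ?thesis .
qed

lemma averaging_finite:
  assumes u: "averaging_function X u"
  shows "(\<integral>\<^sup>+x. u x \<partial>vertex_measure X) < \<infinity>"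
proof -
  obtain v where "averaging_function X v" "(\<integral>\<^sup>+x. v x \<partial>vertex_measure X) < \<infinity>"
    using positive_averaging by blast
  then show ?thesis using averaging_integral_eq[OF u] by simp
qed

end

section \<open>Neighbour sums and measurable kernels\<close>

lemma sum_of_bool_point:
  assumes "finite A" shows "(\<Sum>y\<in>A. of_bool (y = z) * f y :: real) = of_bool (z \<in> A) * f z"
proof (cases "z \<in> A")
  case True
  then have "(\<Sum>y\<in>A. of_bool (y = z) * f y) = (\<Sum>y\<in>{z}. f y)"
    using assms by (intro sum.mono_neutral_cong_right) auto
  then show ?thesis using True by simp
qed (auto intro!: sum.neutral)

context simple_graph
begin

abbreviation nbrs :: "'v \<Rightarrow> 'v set" where
  "nbrs x \<equiv> E `` {x}"

lemma finite_neighbours [simp]: "finite (nbrs x)"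
proof (cases "x \<in> V")
  case True
  then show ?thesis using bounded_degree by blast
next
  case False
  then have "nbrs x = {}" using edges_subset by auto
  then show ?thesis by simp
qed

lemma card_neighbours_le: "card (nbrs x) \<le> max_degree V E"
proof (cases "x \<in> V")
  case True
  obtain D where "\<forall>x\<in>V. card (nbrs x) \<le> D" using bounded_degree by blast
  then have "vertex_degree E ` V \<subseteq> {..D}" by (auto simp: vertex_degree_def)
  then have "finite (vertex_degree E ` V)" by (rule finite_subset) simp
  then show ?thesis
    using True unfolding max_degree_def by (intro Max_ge) (auto simp: vertex_degree_def)
next
  case False
  then have "nbrs x = {}" using edges_subset by auto
  then show ?thesis by simp
qed

definition degree :: "'v \<Rightarrow> real" where
  "degree x = real (card (nbrs x))"

lemma edge_sym: "(x, y) \<in> E \<longleftrightarrow> (y, x) \<in> E"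
  using sym_edges by (auto dest: symD)

lemma edge_neq: "(x, y) \<in> E \<Longrightarrow> x \<noteq> y"
  using irrefl_edges by (auto simp: irrefl_def)

lemma edge_in: "(x, y) \<in> E \<Longrightarrow> x \<in> V \<and> y \<in> V"
  using edges_subset by auto

lemma same_component_edge:
  "(x, y) \<in> same_component V E \<Longrightarrow> (x, z) \<in> E \<Longrightarrow> (z, y) \<in> same_component V E"
  using edge_in[of x z] edge_sym[of x z] unfolding same_component_def
  by (auto intro: converse_rtrancl_into_rtrancl[of z x])

lemma same_component_sym: "(x, y) \<in> same_component V E \<Longrightarrow> (y, x) \<in> same_component V E"
  using sym_rtrancl[OF sym_edges] unfolding same_component_def by (auto dest: symD)

lemma same_component_refl: "x \<in> V \<Longrightarrow> (x, x) \<in> same_component V E"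
  by (auto simp: same_component_def)

end

context measurable_graph
begin

abbreviation pairs :: "('v \<times> 'v) measure" where
  "pairs \<equiv> pair_space V E"

lemma space_pairs: "space pairs = same_component (space V) E"
  by (auto simp: pair_space_def space_restrict_space space_pair_measure same_component_def)

lemma fst_pairs [measurable]: "fst \<in> measurable pairs V"
  unfolding pair_space_def by (rule measurable_restrict_space1) simp

lemma snd_pairs [measurable]: "snd \<in> measurable pairs V"
  unfolding pair_space_def by (rule measurable_restrict_space1) simp

lemma pairsI:
  assumes [measurable]: "f \<in> measurable M V" "g \<in> measurable M V"
    and "\<And>x. x \<in> space M \<Longrightarrow> (f x, g x) \<in> same_component (space V) E"
  shows "(\<lambda>x. (f x, g x)) \<in> measurable M pairs"
  unfolding pair_space_def by (rule measurable_restrict_space2) (use assms(3) in auto)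

lemma diagonal_pairs [measurable]: "(\<lambda>x. (x, x)) \<in> measurable V pairs"
  by (rule pairsI) (auto simp: same_component_refl)

lemma swap_pairs [measurable]: "(\<lambda>p. (snd p, fst p)) \<in> measurable pairs pairs"
  by (rule pairsI) (auto simp: space_pairs same_component_sym)

lemma edges_pairs: "{p \<in> space pairs. p \<in> E} \<in> sets pairs"
proof -
  have "adjacency E -` {1} \<inter> space pairs \<in> sets pairs"
    by (rule measurable_sets[OF adjacency_measurable]) simp
  also have "adjacency E -` {1} \<inter> space pairs = {p \<in> space pairs. p \<in> E}"
    by (auto simp: adjacency_def indicator_def of_bool_def split: if_splits)
  finally show ?thesis .
qed

lemma pred_edges [measurable]: "Measurable.pred pairs (\<lambda>p. p \<in> E)"
  using edges_pairs by (simp add: pred_def)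

text \<open>This is convolution with the adjacency matrix.\<close>

lemma neighbour_sum_ennreal:
  fixes K :: "'v \<times> 'v \<Rightarrow> ennreal"
  assumes K: "K \<in> borel_measurable pairs"
  shows "(\<lambda>p. \<Sum>a\<in>nbrs (fst p). K (a, snd p)) \<in> borel_measurable pairs"
proof -
  have "(\<lambda>p. indicator E p :: ennreal) \<in> borel_measurable pairs"
    unfolding indicator_def by measurable
  from convolution_measurable[OF this K] show ?thesis
  proof (rule iffD1[OF measurable_cong, rotated])
    fix p assume "p \<in> space pairs"
    obtain x y where p: "p = (x, y)" by (cases p)
    have "convolution E (indicator E) K (x, y)
        = (\<integral>\<^sup>+z. indicator E (x, z) * K (z, y) \<partial>count_space {z. (x, z) \<in> E\<^sup>*})"
      by (simp add: convolution_def)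
    also have "\<dots> = (\<Sum>z\<in>nbrs x. indicator E (x, z) * K (z, y))"
      by (rule nn_integral_count_space') auto
    also have "\<dots> = (\<Sum>z\<in>nbrs x. K (z, y))"
      by (rule sum.cong) auto
    finally show "convolution E (indicator E) K p = (\<Sum>a\<in>nbrs (fst p). K (a, snd p))"
      by (simp add: p)
  qed
qed

lemma neighbour_sum_real:
  fixes K :: "'v \<times> 'v \<Rightarrow> real"
  assumes [measurable]: "K \<in> borel_measurable pairs"
  shows "(\<lambda>p. \<Sum>a\<in>nbrs (fst p). K (a, snd p)) \<in> borel_measurable pairs"
proof -
  have [measurable]: "(\<lambda>p. \<Sum>a\<in>nbrs (fst p). ennreal (K (a, snd p))) \<in> borel_measurable pairs"
    "(\<lambda>p. \<Sum>a\<in>nbrs (fst p). ennreal (- K (a, snd p))) \<in> borel_measurable pairs"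
    using neighbour_sum_ennreal[of "\<lambda>p. ennreal (K p)"] neighbour_sum_ennreal[of "\<lambda>p. ennreal (- K p)"]
    by measurable
  have "(\<lambda>p. enn2real (\<Sum>a\<in>nbrs (fst p). ennreal (K (a, snd p)))
      - enn2real (\<Sum>a\<in>nbrs (fst p). ennreal (- K (a, snd p)))) \<in> borel_measurable pairs"
    by measurable
  moreover have "enn2real (\<Sum>a\<in>A. ennreal (f a)) - enn2real (\<Sum>a\<in>A. ennreal (- f a)) = sum f A"
    for f :: "'v \<Rightarrow> real" and A
  proof -
    have pos: "enn2real (\<Sum>a\<in>A. ennreal (g a)) = (\<Sum>a\<in>A. max 0 (g a))" for g :: "'v \<Rightarrow> real"
    proof -
      have "(\<Sum>a\<in>A. ennreal (g a)) = (\<Sum>a\<in>A. ennreal (max 0 (g a)))"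
        by (rule sum.cong) (simp_all add: max_def ennreal_neg)
      also have "\<dots> = ennreal (\<Sum>a\<in>A. max 0 (g a))"
        by (rule sum_ennreal) simp
      finally show ?thesis by (simp add: sum_nonneg)
    qed
    have "max 0 (f a) - max 0 (- f a) = f a" for a by (simp add: max_def)
    then show ?thesis unfolding pos sum_subtractf[symmetric] by simp
  qed
  ultimately show ?thesis by simp
qed

lemma neighbour_sum_vertex_ennreal:
  fixes K :: "'v \<times> 'v \<Rightarrow> ennreal"
  assumes [measurable]: "K \<in> borel_measurable pairs"
  shows "(\<lambda>x. \<Sum>a\<in>nbrs x. K (a, x)) \<in> borel_measurable V"
  using measurable_compose[OF diagonal_pairs neighbour_sum_ennreal[OF assms]] by simp

lemma neighbour_sum_vertex_real:
  fixes K :: "'v \<times> 'v \<Rightarrow> real"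
  assumes [measurable]: "K \<in> borel_measurable pairs"
  shows "(\<lambda>x. \<Sum>a\<in>nbrs x. K (a, x)) \<in> borel_measurable V"
  using measurable_compose[OF diagonal_pairs neighbour_sum_real[OF assms]] by simp

lemma neighbour_sum_function:
  fixes f :: "'v \<Rightarrow> real"
  assumes [measurable]: "f \<in> borel_measurable V"
  shows "(\<lambda>x. \<Sum>a\<in>nbrs x. f a) \<in> borel_measurable V"
  using neighbour_sum_vertex_real[of "\<lambda>p. f (fst p)"] by simp

lemma neighbour_sum_complex:
  fixes f :: "'v \<Rightarrow> complex"
  assumes [measurable]: "f \<in> borel_measurable V"
  shows "(\<lambda>x. \<Sum>a\<in>nbrs x. f a) \<in> borel_measurable V"
  unfolding borel_measurable_complex_iff
  using neighbour_sum_function[of "\<lambda>x. Re (f x)"] neighbour_sum_function[of "\<lambda>x. Im (f x)"]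
  by simp

lemma degree_measurable [measurable]: "degree \<in> borel_measurable V"
  using neighbour_sum_function[of "\<lambda>x. 1"] by (simp add: degree_def[abs_def])

text \<open>The identity kernel belongs to this class with \<open>K' = 0\<close> and \<open>d = 1\<close>, whether or not the diagonal is
  a measurable set.\<close>

definition measurable_off_diagonal :: "('v \<Rightarrow> 'v \<Rightarrow> real) \<Rightarrow> bool" where
  "measurable_off_diagonal K \<longleftrightarrow> (\<exists>K' d. K' \<in> borel_measurable pairs \<and> d \<in> borel_measurable V
     \<and> (\<forall>x y. (x, y) \<in> same_component (space V) E \<longrightarrow> K x y = K' (x, y) + of_bool (x = y) * d x))"

lemma measurable_off_diagonalE:
  assumes "measurable_off_diagonal K"
  obtains K' d where "K' \<in> borel_measurable pairs" "d \<in> borel_measurable V"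
    "\<And>x y. (x, y) \<in> same_component (space V) E \<Longrightarrow> K x y = K' (x, y) + of_bool (x = y) * d x"
  using assms unfolding measurable_off_diagonal_def by blast

lemma measurable_off_diagonalI:
  assumes "K' \<in> borel_measurable pairs"
    "\<And>x y. (x, y) \<in> same_component (space V) E \<Longrightarrow> K x y = K' (x, y)"
  shows "measurable_off_diagonal K"
  using assms unfolding measurable_off_diagonal_def
  by (intro exI[of _ K'] exI[of _ "\<lambda>_. 0"]) auto

lemma measurable_off_diagonal_identity: "measurable_off_diagonal (\<lambda>x y. of_bool (x = y))"
  unfolding measurable_off_diagonal_def by (intro exI[of _ "\<lambda>_. 0"] exI[of _ "\<lambda>_. 1"]) auto

text \<open>Multiplication by the adjacency matrix from the left moves the diagonal part \<open>d\<close> onto the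
  edges, where it is measurable.\<close>

lemma measurable_off_diagonal_neighbours:
  assumes "measurable_off_diagonal K"
  shows "measurable_off_diagonal (\<lambda>x y. \<Sum>a\<in>nbrs x. K a y)"
proof -
  obtain K' d where [measurable]: "K' \<in> borel_measurable pairs" "d \<in> borel_measurable V"
    and K: "\<And>x y. (x, y) \<in> same_component (space V) E \<Longrightarrow> K x y = K' (x, y) + of_bool (x = y) * d x"
    using assms by (rule measurable_off_diagonalE) blast
  define L where "L p = (\<Sum>a\<in>nbrs (fst p). K' (a, snd p)) + (if p \<in> E then d (snd p) else 0)" for p
  have "L \<in> borel_measurable pairs"
    unfolding L_def using neighbour_sum_real[of K'] by measurable
  moreover have "(\<Sum>a\<in>nbrs x. K a y) = L (x, y)" if "(x, y) \<in> same_component (space V) E" for x y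
  proof -
    have "(\<Sum>a\<in>nbrs x. K a y) = (\<Sum>a\<in>nbrs x. K' (a, y) + of_bool (a = y) * d a)"
      using same_component_edge[OF that] by (intro sum.cong) (auto simp: K)
    also have "\<dots> = L (x, y)"
      using sum_of_bool_point[of "nbrs x" y d] by (simp add: L_def sum.distrib)
    finally show ?thesis .
  qed
  ultimately show ?thesis
    unfolding measurable_off_diagonal_def by (intro exI[of _ L] exI[of _ "\<lambda>_. 0"]) simp
qed

lemma measurable_off_diagonal_mult:
  assumes "measurable_off_diagonal K" and [measurable]: "f \<in> borel_measurable V"
  shows "measurable_off_diagonal (\<lambda>x y. f x * K x y)"
proof -
  obtain K' d where [measurable]: "K' \<in> borel_measurable pairs" "d \<in> borel_measurable V"
    and K: "\<And>x y. (x, y) \<in> same_component (space V) E \<Longrightarrow> K x y = K' (x, y) + of_bool (x = y) * d x"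
    using assms(1) by (rule measurable_off_diagonalE) blast
  have "(\<lambda>p. f (fst p) * K' p) \<in> borel_measurable pairs" "(\<lambda>x. f x * d x) \<in> borel_measurable V"
    by measurable
  then show ?thesis unfolding measurable_off_diagonal_def
    by (intro exI[of _ "\<lambda>p. f (fst p) * K' p"] exI[of _ "\<lambda>x. f x * d x"]) (simp add: K algebra_simps)
qed

lemma measurable_off_diagonal_add:
  assumes "measurable_off_diagonal K" "measurable_off_diagonal L"
  shows "measurable_off_diagonal (\<lambda>x y. K x y + L x y)"
proof -
  obtain K' d where [measurable]: "K' \<in> borel_measurable pairs" "d \<in> borel_measurable V"
    and K: "\<And>x y. (x, y) \<in> same_component (space V) E \<Longrightarrow> K x y = K' (x, y) + of_bool (x = y) * d x"
    using assms(1) by (rule measurable_off_diagonalE) blast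
  obtain L' e where [measurable]: "L' \<in> borel_measurable pairs" "e \<in> borel_measurable V"
    and L: "\<And>x y. (x, y) \<in> same_component (space V) E \<Longrightarrow> L x y = L' (x, y) + of_bool (x = y) * e x"
    using assms(2) by (rule measurable_off_diagonalE) blast
  have "(\<lambda>p. K' p + L' p) \<in> borel_measurable pairs" "(\<lambda>x. d x + e x) \<in> borel_measurable V"
    by measurable
  then show ?thesis unfolding measurable_off_diagonal_def
    by (intro exI[of _ "\<lambda>p. K' p + L' p"] exI[of _ "\<lambda>x. d x + e x"]) (simp add: K L algebra_simps)
qed

lemma measurable_off_diagonal_diagonal:
  assumes "measurable_off_diagonal K" shows "(\<lambda>x. K x x) \<in> borel_measurable V"
proof -
  obtain K' d where [measurable]: "K' \<in> borel_measurable pairs" "d \<in> borel_measurable V"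
    and K: "\<And>x y. (x, y) \<in> same_component (space V) E \<Longrightarrow> K x y = K' (x, y) + of_bool (x = y) * d x"
    using assms(1) by (rule measurable_off_diagonalE) blast
  have "(\<lambda>x. K' (x, x) + d x) \<in> borel_measurable V" by measurable
  then show ?thesis
    by (rule iffD1[OF measurable_cong, rotated]) (simp add: K same_component_refl)
qed

lemma measurable_off_diagonal_swap:
  assumes "measurable_off_diagonal K" shows "measurable_off_diagonal (\<lambda>x y. K y x)"
proof -
  obtain K' d where [measurable]: "K' \<in> borel_measurable pairs" "d \<in> borel_measurable V"
    and K: "\<And>x y. (x, y) \<in> same_component (space V) E \<Longrightarrow> K x y = K' (x, y) + of_bool (x = y) * d x"
    using assms by (rule measurable_off_diagonalE) blast
  have "(\<lambda>p. K' (snd p, fst p)) \<in> borel_measurable pairs" by measurable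
  moreover have "K y x = K' (y, x) + of_bool (x = y) * d x" if "(x, y) \<in> same_component (space V) E" for x y
    using K[OF same_component_sym[OF that]] by auto
  ultimately show ?thesis unfolding measurable_off_diagonal_def
    by (intro exI[of _ "\<lambda>p. K' (snd p, fst p)"] exI[of _ d]) auto
qed

text \<open>The graph has no loops, so the diagonal part is invisible on edges.\<close>

lemma measurable_on_edges:
  assumes "measurable_off_diagonal K"
  shows "(\<lambda>p. of_bool (p \<in> E) * K (fst p) (snd p)) \<in> borel_measurable pairs"
proof -
  obtain K' d where [measurable]: "K' \<in> borel_measurable pairs" "d \<in> borel_measurable V"
    and K: "\<And>x y. (x, y) \<in> same_component (space V) E \<Longrightarrow> K x y = K' (x, y) + of_bool (x = y) * d x"
    using assms by (rule measurable_off_diagonalE) blast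
  have "(\<lambda>p. if p \<in> E then K' p else 0) \<in> borel_measurable pairs" by measurable
  then show ?thesis
  proof (rule iffD1[OF measurable_cong, rotated])
    fix p assume "p \<in> space pairs"
    then show "(if p \<in> E then K' p else 0) = of_bool (p \<in> E) * K (fst p) (snd p)"
      using K[of "fst p" "snd p"] edge_neq[of "fst p" "snd p"] by (auto simp: space_pairs)
  qed
qed

end

context graph_over
begin

lemma neighbours_fiber: "x \<in> fiber X \<omega> \<Longrightarrow> nbrs x \<subseteq> fiber X \<omega>"
  using edge_in edges_in_fibers by (fastforce simp: in_fiber_iff)

lemma neighbours_act:
  assumes g: "g \<in> space (arrows X)" and x: "x \<in> fiber X (gsource X g)"
  shows "nbrs (act X g x) = act X g ` (nbrs x)"
proof (intro set_eqI iffI)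
  fix y assume "y \<in> nbrs (act X g x)"
  then have e: "(act X g x, y) \<in> edges X" by simp
  have y: "y \<in> fiber X (grange X g)"
    using neighbours_fiber[OF act_fiber[OF g x]] e by blast
  have y': "act X g (act X (ginv X g) y) = y" by (rule act_act_ginv[OF g y])
  have "(x, act X (ginv X g) y) \<in> edges X"
    using e act_edges[OF g x act_ginv_fiber[OF g y]] y' by simp
  then show "y \<in> act X g ` (nbrs x)" using y' by force
next
  fix y assume "y \<in> act X g ` (nbrs x)"
  then obtain z where z: "y = act X g z" "(x, z) \<in> edges X" by auto
  have "z \<in> fiber X (gsource X g)" using neighbours_fiber[OF x] z(2) by blast
  then show "y \<in> nbrs (act X g x)" using act_edges[OF g x] z by auto
qed

lemma sum_neighbours_act:
  assumes g: "g \<in> space (arrows X)" and x: "x \<in> fiber X (gsource X g)"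
  shows "(\<Sum>y\<in>nbrs (act X g x). f y) = (\<Sum>y\<in>nbrs x. f (act X g y))"
  unfolding neighbours_act[OF assms]
  by (rule sum.reindex_cong[OF _ refl refl])
    (rule inj_on_subset[OF bij_betw_imp_inj_on[OF act_bij[OF g]] neighbours_fiber[OF x]])

lemma degree_act:
  assumes "g \<in> space (arrows X)" "x \<in> fiber X (gsource X g)"
  shows "degree (act X g x) = degree x"
  using sum_neighbours_act[OF assms, of "\<lambda>_. 1 :: real"] by (simp add: degree_def)

definition invariant_kernel :: "('v \<Rightarrow> 'v \<Rightarrow> real) \<Rightarrow> bool" where
  "invariant_kernel K \<longleftrightarrow> (\<forall>g\<in>space (arrows X). \<forall>x\<in>fiber X (gsource X g). \<forall>y\<in>fiber X (gsource X g).
     K (act X g x) (act X g y) = K x y)"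

lemma invariant_kernelD:
  "\<lbrakk>invariant_kernel K; g \<in> space (arrows X); x \<in> fiber X (gsource X g); y \<in> fiber X (gsource X g)\<rbrakk>
    \<Longrightarrow> K (act X g x) (act X g y) = K x y"
  by (simp add: invariant_kernel_def)

lemma act_eq_iff:
  "\<lbrakk>g \<in> space (arrows X); x \<in> fiber X (gsource X g); y \<in> fiber X (gsource X g)\<rbrakk>
    \<Longrightarrow> act X g x = act X g y \<longleftrightarrow> x = y"
  by (rule inj_on_eq_iff[OF bij_betw_imp_inj_on[OF act_bij]])

end

section \<open>Means and transport along edges\<close>

locale averaged_measure_graph = measure_graph X
  for X :: "('g, 'v, 'z) measure_graph_scheme" (structure) +
  fixes u :: "'v \<Rightarrow> ennreal"
  assumes averaging: "averaging_function X u"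
begin

lemma u_measurable [measurable]: "u \<in> borel_measurable (verts X)"
  using averaging unfolding averaging_function_def by blast

lemma u_finite: "(\<integral>\<^sup>+x. u x \<partial>vertex_measure X) < \<infinity>"
  by (rule averaging_finite[OF averaging])

text \<open>The finite measure \<open>u dM\<close>; integrals against it are called means.\<close>

definition weight :: "'v measure" where
  "weight = density (vertex_measure X) u"

abbreviation mean :: "('v \<Rightarrow> 'b::{banach, second_countable_topology}) \<Rightarrow> 'b" where
  "mean f \<equiv> integral\<^sup>L weight f"

lemma sets_weight [simp]: "sets weight = sets (verts X)"
  by (simp add: weight_def)

lemma space_weight [simp]: "space weight = space (verts X)"
  by (simp add: weight_def)

lemma borel_weight: "borel_measurable weight = borel_measurable (verts X)"
  by (rule measurable_cong_sets) auto

lemma nn_integral_weight: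
  assumes [measurable]: "f \<in> borel_measurable (verts X)"
  shows "(\<integral>\<^sup>+x. f x \<partial>weight) = (\<integral>\<^sup>+x. u x * f x \<partial>vertex_measure X)"
  unfolding weight_def by (rule nn_integral_density) (simp_all add: borel_vertex)

lemma finite_measure_weight: "finite_measure weight"
proof
  have "emeasure weight (space weight) = (\<integral>\<^sup>+x. 1 \<partial>weight)" by simp
  also have "\<dots> = (\<integral>\<^sup>+x. u x \<partial>vertex_measure X)" by (subst nn_integral_weight) auto
  finally show "emeasure weight (space weight) \<noteq> \<infinity>" using u_finite by simp
qed

lemma integrable_weight:
  fixes f :: "'v \<Rightarrow> 'b::{banach, second_countable_topology}"
  assumes "f \<in> borel_measurable (verts X)" "\<And>x. x \<in> space (verts X) \<Longrightarrow> norm (f x) \<le> B"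
  shows "integrable weight f"
  using assms by (intro finite_measure.integrable_const_bound[OF finite_measure_weight, of _ B] AE_I2)
    (auto simp: measurable_cong_sets[OF sets_weight refl])

definition max_deg :: real where
  "max_deg = real (max_degree (space (verts X)) (edges X))"

lemma degree_le: "degree x \<le> max_deg" "0 \<le> degree x"
  using card_neighbours_le[of x] by (auto simp: degree_def max_deg_def)

lemma max_deg_nonneg: "0 \<le> max_deg" by (simp add: max_deg_def)

lemma neighbour_sum_bound:
  fixes f :: "'v \<Rightarrow> real"
  assumes "\<And>y. y \<in> nbrs x \<Longrightarrow> \<bar>f y\<bar> \<le> C" "0 \<le> C"
  shows "\<bar>\<Sum>y\<in>nbrs x. f y\<bar> \<le> max_deg * C"
proof -
  have "\<bar>\<Sum>y\<in>nbrs x. f y\<bar> \<le> (\<Sum>y\<in>nbrs x. \<bar>f y\<bar>)" by (rule sum_abs)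
  also have "\<dots> \<le> degree x * C" using sum_bounded_above[of "nbrs x" "\<lambda>y. \<bar>f y\<bar>" C] assms
    by (simp add: degree_def)
  also have "\<dots> \<le> max_deg * C" using degree_le assms(2) by (intro mult_right_mono) auto
  finally show ?thesis .
qed

text \<open>The properties that give means to the diagonal and to neighbour sums and allow mass transport.\<close>

definition admissible :: "('v \<Rightarrow> 'v \<Rightarrow> real) \<Rightarrow> bool" where
  "admissible K \<longleftrightarrow> measurable_off_diagonal K \<and> invariant_kernel K \<and> (\<exists>B. \<forall>x y. \<bar>K x y\<bar> \<le> B)"

definition bounded_measurable :: "('v \<Rightarrow> real) \<Rightarrow> bool" where
  "bounded_measurable f \<longleftrightarrow> f \<in> borel_measurable (verts X) \<and> (\<exists>B. \<forall>x. \<bar>f x\<bar> \<le> B)"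

lemma admissible_identity: "admissible (\<lambda>x y. of_bool (x = y))"
  unfolding admissible_def
  by (auto simp: measurable_off_diagonal_identity invariant_kernel_def act_eq_iff intro!: exI[of _ 1])

lemma admissible_neighbours:
  assumes "admissible K" shows "admissible (\<lambda>x y. \<Sum>a\<in>nbrs x. K a y)"
proof -
  from assms obtain B where K: "measurable_off_diagonal K" "invariant_kernel K" "\<And>x y. \<bar>K x y\<bar> \<le> B"
    unfolding admissible_def by blast
  have B: "0 \<le> B" using K(3) abs_ge_zero order_trans by blast
  have "invariant_kernel (\<lambda>x y. \<Sum>a\<in>nbrs x. K a y)"
    unfolding invariant_kernel_def
  proof (intro ballI)
    fix g x y assume *: "g \<in> space (arrows X)" "x \<in> fiber X (gsource X g)" "y \<in> fiber X (gsource X g)"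
    show "(\<Sum>a\<in>nbrs (act X g x). K a (act X g y)) = (\<Sum>a\<in>nbrs x. K a y)"
      unfolding sum_neighbours_act[OF *(1,2)]
      by (intro sum.cong refl invariant_kernelD[OF K(2) *(1) _ *(3)])
        (use neighbours_fiber[OF *(2)] in blast)
  qed
  moreover have "\<bar>\<Sum>a\<in>nbrs x. K a y\<bar> \<le> max_deg * B" for x y
    by (rule neighbour_sum_bound) (simp_all add: K(3) B)
  ultimately show ?thesis
    using measurable_off_diagonal_neighbours[OF K(1)] unfolding admissible_def by blast
qed

lemma admissible_mult:
  assumes "admissible K" "bounded_measurable f"
    and inv: "\<And>g x. \<lbrakk>g \<in> space (arrows X); x \<in> fiber X (gsource X g)\<rbrakk> \<Longrightarrow> f (act X g x) = f x"
  shows "admissible (\<lambda>x y. f x * K x y)"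
proof -
  from assms obtain B where K: "measurable_off_diagonal K" "invariant_kernel K" "\<And>x y. \<bar>K x y\<bar> \<le> B"
    unfolding admissible_def by blast
  from assms obtain C where f: "f \<in> borel_measurable (verts X)" "\<And>x. \<bar>f x\<bar> \<le> C"
    unfolding bounded_measurable_def by blast
  have C: "0 \<le> C" using f(2) abs_ge_zero order_trans by blast
  have "invariant_kernel (\<lambda>x y. f x * K x y)"
    using K(2) by (auto simp: invariant_kernel_def inv)
  moreover have "\<bar>f x * K x y\<bar> \<le> C * B" for x y
    unfolding abs_mult by (intro mult_mono f K C) simp
  ultimately show ?thesis
    using measurable_off_diagonal_mult[OF K(1) f(1)] unfolding admissible_def by blast
qed

lemma admissible_add:
  assumes "admissible K" "admissible L" shows "admissible (\<lambda>x y. K x y + L x y)"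
proof -
  from assms obtain B C where B: "\<And>x y. \<bar>K x y\<bar> \<le> B" and C: "\<And>x y. \<bar>L x y\<bar> \<le> C"
    unfolding admissible_def by blast
  have "\<bar>K x y + L x y\<bar> \<le> B + C" for x y
    using abs_triangle_ineq[of "K x y" "L x y"] B[of x y] C[of x y] by linarith
  then show ?thesis using assms measurable_off_diagonal_add[of K L]
    unfolding admissible_def by (auto simp: invariant_kernel_def)
qed

lemma bounded_measurable_const: "bounded_measurable (\<lambda>_. c)"
  by (auto simp: bounded_measurable_def)

lemma bounded_measurable_add:
  assumes "bounded_measurable f" "bounded_measurable g" shows "bounded_measurable (\<lambda>x. f x + g x)"
proof -
  from assms obtain B C where B: "\<And>x. \<bar>f x\<bar> \<le> B" and C: "\<And>x. \<bar>g x\<bar> \<le> C"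
    unfolding bounded_measurable_def by blast
  have "\<bar>f x + g x\<bar> \<le> B + C" for x
    using abs_triangle_ineq[of "f x" "g x"] B[of x] C[of x] by linarith
  then show ?thesis using assms unfolding bounded_measurable_def by auto
qed

lemma bounded_measurable_mult:
  assumes "bounded_measurable f" "bounded_measurable g" shows "bounded_measurable (\<lambda>x. f x * g x)"
proof -
  from assms obtain B C where B: "\<And>x. \<bar>f x\<bar> \<le> B" and C: "\<And>x. \<bar>g x\<bar> \<le> C"
    unfolding bounded_measurable_def by blast
  have "0 \<le> B" using B abs_ge_zero order_trans by blast
  then have "\<bar>f x * g x\<bar> \<le> B * C" for x
    unfolding abs_mult by (intro mult_mono B C) simp_all
  then show ?thesis using assms unfolding bounded_measurable_def by auto
qed

lemma bounded_measurable_diff: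
  assumes "bounded_measurable f" "bounded_measurable g" shows "bounded_measurable (\<lambda>x. f x - g x)"
  using bounded_measurable_add[OF assms(1) bounded_measurable_mult[OF bounded_measurable_const[of "-1"] assms(2)]]
  by simp

lemma bounded_measurable_degree: "bounded_measurable degree"
  using degree_le by (auto simp: bounded_measurable_def intro!: exI[of _ max_deg])

lemma bounded_measurable_diagonal: "admissible K \<Longrightarrow> bounded_measurable (\<lambda>x. K x x)"
  using measurable_off_diagonal_diagonal unfolding admissible_def bounded_measurable_def by blast

lemma bounded_measurable_integrable: "bounded_measurable f \<Longrightarrow> integrable weight f"
  unfolding bounded_measurable_def using integrable_weight[of f] by (metis real_norm_def)

lemma mean_add:
  "bounded_measurable f \<Longrightarrow> bounded_measurable g \<Longrightarrow> mean (\<lambda>x. f x + g x) = mean f + mean g"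
  by (intro Bochner_Integration.integral_add bounded_measurable_integrable)

lemma mean_diff:
  "bounded_measurable f \<Longrightarrow> bounded_measurable g \<Longrightarrow> mean (\<lambda>x. f x - g x) = mean f - mean g"
  by (intro Bochner_Integration.integral_diff bounded_measurable_integrable)

lemma admissible_cmult: "admissible K \<Longrightarrow> admissible (\<lambda>x y. c * K x y)"
  by (rule admissible_mult[OF _ bounded_measurable_const]) simp_all

lemma admissible_diff:
  assumes "admissible K" "admissible L" shows "admissible (\<lambda>x y. K x y - L x y)"
  using admissible_add[OF assms(1) admissible_cmult[OF assms(2), of "-1"]] by simp

lemma admissible_const: "admissible (\<lambda>x y. c)"
  unfolding admissible_def
  by (auto simp: invariant_kernel_def intro!: measurable_off_diagonalI[of "\<lambda>_. c"])

lemma admissible_swap: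
  assumes "admissible K" shows "admissible (\<lambda>x y. K y x)"
  using assms measurable_off_diagonal_swap unfolding admissible_def invariant_kernel_def by blast

lemma admissible_on_edges:
  assumes "admissible K" shows "admissible (\<lambda>x y. of_bool ((x, y) \<in> edges X) * K x y)"
proof -
  from assms obtain B where K: "measurable_off_diagonal K" "invariant_kernel K" "\<And>x y. \<bar>K x y\<bar> \<le> B"
    unfolding admissible_def by blast
  have "0 \<le> B" using K(3) abs_ge_zero order_trans by blast
  then have "\<bar>of_bool ((x, y) \<in> edges X) * K x y\<bar> \<le> B" for x y using K(3) by auto
  moreover have "invariant_kernel (\<lambda>x y. of_bool ((x, y) \<in> edges X) * K x y)"
    using K(2) by (auto simp: invariant_kernel_def act_edges)
  moreover have "measurable_off_diagonal (\<lambda>x y. of_bool ((x, y) \<in> edges X) * K x y)"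
    by (rule measurable_off_diagonalI[OF measurable_on_edges[OF K(1)]]) simp
  ultimately show ?thesis unfolding admissible_def by blast
qed

lemma admissible_diagonal:
  assumes "admissible K" shows "admissible (\<lambda>x y. K x x)"
proof -
  from assms obtain B where K: "measurable_off_diagonal K" "invariant_kernel K" "\<And>x y. \<bar>K x y\<bar> \<le> B"
    unfolding admissible_def by blast
  have "measurable_off_diagonal (\<lambda>x y. K x x)"
    by (rule measurable_off_diagonalI[OF measurable_compose[OF fst_pairs measurable_off_diagonal_diagonal[OF K(1)]]]) simp
  then show ?thesis using K unfolding admissible_def invariant_kernel_def by blast
qed

lemma bounded_measurable_neighbour_sum:
  assumes "admissible \<phi>" shows "bounded_measurable (\<lambda>x. \<Sum>y\<in>nbrs x. \<phi> x y)"
  by (rule bounded_measurable_diagonal[OF admissible_neighbours[OF admissible_swap[OF assms]]])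

lemma edge_transport_nonneg:
  assumes adm: "admissible \<phi>" and nonneg: "\<And>x y. 0 \<le> \<phi> x y"
  shows "(\<integral>\<^sup>+x. ennreal (\<Sum>y\<in>nbrs x. \<phi> x y) \<partial>weight)
    = (\<integral>\<^sup>+x. ennreal (\<Sum>y\<in>nbrs x. \<phi> y x) \<partial>weight)"
proof -
  define \<psi> where "\<psi> x y = (if (x, y) \<in> edges X then ennreal (\<phi> x y) else 0)" for x y
  have fib: "nbrs x \<subseteq> fiber X (proj X x)" if "x \<in> space (verts X)" for x
    by (rule neighbours_fiber) (simp add: in_fiber_iff that)
  have s1: "(\<integral>\<^sup>+y. \<psi> x y \<partial>\<eta> (proj X x)) = ennreal (\<Sum>y\<in>nbrs x. \<phi> x y)"
    if "x \<in> space (verts X)" for x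
  proof -
    have "(\<integral>\<^sup>+y. \<psi> x y \<partial>\<eta> (proj X x)) = (\<Sum>y\<in>nbrs x. \<psi> x y)"
      by (rule nn_integral_count_space') (use fib[OF that] in \<open>auto simp: \<psi>_def\<close>)
    also have "\<dots> = (\<Sum>y\<in>nbrs x. ennreal (\<phi> x y))" by (simp add: \<psi>_def)
    also have "\<dots> = ennreal (\<Sum>y\<in>nbrs x. \<phi> x y)" by (rule sum_ennreal) (rule nonneg)
    finally show ?thesis .
  qed
  have s2: "(\<integral>\<^sup>+y. \<psi> y x \<partial>\<eta> (proj X x)) = ennreal (\<Sum>y\<in>nbrs x. \<phi> y x)"
    if "x \<in> space (verts X)" for x
  proof -
    have "(\<integral>\<^sup>+y. \<psi> y x \<partial>\<eta> (proj X x)) = (\<Sum>y\<in>nbrs x. \<psi> y x)"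
      by (rule nn_integral_count_space') (use fib[OF that] in \<open>auto simp: \<psi>_def dest: edge_sym[THEN iffD1]\<close>)
    also have "\<dots> = (\<Sum>y\<in>nbrs x. ennreal (\<phi> y x))"
      by (rule sum.cong) (auto simp: \<psi>_def dest: edge_sym[THEN iffD1])
    also have "\<dots> = ennreal (\<Sum>y\<in>nbrs x. \<phi> y x)"
      by (rule sum_ennreal) (rule nonneg)
    finally show ?thesis .
  qed
  have s3: "(\<integral>\<^sup>+y. u y * \<psi> y x \<partial>\<eta> (proj X x)) = (\<Sum>y\<in>nbrs x. u y * \<psi> y x)"
    if "x \<in> space (verts X)" for x
    by (rule nn_integral_count_space') (use fib[OF that] in \<open>auto simp: \<psi>_def dest: edge_sym[THEN iffD1]\<close>)
  have m1: "(\<lambda>x. ennreal (\<Sum>y\<in>nbrs x. \<phi> x y)) \<in> borel_measurable (verts X)"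
    using bounded_measurable_neighbour_sum[OF adm] unfolding bounded_measurable_def
    by (intro measurable_compose[OF _ measurable_ennreal]) blast
  have m2: "(\<lambda>x. ennreal (\<Sum>y\<in>nbrs x. \<phi> y x)) \<in> borel_measurable (verts X)"
    using bounded_measurable_neighbour_sum[OF admissible_swap[OF adm]] unfolding bounded_measurable_def
    by (intro measurable_compose[OF _ measurable_ennreal]) blast
  have m3: "(\<lambda>x. \<Sum>y\<in>nbrs x. u y * \<psi> y x) \<in> borel_measurable (verts X)"
  proof -
    have [measurable]: "(\<lambda>p. of_bool (p \<in> edges X) * \<phi> (fst p) (snd p)) \<in> borel_measurable pairs"
      using adm measurable_on_edges unfolding admissible_def by blast
    have "(\<lambda>p. u (fst p) * ennreal (of_bool (p \<in> edges X) * \<phi> (fst p) (snd p))) \<in> borel_measurable pairs"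
      by measurable
    also have "(\<lambda>p. u (fst p) * ennreal (of_bool (p \<in> edges X) * \<phi> (fst p) (snd p)))
        = (\<lambda>p. u (fst p) * \<psi> (fst p) (snd p))"
      by (auto simp: \<psi>_def)
    finally show ?thesis using neighbour_sum_vertex_ennreal by force
  qed
  have "(\<integral>\<^sup>+x. u x * (\<integral>\<^sup>+y. \<psi> x y \<partial>\<eta> (proj X x)) \<partial>vertex_measure X)
    = (\<integral>\<^sup>+y. u y * (\<integral>\<^sup>+x. \<psi> x y \<partial>\<eta> (proj X y)) \<partial>vertex_measure X)"
  proof (rule mass_transport_nonneg[OF averaging averaging, where \<phi> = \<psi>])
    fix g x y assume "g \<in> space (arrows X)" "x \<in> fiber X (gsource X g)" "y \<in> fiber X (gsource X g)"
    then show "\<psi> (act X g x) (act X g y) = \<psi> x y"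
      using adm by (simp add: \<psi>_def act_edges admissible_def invariant_kernelD)
  next
    show "(\<lambda>x. \<integral>\<^sup>+y. \<psi> x y \<partial>\<eta> (proj X x)) \<in> borel_measurable (verts X)"
      by (rule iffD2[OF measurable_cong m1]) (rule s1)
    show "(\<lambda>x. \<integral>\<^sup>+y. \<psi> y x \<partial>\<eta> (proj X x)) \<in> borel_measurable (verts X)"
      by (rule iffD2[OF measurable_cong m2]) (rule s2)
    show "(\<lambda>x. \<integral>\<^sup>+y. u y * \<psi> y x \<partial>\<eta> (proj X x)) \<in> borel_measurable (verts X)"
      by (rule iffD2[OF measurable_cong m3]) (rule s3)
  qed
  also have "(\<integral>\<^sup>+x. u x * (\<integral>\<^sup>+y. \<psi> x y \<partial>\<eta> (proj X x)) \<partial>vertex_measure X)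
      = (\<integral>\<^sup>+x. ennreal (\<Sum>y\<in>nbrs x. \<phi> x y) \<partial>weight)"
    by (subst nn_integral_weight[OF m1], rule nn_integral_cong) (simp add: s1)
  also have "(\<integral>\<^sup>+x. u x * (\<integral>\<^sup>+y. \<psi> y x \<partial>\<eta> (proj X x)) \<partial>vertex_measure X)
      = (\<integral>\<^sup>+x. ennreal (\<Sum>y\<in>nbrs x. \<phi> y x) \<partial>weight)"
    by (subst nn_integral_weight[OF m2], rule nn_integral_cong) (simp add: s2)
  finally show ?thesis .
qed

text \<open>Adding a constant makes the kernel nonnegative, and the constant contributes the same finite amount
  to both sides.\<close>

lemma edge_transport:
  assumes \<phi>: "admissible \<phi>"
  shows "mean (\<lambda>x. \<Sum>y\<in>nbrs x. \<phi> x y) = mean (\<lambda>x. \<Sum>y\<in>nbrs x. \<phi> y x)"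
proof -
  obtain C where C: "\<And>x y. \<bar>\<phi> x y\<bar> \<le> C" using \<phi> unfolding admissible_def by blast
  define \<psi> where "\<psi> x y = \<phi> x y + C" for x y
  have \<psi>: "admissible \<psi>" unfolding \<psi>_def by (rule admissible_add[OF \<phi> admissible_const])
  have nonneg: "0 \<le> \<psi> x y" for x y using C[of x y] by (simp add: \<psi>_def)
  have real: "mean (\<lambda>x. \<Sum>y\<in>nbrs x. \<theta> x y)
      = enn2real (\<integral>\<^sup>+x. ennreal (\<Sum>y\<in>nbrs x. \<theta> x y) \<partial>weight)"
    if "admissible \<theta>" "\<And>x y. 0 \<le> \<theta> x y" for \<theta>
    using bounded_measurable_neighbour_sum[OF that(1)] that(2) unfolding bounded_measurable_def
    by (intro integral_eq_nn_integral AE_I2) (auto simp: borel_weight intro!: sum_nonneg)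
  have split: "mean (\<lambda>x. \<Sum>y\<in>nbrs x. \<theta> x y + C)
      = mean (\<lambda>x. \<Sum>y\<in>nbrs x. \<theta> x y) + mean (\<lambda>x. degree x * C)"
    if "admissible \<theta>" for \<theta>
    using mean_add[OF bounded_measurable_neighbour_sum[OF that]
        bounded_measurable_mult[OF bounded_measurable_degree bounded_measurable_const[of C]]]
    by (simp add: sum.distrib degree_def)
  have "mean (\<lambda>x. \<Sum>y\<in>nbrs x. \<psi> x y) = mean (\<lambda>x. \<Sum>y\<in>nbrs x. \<psi> y x)"
    using edge_transport_nonneg[OF \<psi> nonneg] real[OF \<psi> nonneg] real[OF admissible_swap[OF \<psi>] nonneg] by simp
  then show ?thesis
    unfolding \<psi>_def split[OF \<phi>] split[OF admissible_swap[OF \<phi>]] by simp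
qed

end

section \<open>Non-backtracking walks\<close>

definition nonbacktracking :: "('v \<times> 'v) list \<Rightarrow> bool" where
  "nonbacktracking es \<longleftrightarrow> (\<forall>i. Suc i < length es \<longrightarrow> es ! Suc i \<noteq> prod.swap (es ! i))"

lemma nonbacktracking_Cons:
  "nonbacktracking (e # es) \<longleftrightarrow> nonbacktracking es \<and> (es \<noteq> [] \<longrightarrow> hd es \<noteq> prod.swap e)"
  unfolding nonbacktracking_def by (cases es) (auto simp: nth_Cons split: nat.splits)

lemma is_path_Cons:
  "is_path E (e # es) \<longleftrightarrow> e \<in> E \<and> is_path E es \<and> (es \<noteq> [] \<longrightarrow> snd e = fst (hd es))"
  unfolding is_path_def by (cases es) (auto simp: nth_Cons split: nat.splits)

context simple_graph
begin

text \<open>The number of non-backtracking paths with \<open>n + 1\<close> edges that begin with the edge \<open>e\<close> and end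
  with \<open>e'\<close>, that is, an entry of the \<open>n\<close>-th power of the Hashimoto edge matrix.\<close>

primrec nb_count :: "nat \<Rightarrow> 'v \<times> 'v \<Rightarrow> 'v \<times> 'v \<Rightarrow> real" where
  "nb_count 0 e e' = of_bool (e = e')"
| "nb_count (Suc n) e e' = (\<Sum>a\<in>nbrs (snd e) - {fst e}. nb_count n (snd e, a) e')"

definition nb_paths :: "nat \<Rightarrow> 'v \<times> 'v \<Rightarrow> 'v \<times> 'v \<Rightarrow> ('v \<times> 'v) list set" where
  "nb_paths n e e' = {es. length es = Suc n \<and> is_path E es \<and> nonbacktracking es \<and> hd es = e \<and> last es = e'}"

lemma nb_paths_Suc:
  assumes "e \<in> E"
  shows "nb_paths (Suc n) e e' = (\<Union>a\<in>nbrs (snd e) - {fst e}. (#) e ` nb_paths n (snd e, a) e')"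
proof (intro set_eqI iffI)
  fix es assume es: "es \<in> nb_paths (Suc n) e e'"
  then obtain f fs where [simp]: "es = e # f # fs"
    unfolding nb_paths_def by (auto simp: length_Suc_conv)
  obtain a b where [simp]: "f = (a, b)" by (cases f)
  from es have p: "is_path E (e # f # fs)" "nonbacktracking (e # f # fs)" "length fs = n" "last (f # fs) = e'"
    by (auto simp: nb_paths_def)
  have q: "snd e = a" "is_path E (f # fs)" "(a, b) \<in> E"
    using p(1) is_path_Cons[of E e "f # fs"] is_path_Cons[of E f fs] by simp_all
  have "nonbacktracking (f # fs)" "f \<noteq> prod.swap e"
    using p(2) nonbacktracking_Cons[of e "f # fs"] by simp_all
  then have "b \<in> nbrs (snd e) - {fst e}" "f # fs \<in> nb_paths n (snd e, b) e'"
    using q p by (auto simp: nb_paths_def prod_eq_iff)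
  then show "es \<in> (\<Union>a\<in>nbrs (snd e) - {fst e}. (#) e ` nb_paths n (snd e, a) e')" by auto
next
  fix es assume "es \<in> (\<Union>a\<in>nbrs (snd e) - {fst e}. (#) e ` nb_paths n (snd e, a) e')"
  then obtain a fs where "es = e # fs" "a \<in> nbrs (snd e) - {fst e}" "fs \<in> nb_paths n (snd e, a) e'"
    by auto
  then show "es \<in> nb_paths (Suc n) e e'" using assms
    unfolding nb_paths_def by (auto simp: is_path_Cons nonbacktracking_Cons prod_eq_iff)
qed

lemma nb_paths_hd: "es \<in> nb_paths n e e' \<Longrightarrow> hd es = e"
  by (simp add: nb_paths_def)

lemma card_nb_paths:
  assumes "e \<in> E"
  shows "finite (nb_paths n e e') \<and> real (card (nb_paths n e e')) = nb_count n e e'"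
  using assms
proof (induction n arbitrary: e)
  case 0
  then have "nb_paths 0 e e' = (if e = e' then {[e]} else {})"
    by (auto simp: nb_paths_def length_Suc_conv is_path_def nonbacktracking_def)
  then show ?case by simp
next
  case (Suc n)
  have IH: "finite (nb_paths n (snd e, a) e')" "real (card (nb_paths n (snd e, a) e')) = nb_count n (snd e, a) e'"
    if "a \<in> nbrs (snd e) - {fst e}" for a
    using Suc.IH[of "(snd e, a)"] that by auto
  have "card (\<Union>a\<in>nbrs (snd e) - {fst e}. (#) e ` nb_paths n (snd e, a) e')
      = (\<Sum>a\<in>nbrs (snd e) - {fst e}. card ((#) e ` nb_paths n (snd e, a) e'))"
    using IH(1) by (intro card_UN_disjoint) (auto dest!: nb_paths_hd)
  also have "\<dots> = (\<Sum>a\<in>nbrs (snd e) - {fst e}. card (nb_paths n (snd e, a) e'))"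
    by (intro sum.cong card_image) (auto simp: inj_on_def)
  finally have "real (card (nb_paths (Suc n) e e')) = (\<Sum>a\<in>nbrs (snd e) - {fst e}. real (card (nb_paths n (snd e, a) e')))"
    by (simp add: nb_paths_Suc[OF Suc.prems])
  also have "\<dots> = nb_count (Suc n) e e'" using IH(2) by simp
  finally show ?case using IH(1) by (auto simp: nb_paths_Suc[OF Suc.prems])
qed

text \<open>Powers of the Hashimoto matrix commute with it, so the recursion can also peel off the last edge.\<close>

lemma nb_count_Suc_right:
  assumes "e \<in> E" "e' \<in> E"
  shows "nb_count (Suc n) e e' = (\<Sum>b\<in>nbrs (fst e') - {snd e'}. nb_count n e (b, fst e'))"
  using assms(1)
proof (induction n arbitrary: e)
  case 0
  have l: "(\<Sum>a\<in>nbrs (snd e) - {fst e}. of_bool ((snd e, a) = e') :: real)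
      = of_bool (snd e = fst e' \<and> snd e' \<noteq> fst e)"
  proof (cases "snd e = fst e' \<and> snd e' \<noteq> fst e")
    case True
    then have "(\<Sum>a\<in>nbrs (snd e) - {fst e}. of_bool ((snd e, a) = e') :: real) = (\<Sum>a\<in>{snd e'}. 1)"
      using assms(2) by (intro sum.mono_neutral_cong_right) (auto simp: prod_eq_iff)
    then show ?thesis using True by simp
  next
    case False
    then show ?thesis by (subst sum.neutral) auto
  qed
  have r: "(\<Sum>b\<in>nbrs (fst e') - {snd e'}. of_bool (e = (b, fst e')) :: real)
      = of_bool (snd e = fst e' \<and> snd e' \<noteq> fst e)"
  proof (cases "snd e = fst e' \<and> snd e' \<noteq> fst e")
    case True
    then have "(\<Sum>b\<in>nbrs (fst e') - {snd e'}. of_bool (e = (b, fst e')) :: real) = (\<Sum>b\<in>{fst e}. 1)"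
      using 0 edge_sym[of "fst e" "snd e"]
      by (cases e, intro sum.mono_neutral_cong_right) auto
    then show ?thesis using True by simp
  next
    case False
    then show ?thesis by (subst sum.neutral) auto
  qed
  show ?case using l r by simp
next
  case (Suc n)
  have "nb_count (Suc (Suc n)) e e' = (\<Sum>a\<in>nbrs (snd e) - {fst e}. nb_count (Suc n) (snd e, a) e')"
    by (rule nb_count.simps)
  also have "\<dots> = (\<Sum>a\<in>nbrs (snd e) - {fst e}. \<Sum>b\<in>nbrs (fst e') - {snd e'}. nb_count n (snd e, a) (b, fst e'))"
    by (rule sum.cong[OF refl], rule Suc.IH) auto
  also have "\<dots> = (\<Sum>b\<in>nbrs (fst e') - {snd e'}. nb_count (Suc n) e (b, fst e'))"
    by (subst sum.swap) simp
  finally show ?case .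
qed

lemma nb_count_reverse:
  assumes "e \<in> E" "e' \<in> E"
  shows "nb_count n e e' = nb_count n (prod.swap e') (prod.swap e)"
  using assms
proof (induction n arbitrary: e e')
  case 0
  then show ?case by (auto simp: prod_eq_iff)
next
  case (Suc n)
  have sw: "prod.swap e \<in> E" using Suc.prems(1) edge_sym[of "fst e" "snd e"] by (cases e) simp
  have sw': "prod.swap e' \<in> E" using Suc.prems(2) edge_sym[of "fst e'" "snd e'"] by (cases e') simp
  have "nb_count (Suc n) e e' = (\<Sum>a\<in>nbrs (snd e) - {fst e}. nb_count n (prod.swap e') (a, snd e))"
    unfolding nb_count.simps
  proof (rule sum.cong[OF refl])
    fix a assume "a \<in> nbrs (snd e) - {fst e}"
    then show "nb_count n (snd e, a) e' = nb_count n (prod.swap e') (a, snd e)"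
      using Suc.IH[of "(snd e, a)" e'] Suc.prems by simp
  qed
  also have "\<dots> = nb_count (Suc n) (prod.swap e') (prod.swap e)"
    using nb_count_Suc_right[OF sw' sw] by simp
  finally show ?case .
qed

text \<open>In the counts from here to \<open>tailed\<close>, \<open>n\<close> stands for walks with \<open>n + 1\<close> edges.\<close>

definition nb_from_edge :: "nat \<Rightarrow> 'v \<Rightarrow> 'v \<Rightarrow> 'v \<Rightarrow> real" where
  "nb_from_edge n x y z = (\<Sum>b\<in>nbrs z. nb_count n (x, y) (b, z))"

definition nb_walks :: "nat \<Rightarrow> 'v \<Rightarrow> 'v \<Rightarrow> real" where
  "nb_walks n x z = (\<Sum>y\<in>nbrs x. nb_from_edge n x y z)"

definition tail_count :: "nat \<Rightarrow> 'v \<Rightarrow> 'v \<Rightarrow> real" where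
  "tail_count n x y = nb_count n (x, y) (y, x)"

definition tailed :: "nat \<Rightarrow> 'v \<Rightarrow> real" where
  "tailed n x = (\<Sum>y\<in>nbrs x. tail_count n x y)"

lemma nb_from_edge_0: "(x, y) \<in> E \<Longrightarrow> nb_from_edge 0 x y z = of_bool (y = z)"
proof (cases "y = z")
  case True
  assume "(x, y) \<in> E"
  then have "(\<Sum>b\<in>nbrs z. of_bool ((x, y) = (b, z)) :: real) = (\<Sum>b\<in>{x}. 1)"
    using True edge_sym[of x y] by (intro sum.mono_neutral_cong_right) auto
  then show ?thesis using True by (simp add: nb_from_edge_def)
qed (simp add: nb_from_edge_def)

text \<open>After the edge from \<open>x\<close> to \<open>y\<close> every walk from \<open>y\<close> is allowed except those that return to \<open>x\<close>
  at once. For \<open>z = x\<close> and \<open>z = y\<close> this recursion stays within functions on edges.\<close>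

lemma nb_from_edge_Suc:
  assumes "(x, y) \<in> E"
  shows "nb_from_edge (Suc n) x y z = nb_walks n y z - nb_from_edge n y x z"
proof -
  have "nb_from_edge (Suc n) x y z = (\<Sum>a\<in>nbrs y - {x}. nb_from_edge n y a z)"
    unfolding nb_from_edge_def nb_count.simps fst_conv snd_conv by (rule sum.swap)
  also have "\<dots> = nb_walks n y z - nb_from_edge n y x z"
    using assms edge_sym[of x y] by (subst sum_diff1) (auto simp: nb_walks_def)
  finally show ?thesis .
qed

lemma nb_walks_0: "nb_walks 0 x z = of_bool ((x, z) \<in> E)"
proof -
  have "nb_walks 0 x z = (\<Sum>y\<in>nbrs x. of_bool (y = z))"
    unfolding nb_walks_def by (intro sum.cong) (auto simp: nb_from_edge_0)
  also have "\<dots> = of_bool ((x, z) \<in> E)"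
    using sum_of_bool_point[of "nbrs x" z "\<lambda>_. 1"] by simp
  finally show ?thesis .
qed

lemma nb_walks_1: "nb_walks 1 x z = (\<Sum>y\<in>nbrs x. nb_walks 0 y z) - degree x * of_bool (x = z)"
proof -
  have "nb_walks 1 x z = (\<Sum>y\<in>nbrs x. nb_walks 0 y z - of_bool (x = z))"
    unfolding nb_walks_def[of 1]
    by (intro sum.cong) (auto simp: nb_from_edge_Suc nb_from_edge_0 edge_sym[of _ x])
  then show ?thesis by (simp add: sum_subtractf degree_def)
qed

lemma nb_walks_Suc_Suc:
  "nb_walks (Suc (Suc n)) x z = (\<Sum>y\<in>nbrs x. nb_walks (Suc n) y z) - (degree x - 1) * nb_walks n x z"
proof -
  have "nb_walks (Suc (Suc n)) x z
      = (\<Sum>y\<in>nbrs x. nb_walks (Suc n) y z - (nb_walks n x z - nb_from_edge n x y z))"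
    unfolding nb_walks_def[of "Suc (Suc n)"]
  proof (intro sum.cong refl)
    fix y assume "y \<in> nbrs x"
    then have e: "(x, y) \<in> E" "(y, x) \<in> E" using edge_sym[of x y] by auto
    show "nb_from_edge (Suc (Suc n)) x y z = nb_walks (Suc n) y z - (nb_walks n x z - nb_from_edge n x y z)"
      using nb_from_edge_Suc[OF e(1)] nb_from_edge_Suc[OF e(2)] by simp
  qed
  also have "\<dots> = (\<Sum>y\<in>nbrs x. nb_walks (Suc n) y z) - degree x * nb_walks n x z + nb_walks n x z"
    by (simp add: sum_subtractf degree_def nb_walks_def[of n x z])
  finally show ?thesis by (simp add: algebra_simps)
qed

text \<open>The coefficient of \<open>z\<^sup>n\<close> in the inverse of \<open>I - z A + z\<^sup>2 Q\<close>.\<close>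

fun weighted_walks :: "nat \<Rightarrow> 'v \<Rightarrow> 'v \<Rightarrow> real" where
  "weighted_walks 0 x y = of_bool (x = y)"
| "weighted_walks (Suc 0) x y = of_bool ((x, y) \<in> E)"
| "weighted_walks (Suc (Suc n)) x y
    = (\<Sum>a\<in>nbrs x. weighted_walks (Suc n) a y) - (degree x - 1) * weighted_walks n x y"

text \<open>Both sides satisfy \<open>K\<^sub>n\<^sub>+\<^sub>2 = A K\<^sub>n\<^sub>+\<^sub>1 - Q K\<^sub>n\<close>. The right-hand side is the coefficient of
  \<open>z\<^sup>n\<^sup>+\<^sup>2\<close> in \<open>1 - z\<^sup>2\<close> times the inverse of \<open>I - z A + z\<^sup>2 Q\<close>.\<close>

lemma nb_walks_Suc_eq: "nb_walks (Suc n) x z = weighted_walks (Suc (Suc n)) x z - weighted_walks n x z"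
proof (induction n arbitrary: x rule: less_induct)
  case (less n)
  consider "n = 0" | "n = 1" | k where "n = Suc (Suc k)"
    by (metis One_nat_def not0_implies_Suc)
  then show ?case
  proof cases
    case 1
    then show ?thesis using nb_walks_1[of x z] by (simp add: nb_walks_0 algebra_simps)
  next
    case 2
    have a: "(\<Sum>a\<in>nbrs x. of_bool (a = z) :: real) = of_bool ((x, z) \<in> E)"
      using sum_of_bool_point[of "nbrs x" z "\<lambda>_. 1"] by simp
    have "nb_walks (Suc (Suc 0)) x z = (\<Sum>y\<in>nbrs x. weighted_walks (Suc (Suc 0)) y z - weighted_walks 0 y z)
        - (degree x - 1) * weighted_walks 1 x z"
      unfolding nb_walks_Suc_Suc using less.IH[of 0] 2 by (simp add: nb_walks_0)
    also have "\<dots> = weighted_walks (Suc (Suc (Suc 0))) x z - weighted_walks (Suc 0) x z"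
      by (simp only: sum_subtractf weighted_walks.simps a One_nat_def)
    finally show ?thesis using 2 by simp
  next
    case 3
    have ww_n: "weighted_walks n x z
        = (\<Sum>y\<in>nbrs x. weighted_walks (Suc k) y z) - (degree x - 1) * weighted_walks k x z"
      unfolding 3 by (rule weighted_walks.simps)
    have "nb_walks (Suc n) x z = (\<Sum>y\<in>nbrs x. nb_walks (Suc (Suc k)) y z) - (degree x - 1) * nb_walks (Suc k) x z"
      by (simp add: 3 nb_walks_Suc_Suc)
    also have "\<dots> = (\<Sum>y\<in>nbrs x. weighted_walks (Suc n) y z - weighted_walks (Suc k) y z)
       - (degree x - 1) * (weighted_walks n x z - weighted_walks k x z)"
      using less.IH[of k] less.IH[of "Suc k"] 3 by (simp del: weighted_walks.simps)
    also have "\<dots> = weighted_walks (Suc (Suc n)) x z - weighted_walks n x z"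
      unfolding sum_subtractf right_diff_distrib weighted_walks.simps(3)[of n x z]
      using ww_n by linarith
    finally show ?thesis .
  qed
qed

lemma tail_count_0: "(x, y) \<in> E \<Longrightarrow> tail_count 0 x y = 0"
  using edge_neq by (auto simp: tail_count_def)

lemma tail_count_1: "(x, y) \<in> E \<Longrightarrow> tail_count (Suc 0) x y = 0"
  by (auto simp: tail_count_def intro!: sum.neutral)

text \<open>Cutting off both ends of a walk that starts with the edge from \<open>x\<close> to \<open>y\<close> and ends with its reverse
  leaves a closed walk at \<open>y\<close> that neither starts towards \<open>x\<close> nor comes back from it. These are
  counted by inclusion and exclusion; reversal identifies the two middle terms.\<close>

lemma tail_count_Suc_Suc:
  assumes "(x, y) \<in> E"
  shows "tail_count (Suc (Suc n)) x y = nb_walks n y y - 2 * nb_from_edge n y x y + tail_count n y x"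
proof -
  have e: "(y, x) \<in> E" using assms edge_sym by blast
  let ?N = "nbrs y"
  have "tail_count (Suc (Suc n)) x y = (\<Sum>a\<in>?N - {x}. nb_count (Suc n) (y, a) (y, x))"
    by (simp add: tail_count_def)
  also have "\<dots> = (\<Sum>a\<in>?N - {x}. \<Sum>b\<in>?N - {x}. nb_count n (y, a) (b, y))"
    using e by (intro sum.cong refl) (subst nb_count_Suc_right, auto)
  also have "\<dots> = (\<Sum>a\<in>?N - {x}. nb_from_edge n y a y - nb_count n (y, a) (x, y))"
    using e by (intro sum.cong refl) (simp add: sum_diff1 nb_from_edge_def)
  also have "\<dots> = (nb_walks n y y - nb_from_edge n y x y)
      - ((\<Sum>a\<in>?N. nb_count n (y, a) (x, y)) - tail_count n y x)"
    using e by (simp add: sum_subtractf sum_diff1 nb_walks_def tail_count_def)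
  also have "(\<Sum>a\<in>?N. nb_count n (y, a) (x, y)) = nb_from_edge n y x y"
    unfolding nb_from_edge_def
  proof (intro sum.cong refl)
    fix a assume "a \<in> ?N"
    then show "nb_count n (y, a) (x, y) = nb_count n (y, x) (a, y)"
      using nb_count_reverse[of "(y, a)" "(x, y)" n] assms by simp
  qed
  finally show ?thesis by simp
qed

lemma num_reduced_closed_0: "num_reduced_closed E 0 x = 0"
  by (auto simp: num_reduced_closed_def is_closed_path_def)

text \<open>A closed non-backtracking walk is reduced unless its last edge is the reverse of the first.\<close>

lemma num_reduced_closed_Suc: "real (num_reduced_closed E (Suc n) x) = nb_walks n x x - tailed n x"
proof -
  let ?N = "nbrs x"
  let ?I = "SIGMA a:?N. ?N - {a}"
  let ?P = "\<lambda>(a, b). nb_paths n (x, a) (b, x)"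
  have "{es. length es = Suc n \<and> is_closed_path E es \<and> is_reduced es \<and> fst (hd es) = x} = (\<Union>i\<in>?I. ?P i)"
  proof (intro set_eqI iffI)
    fix es assume "es \<in> {es. length es = Suc n \<and> is_closed_path E es \<and> is_reduced es \<and> fst (hd es) = x}"
    then have es: "length es = Suc n" "is_path E es" "es \<noteq> []" "snd (last es) = x" "nonbacktracking es"
        "prod.swap (hd es) \<noteq> last es" "fst (hd es) = x"
      by (auto simp: is_closed_path_def is_reduced_def nonbacktracking_def)
    obtain a where a: "hd es = (x, a)" using es(7) by (cases "hd es") auto
    obtain b where b: "last es = (b, x)" using es(4) by (cases "last es") auto
    have "hd es \<in> E" "last es \<in> E" using es(2,3) by (auto simp: is_path_def)
    then have "(a, b) \<in> ?I" "es \<in> ?P (a, b)"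
      using a b es edge_sym[of b x] by (auto simp: nb_paths_def)
    then show "es \<in> (\<Union>i\<in>?I. ?P i)" by blast
  next
    fix es assume "es \<in> (\<Union>i\<in>?I. ?P i)"
    then show "es \<in> {es. length es = Suc n \<and> is_closed_path E es \<and> is_reduced es \<and> fst (hd es) = x}"
      by (auto simp: nb_paths_def is_closed_path_def is_reduced_def nonbacktracking_def)
  qed
  then have "num_reduced_closed E (Suc n) x = card (\<Union>i\<in>?I. ?P i)"
    by (simp add: num_reduced_closed_def)
  also have "\<dots> = (\<Sum>i\<in>?I. card (?P i))"
    using card_nb_paths by (intro card_UN_disjoint) (auto simp: nb_paths_def)
  finally have "real (num_reduced_closed E (Suc n) x) = (\<Sum>(a, b)\<in>?I. nb_count n (x, a) (b, x))"
    using card_nb_paths by (auto intro!: sum.cong)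
  also have "\<dots> = (\<Sum>a\<in>?N. \<Sum>b\<in>?N - {a}. nb_count n (x, a) (b, x))"
    by (subst sum.Sigma) auto
  also have "\<dots> = (\<Sum>a\<in>?N. nb_from_edge n x a x - tail_count n x a)"
    by (intro sum.cong refl) (simp add: sum_diff1 nb_from_edge_def tail_count_def)
  finally show ?thesis by (simp add: sum_subtractf nb_walks_def tailed_def)
qed

end

context averaged_measure_graph
begin

section \<open>The mean number of reduced closed paths\<close>

text \<open>For counts that start with a given edge: the recursions for them are valid on edges only, and only
  these values enter neighbour sums.\<close>

definition edge_admissible :: "('v \<Rightarrow> 'v \<Rightarrow> real) \<Rightarrow> bool" where
  "edge_admissible \<phi> \<longleftrightarrow> admissible (\<lambda>x y. of_bool ((x, y) \<in> edges X) * \<phi> x y)"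

lemma edge_admissible_kernel: "admissible K \<Longrightarrow> edge_admissible K"
  unfolding edge_admissible_def by (rule admissible_on_edges)

lemma edge_admissible_cong:
  assumes "\<And>x y. (x, y) \<in> edges X \<Longrightarrow> \<phi> x y = \<psi> x y"
  shows "edge_admissible \<phi> \<longleftrightarrow> edge_admissible \<psi>"
proof -
  have "(\<lambda>x y. of_bool ((x, y) \<in> edges X) * \<phi> x y) = (\<lambda>x y. of_bool ((x, y) \<in> edges X) * \<psi> x y)"
    using assms by (intro ext) simp
  then show ?thesis by (simp only: edge_admissible_def)
qed

lemma edge_admissible_swap: "edge_admissible \<phi> \<Longrightarrow> edge_admissible (\<lambda>x y. \<phi> y x)"
  unfolding edge_admissible_def by (subst edge_sym) (rule admissible_swap)

lemma edge_admissible_add: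
  "edge_admissible \<phi> \<Longrightarrow> edge_admissible \<psi> \<Longrightarrow> edge_admissible (\<lambda>x y. \<phi> x y + \<psi> x y)"
  unfolding edge_admissible_def distrib_left by (rule admissible_add)

lemma edge_admissible_cmult: "edge_admissible \<phi> \<Longrightarrow> edge_admissible (\<lambda>x y. c * \<phi> x y)"
  unfolding edge_admissible_def mult.left_commute[of _ c] by (rule admissible_cmult)

lemma edge_admissible_diff:
  "edge_admissible \<phi> \<Longrightarrow> edge_admissible \<psi> \<Longrightarrow> edge_admissible (\<lambda>x y. \<phi> x y - \<psi> x y)"
  unfolding edge_admissible_def right_diff_distrib by (rule admissible_diff)

lemma bounded_measurable_edge_sum:
  "edge_admissible \<phi> \<Longrightarrow> bounded_measurable (\<lambda>x. \<Sum>y\<in>nbrs x. \<phi> x y)"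
  unfolding edge_admissible_def by (drule bounded_measurable_neighbour_sum) simp

lemma mean_edge_sum_swap:
  assumes "edge_admissible \<phi>"
  shows "mean (\<lambda>x. \<Sum>y\<in>nbrs x. \<phi> x y) = mean (\<lambda>x. \<Sum>y\<in>nbrs x. \<phi> y x)"
proof -
  have "(\<Sum>y\<in>nbrs x. of_bool ((y, x) \<in> edges X) * \<phi> y x) = (\<Sum>y\<in>nbrs x. \<phi> y x)" for x
    by (rule sum.cong) (auto dest: edge_sym[THEN iffD1])
  then show ?thesis using edge_transport[OF assms[unfolded edge_admissible_def]] by simp
qed

lemma bounded_measurable_q: "bounded_measurable (\<lambda>x. degree x - 1)"
  by (intro bounded_measurable_diff bounded_measurable_degree bounded_measurable_const)

lemma admissible_weighted_walks: "admissible (weighted_walks n)"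
proof (induction n rule: induct_nat_012)
  case 0
  have "weighted_walks 0 = (\<lambda>x y. of_bool (x = y))" by (intro ext) simp
  then show ?case using admissible_identity by simp
next
  case 1
  have "weighted_walks (Suc 0) x y = (\<Sum>a\<in>nbrs x. of_bool (a = y))" for x y
    using sum_of_bool_point[of "nbrs x" y "\<lambda>_. 1"] by simp
  then have "weighted_walks (Suc 0) = (\<lambda>x y. \<Sum>a\<in>nbrs x. of_bool (a = y))"
    by (intro ext)
  then show ?case using admissible_neighbours[OF admissible_identity] by simp
next
  case (ge2 n)
  have eq: "weighted_walks (Suc (Suc n)) = (\<lambda>x y.
      (\<Sum>a\<in>nbrs x. weighted_walks (Suc n) a y) - (degree x - 1) * weighted_walks n x y)"
    by (intro ext) simp
  show ?case unfolding eq
    by (intro admissible_diff admissible_neighbours admissible_mult bounded_measurable_q)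
      (use ge2 in \<open>simp_all add: degree_act\<close>)
qed

lemma admissible_nb_walks: "admissible (nb_walks n)"
proof (cases n)
  case 0
  have "nb_walks n = weighted_walks (Suc 0)" by (intro ext) (simp add: 0 nb_walks_0)
  then show ?thesis using admissible_weighted_walks by simp
next
  case (Suc m)
  have "nb_walks n = (\<lambda>x y. weighted_walks (Suc (Suc m)) x y - weighted_walks m x y)"
    unfolding Suc by (intro ext) (rule nb_walks_Suc_eq)
  then show ?thesis using admissible_diff[OF admissible_weighted_walks admissible_weighted_walks] by (simp del: weighted_walks.simps)
qed

text \<open>The two counts have to be treated together: \<open>nb_from_edge_Suc\<close> expresses each by the other with
  the edge reversed.\<close>

lemma edge_admissible_nb_from_edge:
  "edge_admissible (\<lambda>x y. nb_from_edge n x y x) \<and> edge_admissible (\<lambda>x y. nb_from_edge n x y y)"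
proof (induction n)
  case 0
  have "edge_admissible (\<lambda>x y. nb_from_edge 0 x y x) \<longleftrightarrow> edge_admissible (\<lambda>x y. 0)"
    by (rule edge_admissible_cong) (use edge_neq in \<open>auto simp: nb_from_edge_0\<close>)
  moreover have "edge_admissible (\<lambda>x y. nb_from_edge 0 x y y) \<longleftrightarrow> edge_admissible (\<lambda>x y. 1)"
    by (rule edge_admissible_cong) (auto simp: nb_from_edge_0)
  ultimately show ?case using edge_admissible_kernel[OF admissible_const] by blast
next
  case (Suc n)
  have "edge_admissible (\<lambda>x y. nb_from_edge (Suc n) x y x)
      \<longleftrightarrow> edge_admissible (\<lambda>x y. nb_walks n y x - nb_from_edge n y x x)"
    by (rule edge_admissible_cong) (rule nb_from_edge_Suc)
  moreover have "edge_admissible (\<lambda>x y. nb_walks n y x - nb_from_edge n y x x)"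
    by (rule edge_admissible_swap[OF edge_admissible_diff[OF
          edge_admissible_kernel[OF admissible_nb_walks] Suc.IH[THEN conjunct2]]])
  moreover have "edge_admissible (\<lambda>x y. nb_from_edge (Suc n) x y y)
      \<longleftrightarrow> edge_admissible (\<lambda>x y. nb_walks n y y - nb_from_edge n y x y)"
    by (rule edge_admissible_cong) (rule nb_from_edge_Suc)
  moreover have "edge_admissible (\<lambda>x y. nb_walks n y y - nb_from_edge n y x y)"
    by (rule edge_admissible_swap[OF edge_admissible_diff[OF
          edge_admissible_kernel[OF admissible_diagonal[OF admissible_nb_walks]] Suc.IH[THEN conjunct1]]])
  ultimately show ?case by blast
qed

lemma edge_admissible_tail_step:
  assumes "edge_admissible (tail_count n)"
  shows "edge_admissible (\<lambda>x y. nb_walks n x x - 2 * nb_from_edge n x y x + tail_count n x y)"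
  by (rule edge_admissible_add[OF edge_admissible_diff[OF
        edge_admissible_kernel[OF admissible_diagonal[OF admissible_nb_walks]]
        edge_admissible_cmult[OF edge_admissible_nb_from_edge[THEN conjunct1]]] assms])

lemma edge_admissible_tail_count: "edge_admissible (tail_count n)"
proof (induction n rule: induct_nat_012)
  case 0
  have "edge_admissible (tail_count 0) \<longleftrightarrow> edge_admissible (\<lambda>x y. 0)"
    by (rule edge_admissible_cong) (rule tail_count_0)
  then show ?case using edge_admissible_kernel[OF admissible_const] by simp
next
  case 1
  have "edge_admissible (tail_count (Suc 0)) \<longleftrightarrow> edge_admissible (\<lambda>x y. 0)"
    by (rule edge_admissible_cong) (rule tail_count_1)
  then show ?case using edge_admissible_kernel[OF admissible_const] by simp
next
  case (ge2 n)
  have "edge_admissible (tail_count (Suc (Suc n)))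
      \<longleftrightarrow> edge_admissible (\<lambda>x y. nb_walks n y y - 2 * nb_from_edge n y x y + tail_count n y x)"
    by (rule edge_admissible_cong) (rule tail_count_Suc_Suc)
  then show ?case using edge_admissible_swap[OF edge_admissible_tail_step[OF ge2(1)]] by simp
qed

lemma bounded_measurable_tailed: "bounded_measurable (tailed n)"
  using bounded_measurable_edge_sum[OF edge_admissible_tail_count[of n]]
  by (simp add: tailed_def[abs_def])

text \<open>After transport the tail is counted at the vertex to which it is attached. Summing
  \<open>tail_count_Suc_Suc\<close> over the neighbours, each closed walk is counted \<open>degree x\<close> times, minus once
  for each of its two ends, plus once more if these agree.\<close>

lemma mean_tailed_Suc_Suc:
  "mean (tailed (Suc (Suc n))) = mean (tailed n) + mean (\<lambda>x. (degree x - 2) * nb_walks n x x)"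
proof -
  let ?\<psi> = "\<lambda>x y. nb_walks n x x - 2 * nb_from_edge n x y x + tail_count n x y"
  have "tailed (Suc (Suc n)) = (\<lambda>x. \<Sum>y\<in>nbrs x. ?\<psi> y x)"
    unfolding tailed_def[abs_def] by (intro ext sum.cong refl) (simp add: tail_count_Suc_Suc)
  then have "mean (tailed (Suc (Suc n))) = mean (\<lambda>x. \<Sum>y\<in>nbrs x. ?\<psi> x y)"
    using mean_edge_sum_swap[OF edge_admissible_tail_step[OF edge_admissible_tail_count[of n]]] by simp
  also have "(\<lambda>x. \<Sum>y\<in>nbrs x. ?\<psi> x y) = (\<lambda>x. tailed n x + (degree x - 2) * nb_walks n x x)"
    by (intro ext) (simp add: sum.distrib sum_subtractf sum_distrib_left[symmetric] tailed_def
        degree_def nb_walks_def[of n x x for x] algebra_simps)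
  also have "mean \<dots> = mean (tailed n) + mean (\<lambda>x. (degree x - 2) * nb_walks n x x)"
    by (intro mean_add bounded_measurable_tailed bounded_measurable_mult bounded_measurable_diff
        bounded_measurable_degree bounded_measurable_const bounded_measurable_diagonal admissible_nb_walks)
  finally show ?thesis .
qed

definition mean_closed :: "nat \<Rightarrow> real" where
  "mean_closed n = mean (\<lambda>x. real (num_reduced_closed (edges X) n x))"

lemma bounded_measurable_num_reduced_closed:
  "bounded_measurable (\<lambda>x. real (num_reduced_closed (edges X) n x))"
proof (cases n)
  case 0
  then show ?thesis by (simp add: num_reduced_closed_0 bounded_measurable_const)
next
  case (Suc m)
  show ?thesis unfolding Suc num_reduced_closed_Suc
    by (intro bounded_measurable_diff bounded_measurable_diagonal admissible_nb_walks bounded_measurable_tailed)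
qed

lemma mean_closed_Suc: "mean_closed (Suc n) = mean (\<lambda>x. nb_walks n x x) - mean (tailed n)"
  unfolding mean_closed_def num_reduced_closed_Suc
  by (intro mean_diff bounded_measurable_diagonal admissible_nb_walks bounded_measurable_tailed)

lemma nb_walks_0_diagonal: "nb_walks 0 x x = 0"
  using edge_neq by (auto simp: nb_walks_0)

lemma tailed_0: "tailed 0 = (\<lambda>x. 0)" "tailed (Suc 0) = (\<lambda>x. 0)"
  by (auto simp: fun_eq_iff tailed_def tail_count_0 tail_count_1)

lemma mean_closed_step:
  "mean_closed (Suc (Suc (Suc n))) = mean_closed (Suc n)
    + mean (\<lambda>x. nb_walks (Suc (Suc n)) x x - (degree x - 1) * nb_walks n x x)"
proof -
  note bm = bounded_measurable_diagonal[OF admissible_nb_walks]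
    bounded_measurable_mult[OF bounded_measurable_q bounded_measurable_diagonal[OF admissible_nb_walks]]
  have "mean (\<lambda>x. (degree x - 2) * nb_walks n x x) = mean (\<lambda>x. (degree x - 1) * nb_walks n x x - nb_walks n x x)"
    by (simp add: algebra_simps)
  also have "\<dots> = mean (\<lambda>x. (degree x - 1) * nb_walks n x x) - mean (\<lambda>x. nb_walks n x x)"
    by (intro mean_diff bm)
  finally show ?thesis
    unfolding mean_closed_Suc mean_tailed_Suc_Suc by (subst mean_diff) (auto intro: bm)
qed

lemma mean_closed_1: "mean_closed (Suc 0) = 0"
  unfolding mean_closed_Suc by (simp add: nb_walks_0_diagonal tailed_0)

text \<open>The function \<open>2 - degree x\<close> is the diagonal of \<open>I - Q\<close>. After the cases \<open>n = 0\<close> and \<open>n = 1\<close>,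
  \<open>mean_closed_step\<close> gives the increment from \<open>n\<close> to \<open>n + 2\<close>.\<close>

theorem mean_closed_weighted_walks:
  "mean_closed (Suc (Suc n)) = mean (\<lambda>x. weighted_walks (Suc (Suc n)) x x - (degree x - 1) * weighted_walks n x x)
     - of_bool (even n) * mean (\<lambda>x. 2 - degree x)"
proof (induction n rule: induct_nat_012)
  case 0
  \<comment> \<open>Here the kernel \<open>weighted_walks 0\<close> is the identity, so its diagonal is the constant 1.\<close>
  note bm = bounded_measurable_diff[OF bounded_measurable_diagonal[OF admissible_weighted_walks[of 2]] bounded_measurable_q]
    bounded_measurable_diff[OF bounded_measurable_const[of 2] bounded_measurable_degree]
  have "mean_closed (Suc (Suc 0)) = mean (\<lambda>x. nb_walks (Suc 0) x x)"
    unfolding mean_closed_Suc[of "Suc 0"] by (simp add: tailed_0)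
  also have "\<dots> = mean (\<lambda>x. (weighted_walks 2 x x - (degree x - 1)) - (2 - degree x))"
    by (simp add: nb_walks_Suc_eq numeral_2_eq_2 del: weighted_walks.simps(3))
  also have "\<dots> = mean (\<lambda>x. weighted_walks 2 x x - (degree x - 1)) - mean (\<lambda>x. 2 - degree x)"
    by (rule mean_diff[OF bm])
  finally show ?case by (simp add: numeral_2_eq_2)
next
  case 1
  have "mean_closed (Suc (Suc (Suc 0))) = mean (\<lambda>x. nb_walks (Suc (Suc 0)) x x)"
    using mean_closed_step[of 0] mean_closed_1 by (simp add: nb_walks_0_diagonal)
  also have "\<dots> = mean (\<lambda>x. weighted_walks (Suc (Suc (Suc 0))) x x - (degree x - 1) * weighted_walks (Suc 0) x x)"
  proof -
    have "weighted_walks (Suc 0) x x = 0" for x using edge_neq by auto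
    then show ?thesis by (simp add: nb_walks_Suc_eq del: weighted_walks.simps)
  qed
  finally show ?case by simp
next
  case (ge2 n)
  let ?W = "\<lambda>n x. weighted_walks n x x"
  note w = bounded_measurable_diagonal[OF admissible_weighted_walks]
  have "mean_closed (Suc (Suc (Suc (Suc n)))) = mean_closed (Suc (Suc n))
      + mean (\<lambda>x. nb_walks (Suc (Suc (Suc n))) x x - (degree x - 1) * nb_walks (Suc n) x x)"
    by (rule mean_closed_step)
  also have "\<dots> = mean (\<lambda>x. ?W (Suc (Suc n)) x - (degree x - 1) * ?W n x)
     + mean (\<lambda>x. (?W (Suc (Suc (Suc (Suc n)))) x - ?W (Suc (Suc n)) x)
           - (degree x - 1) * (?W (Suc (Suc n)) x - ?W n x))
     - of_bool (even n) * mean (\<lambda>x. 2 - degree x)"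
    unfolding ge2(1) nb_walks_Suc_eq by simp
  also have "mean (\<lambda>x. ?W (Suc (Suc n)) x - (degree x - 1) * ?W n x)
     + mean (\<lambda>x. (?W (Suc (Suc (Suc (Suc n)))) x - ?W (Suc (Suc n)) x)
           - (degree x - 1) * (?W (Suc (Suc n)) x - ?W n x))
     = mean (\<lambda>x. (?W (Suc (Suc n)) x - (degree x - 1) * ?W n x) + ((?W (Suc (Suc (Suc (Suc n)))) x - ?W (Suc (Suc n)) x)
           - (degree x - 1) * (?W (Suc (Suc n)) x - ?W n x)))"
    by (rule mean_add[symmetric]) (intro bounded_measurable_diff bounded_measurable_mult bounded_measurable_q w)+
  also have "(\<lambda>x. (?W (Suc (Suc n)) x - (degree x - 1) * ?W n x) + ((?W (Suc (Suc (Suc (Suc n)))) x - ?W (Suc (Suc n)) x)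
           - (degree x - 1) * (?W (Suc (Suc n)) x - ?W n x)))
      = (\<lambda>x. ?W (Suc (Suc (Suc (Suc n)))) x - (degree x - 1) * ?W (Suc (Suc n)) x)"
    by (simp add: algebra_simps del: weighted_walks.simps)
  finally show ?case by simp
qed

end

section \<open>Words in the adjacency and degree operators\<close>

text \<open>The letter \<open>True\<close> stands for the factor \<open>A\<close>, \<open>False\<close> for \<open>-Q\<close>; the weight is the power of
  \<open>z\<close> that accompanies the letter.\<close>

definition letter_weight :: "bool \<Rightarrow> nat" where
  "letter_weight b = (if b then 1 else 2)"

definition word_weight :: "bool list \<Rightarrow> nat" where
  "word_weight w = (\<Sum>b\<leftarrow>w. letter_weight b)"

lemma word_weight_simps [simp]:
  "word_weight [] = 0"
  "word_weight (b # w) = letter_weight b + word_weight w"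
  "word_weight (v @ w) = word_weight v + word_weight w"
  by (auto simp: word_weight_def)

lemma length_le_word_weight: "length w \<le> word_weight w"
  by (induction w) (auto simp: letter_weight_def)

lemma word_weight_rotate1: "word_weight (rotate1 w) = word_weight w"
  by (cases w) auto

lemma word_weight_rotate: "word_weight (rotate i w) = word_weight w"
  by (induction i) (auto simp: word_weight_rotate1)

lemma finite_words_of_length: "finite {w :: bool list. length w = n}"
  using finite_lists_length_eq[of "UNIV :: bool set" n] by simp

lemma finite_words_of_weight: "finite {w. word_weight w = n}"
proof (rule finite_subset)
  show "{w. word_weight w = n} \<subseteq> {w. set w \<subseteq> UNIV \<and> length w \<le> n}"
    using length_le_word_weight by auto
qed (rule finite_lists_length_le, simp)

lemma words_of_weight_0: "{w. word_weight w = 0} = {[]}"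
  using length_le_word_weight by (auto simp: letter_weight_def) (metis le_zero_eq length_0_conv)

lemma words_of_weight_1: "{w. word_weight w = Suc 0} = {[True]}"
proof -
  have "w = [True]" if "word_weight w = Suc 0" for w
  proof (cases w)
    case Nil then show ?thesis using that by simp
  next
    case (Cons b v)
    then have "b" "word_weight v = 0" using that by (auto simp: letter_weight_def split: if_splits)
    then show ?thesis using Cons words_of_weight_0 by auto
  qed
  then show ?thesis by (auto simp: letter_weight_def)
qed

lemma words_of_weight_Suc_Suc: "{w. word_weight w = Suc (Suc n)}
    = (#) True ` {w. word_weight w = Suc n} \<union> (#) False ` {w. word_weight w = n}"
proof (intro set_eqI iffI)
  fix w assume "w \<in> {w. word_weight w = Suc (Suc n)}"
  then show "w \<in> (#) True ` {w. word_weight w = Suc n} \<union> (#) False ` {w. word_weight w = n}"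
    by (cases w) (auto simp: letter_weight_def split: if_splits)
qed (auto simp: letter_weight_def)

lemma sum_words_of_weight_Suc_Suc:
  fixes f :: "bool list \<Rightarrow> 'a::comm_monoid_add"
  shows "(\<Sum>w | word_weight w = Suc (Suc n). f w)
    = (\<Sum>w | word_weight w = Suc n. f (True # w)) + (\<Sum>w | word_weight w = n. f (False # w))"
proof -
  have "(\<Sum>w | word_weight w = Suc (Suc n). f w)
      = sum f ((#) True ` {w. word_weight w = Suc n}) + sum f ((#) False ` {w. word_weight w = n})"
    unfolding words_of_weight_Suc_Suc
    by (rule sum.union_disjoint) (auto intro: finite_words_of_weight)
  then show ?thesis by (simp add: sum.reindex)
qed

lemma word_weight_conv_rotations:
  "word_weight w = (\<Sum>i<length w. letter_weight (hd (rotate i w)))"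
proof -
  have "word_weight w = (\<Sum>i<length w. letter_weight (w ! i))"
    unfolding word_weight_def by (simp add: sum_list_sum_nth atLeast0LessThan)
  also have "\<dots> = (\<Sum>i<length w. letter_weight (hd (rotate i w)))"
    by (intro sum.cong refl, subst hd_rotate_conv_nth) auto
  finally show ?thesis .
qed

lemma inj_rotate: "inj (rotate i)"
proof -
  have "inj (rotate1 ^^ i)" by (induction i) (simp_all only: funpow.simps inj_on_id inj_compose inj_rotate1)
  then show ?thesis by (simp add: rotate_def)
qed

text \<open>The weight of a word is the sum of the weights of the first letters of its rotations. Replace \<open>n\<close>
  by this sum and exchange summations: each rotation permutes the words of given length and weight.\<close>

lemma cyclic_word_sum:
  fixes T :: "bool list \<Rightarrow> real"
  assumes T: "\<And>w. w \<noteq> [] \<Longrightarrow> T (rotate1 w) = T w" and n: "0 < n"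
  shows "(\<Sum>w | word_weight w = n. real n / real (length w) * T w)
    = (\<Sum>w | word_weight w = n. real (letter_weight (hd w)) * T w)"
proof -
  let ?S = "{w. word_weight w = n}" and ?F = "\<lambda>w. real (letter_weight (hd w)) * T w"
  have Trot: "T (rotate i w) = T w" for i w
  proof (induction i)
    case (Suc i)
    then show ?case by (cases "w = []") (simp_all add: T)
  qed simp
  have eq: "(\<Sum>w\<in>?S. h (length w) w) = (\<Sum>k\<in>{..n}. \<Sum>w\<in>{w \<in> ?S. length w = k}. h k w)"
    for h :: "nat \<Rightarrow> bool list \<Rightarrow> real"
  proof -
    have "(\<Sum>k\<in>{..n}. \<Sum>w\<in>{w \<in> ?S. length w = k}. h (length w) w) = (\<Sum>w\<in>?S. h (length w) w)"
      by (rule sum.group) (auto simp: finite_words_of_weight intro: order_trans[OF length_le_word_weight])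
    moreover have "(\<Sum>k\<in>{..n}. \<Sum>w\<in>{w \<in> ?S. length w = k}. h (length w) w)
        = (\<Sum>k\<in>{..n}. \<Sum>w\<in>{w \<in> ?S. length w = k}. h k w)"
      by (intro sum.cong refl) auto
    ultimately show ?thesis by simp
  qed
  have fixed_length: "(\<Sum>w\<in>{w \<in> ?S. length w = k}. real n / real k * T w) = (\<Sum>w\<in>{w \<in> ?S. length w = k}. ?F w)" for k
  proof (cases "k = 0")
    case True
    have "{w \<in> ?S. length w = k} = {}" using True n by auto
    then show ?thesis by (simp only: sum.empty)
  next
    case False
    let ?R = "{w \<in> ?S. length w = k}"
    have fin: "finite ?R" using finite_words_of_weight by simp
    have bij: "bij_betw (rotate i) ?R ?R" for i
    proof -
      have "inj_on (rotate i) ?R" by (rule inj_on_subset[OF inj_rotate]) simp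
      moreover have "rotate i ` ?R \<subseteq> ?R" by (auto simp: word_weight_rotate)
      ultimately show ?thesis using endo_inj_surj[OF fin] by (auto simp: bij_betw_def)
    qed
    have "(\<Sum>w\<in>?R. real n * T w) = (\<Sum>w\<in>?R. \<Sum>i<k. ?F (rotate i w))"
    proof (intro sum.cong refl)
      fix w assume "w \<in> ?R"
      then have w: "word_weight w = n" "length w = k" by auto
      have "real (word_weight w) = (\<Sum>i<length w. real (letter_weight (hd (rotate i w))))"
        by (subst word_weight_conv_rotations) (rule of_nat_sum)
      then have "real n = (\<Sum>i<k. real (letter_weight (hd (rotate i w))))" unfolding w .
      then show "real n * T w = (\<Sum>i<k. ?F (rotate i w))"
        by (simp add: sum_distrib_right Trot)
    qed
    also have "\<dots> = (\<Sum>i<k. \<Sum>w\<in>?R. ?F (rotate i w))" by (rule sum.swap)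
    also have "\<dots> = (\<Sum>i<k. \<Sum>w\<in>?R. ?F w)"
      by (intro sum.cong refl sum.reindex_bij_betw[OF bij])
    also have "\<dots> = real k * (\<Sum>w\<in>?R. ?F w)" by simp
    finally show ?thesis using False
      by (simp add: sum_divide_distrib[symmetric] sum_distrib_left[symmetric] field_simps)
  qed
  show ?thesis
    using eq[of "\<lambda>k w. real n / real k * T w"] eq[of "\<lambda>_. ?F"] fixed_length by simp
qed

context simple_graph
begin

primrec word_kernel :: "bool list \<Rightarrow> 'v \<Rightarrow> 'v \<Rightarrow> real" where
  "word_kernel [] x y = of_bool (x = y)"
| "word_kernel (b # w) x y =
    (if b then \<Sum>a\<in>nbrs x. word_kernel w a y else (1 - degree x) * word_kernel w x y)"

text \<open>The recursion for words peels off the leftmost factor of the product; by associativity the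
  rightmost one can be peeled off as well.\<close>

lemma word_kernel_snoc:
  "word_kernel (w @ [b]) x y =
    (if b then \<Sum>a\<in>nbrs y. word_kernel w x a else (1 - degree y) * word_kernel w x y)"
proof (induction w arbitrary: x)
  case Nil
  have "(\<Sum>a\<in>nbrs x. of_bool (a = y) :: real) = of_bool ((x, y) \<in> E)"
    using sum_of_bool_point[of "nbrs x" y "\<lambda>_. 1"] by simp
  moreover have "(\<Sum>a\<in>nbrs y. of_bool (x = a) :: real) = of_bool ((y, x) \<in> E)"
    using sum_of_bool_point[of "nbrs y" x "\<lambda>_. 1"] by (simp add: eq_commute)
  ultimately show ?case using edge_sym[of x y] by simp
next
  case (Cons c w)
  consider "b = True" "c = True" | "b = True" "c = False" | "b = False" "c = True" | "b = False" "c = False"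
    by (cases b; cases c) auto
  then show ?case
  proof cases
    case 1
    have "word_kernel ((c # w) @ [b]) x y = (\<Sum>a\<in>nbrs x. \<Sum>a'\<in>nbrs y. word_kernel w a a')"
      using Cons.IH by (simp add: 1)
    also have "\<dots> = (\<Sum>a'\<in>nbrs y. word_kernel (c # w) x a')"
      using 1 by (subst sum.swap) simp
    finally show ?thesis using 1 by simp
  next
    case 2
    then show ?thesis using Cons.IH by (simp add: sum_distrib_left)
  next
    case 3
    then show ?thesis using Cons.IH by (simp add: sum_distrib_left)
  next
    case 4
    then show ?thesis using Cons.IH by simp
  qed
qed

lemma sum_word_kernel: "(\<Sum>w | word_weight w = n. word_kernel w x y) = weighted_walks n x y"
proof (induction n arbitrary: x rule: induct_nat_012)
  case 0
  then show ?case by (simp add: words_of_weight_0)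
next
  case 1
  then show ?case using sum_of_bool_point[of "nbrs x" y "\<lambda>_. 1"] by (simp add: words_of_weight_1)
next
  case (ge2 n)
  have "(\<Sum>w | word_weight w = Suc (Suc n). word_kernel w x y)
      = (\<Sum>w | word_weight w = Suc n. \<Sum>a\<in>nbrs x. word_kernel w a y)
        + (\<Sum>w | word_weight w = n. (1 - degree x) * word_kernel w x y)"
    by (simp add: sum_words_of_weight_Suc_Suc)
  also have "(\<Sum>w | word_weight w = Suc n. \<Sum>a\<in>nbrs x. word_kernel w a y)
      = (\<Sum>a\<in>nbrs x. weighted_walks (Suc n) a y)"
    by (subst sum.swap) (simp only: ge2(2))
  also have "(\<Sum>w | word_weight w = n. (1 - degree x) * word_kernel w x y)
      = (1 - degree x) * weighted_walks n x y"
    by (simp only: sum_distrib_left[symmetric] ge2(1))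
  finally show ?case by (simp add: algebra_simps)
qed

end

context averaged_measure_graph
begin

lemma admissible_word_kernel: "admissible (word_kernel w)"
proof (induction w)
  case Nil
  have "word_kernel [] = (\<lambda>x y. of_bool (x = y))" by (intro ext) simp
  then show ?case using admissible_identity by simp
next
  case (Cons b w)
  show ?case
  proof (cases b)
    case True
    have "word_kernel (b # w) = (\<lambda>x y. \<Sum>a\<in>nbrs x. word_kernel w a y)"
      by (intro ext) (simp add: True)
    then show ?thesis using admissible_neighbours[OF Cons] by simp
  next
    case False
    have eq: "word_kernel (b # w) = (\<lambda>x y. (-1) * ((degree x - 1) * word_kernel w x y))"
      by (intro ext) (simp add: False algebra_simps)
    have "admissible (\<lambda>x y. (degree x - 1) * word_kernel w x y)"
      by (rule admissible_mult[OF Cons bounded_measurable_q]) (simp add: degree_act)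
    then show ?thesis unfolding eq by (rule admissible_cmult)
  qed
qed

lemma abs_q_le: "1 \<le> max_deg \<Longrightarrow> \<bar>degree x - 1\<bar> \<le> max_deg"
  using degree_le[of x] by linarith

lemma abs_word_kernel_le:
  assumes "1 \<le> max_deg"
  shows "\<bar>word_kernel w x y\<bar> \<le> max_deg ^ length w"
proof (induction w arbitrary: x)
  case (Cons b w)
  show ?case
  proof (cases b)
    case True
    then show ?thesis using neighbour_sum_bound[of x "\<lambda>a. word_kernel w a y" "max_deg ^ length w"] Cons max_deg_nonneg
      by simp
  next
    case False
    have "\<bar>degree x - 1\<bar> * \<bar>word_kernel w x y\<bar> \<le> max_deg * max_deg ^ length w"
      by (intro mult_mono abs_q_le assms Cons max_deg_nonneg) simp
    then show ?thesis using False by (simp add: abs_mult abs_minus_commute)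
  qed
qed simp

definition word_trace :: "bool list \<Rightarrow> real" where
  "word_trace w = mean (\<lambda>x. word_kernel w x x)"

text \<open>Moving \<open>A\<close> from the left to the right of a product exchanges the two vertices of an edge, which is
  transport; moving \<open>Q\<close> does not change the diagonal.\<close>

lemma word_trace_rotate1:
  assumes "w \<noteq> []" shows "word_trace (rotate1 w) = word_trace w"
proof -
  obtain b v where w: "w = b # v" using assms by (cases w) auto
  show ?thesis
  proof (cases b)
    case True
    have "word_trace (rotate1 w) = mean (\<lambda>x. \<Sum>a\<in>nbrs x. word_kernel v x a)"
      by (simp add: word_trace_def w True word_kernel_snoc)
    also have "\<dots> = mean (\<lambda>x. \<Sum>a\<in>nbrs x. word_kernel v a x)"
      by (rule edge_transport[OF admissible_word_kernel])
    also have "\<dots> = word_trace w" by (simp add: word_trace_def w True)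
    finally show ?thesis .
  next
    case False
    then show ?thesis by (simp add: word_trace_def w word_kernel_snoc)
  qed
qed

lemma mean_sum:
  "finite I \<Longrightarrow> (\<And>i. i \<in> I \<Longrightarrow> bounded_measurable (f i)) \<Longrightarrow> mean (\<lambda>x. \<Sum>i\<in>I. f i x) = (\<Sum>i\<in>I. mean (f i))"
  by (intro Bochner_Integration.integral_sum bounded_measurable_integrable)

text \<open>The sum of the kernels of all words of weight \<open>m + 2\<close>, each multiplied by the weight of its first
  letter, is \<open>A W\<^sub>m\<^sub>+\<^sub>1 - 2 Q W\<^sub>m = W\<^sub>m\<^sub>+\<^sub>2 - Q W\<^sub>m\<close>.\<close>

theorem mean_closed_words:
  assumes "0 < n"
  shows "mean_closed n = (\<Sum>w | word_weight w = n. real n / real (length w) * word_trace w)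
    - of_bool (even n) * mean (\<lambda>x. 2 - degree x)"
proof (cases "n = 1")
  case True
  have "word_kernel [True] x x = 0" for x
    using sum_of_bool_point[of "nbrs x" x "\<lambda>_. 1"] edge_neq by auto
  then have "word_trace [True] = 0" by (simp add: word_trace_def del: word_kernel.simps)
  then show ?thesis using True mean_closed_1 by (simp add: words_of_weight_1)
next
  case False
  then obtain m where m: "n = Suc (Suc m)" using assms by (metis One_nat_def gr0_implies_Suc not_gr0)
  have bm: "bounded_measurable (\<lambda>x. c * word_kernel w x x)" for c w
    by (intro bounded_measurable_mult bounded_measurable_const bounded_measurable_diagonal admissible_word_kernel)
  have "(\<Sum>w | word_weight w = n. real n / real (length w) * word_trace w)
      = (\<Sum>w | word_weight w = n. real (letter_weight (hd w)) * word_trace w)"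
    by (rule cyclic_word_sum[where T = word_trace]) (rule word_trace_rotate1, assumption, rule assms)
  also have "\<dots> = (\<Sum>w | word_weight w = n. mean (\<lambda>x. real (letter_weight (hd w)) * word_kernel w x x))"
    by (simp add: word_trace_def)
  also have "\<dots> = mean (\<lambda>x. \<Sum>w | word_weight w = n. real (letter_weight (hd w)) * word_kernel w x x)"
    by (rule mean_sum[symmetric, OF finite_words_of_weight bm])
  also have "(\<lambda>x. \<Sum>w | word_weight w = n. real (letter_weight (hd w)) * word_kernel w x x)
      = (\<lambda>x. weighted_walks (Suc (Suc m)) x x - (degree x - 1) * weighted_walks m x x)"
  proof (intro ext)
    fix x
    have "(\<Sum>w | word_weight w = n. real (letter_weight (hd w)) * word_kernel w x x)
        = (\<Sum>w | word_weight w = Suc m. \<Sum>a\<in>nbrs x. word_kernel w a x)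
          + (\<Sum>w | word_weight w = m. 2 * ((1 - degree x) * word_kernel w x x))"
      unfolding m sum_words_of_weight_Suc_Suc by (simp add: letter_weight_def)
    also have "(\<Sum>w | word_weight w = Suc m. \<Sum>a\<in>nbrs x. word_kernel w a x)
        = (\<Sum>a\<in>nbrs x. weighted_walks (Suc m) a x)"
      by (subst sum.swap) (simp only: sum_word_kernel)
    also have "(\<Sum>w | word_weight w = m. 2 * ((1 - degree x) * word_kernel w x x))
        = 2 * ((1 - degree x) * weighted_walks m x x)"
      by (simp only: sum_distrib_left[symmetric] sum_word_kernel)
    finally show "(\<Sum>w | word_weight w = n. real (letter_weight (hd w)) * word_kernel w x x)
        = weighted_walks (Suc (Suc m)) x x - (degree x - 1) * weighted_walks m x x"
      by (simp add: algebra_simps)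
  qed
  finally show ?thesis using mean_closed_weighted_walks[of m] by (simp add: m)
qed

end

section \<open>Equivariant local operators\<close>

lemma ell2_vanishes: "f \<in> ell2 S \<Longrightarrow> x \<notin> S \<Longrightarrow> f x = 0"
  by (simp add: ell2_def)

lemma L2_set_le_l2_norm:
  assumes "f \<in> ell2 S" "finite F" "F \<subseteq> S"
  shows "L2_set (\<lambda>x. cmod (f x)) F \<le> l2_norm S f"
  unfolding L2_set_def l2_norm_def
  using assms by (intro real_sqrt_le_mono finite_sum_le_infsum) (auto simp: ell2_def)

text \<open>Square summability with a norm bound can be tested on finite sets, where Minkowski's inequality for
  \<open>L2_set\<close> applies.\<close>

lemma ell2I:
  assumes "\<And>x. x \<notin> S \<Longrightarrow> f x = 0"
    and bound: "\<And>F. finite F \<Longrightarrow> F \<subseteq> S \<Longrightarrow> L2_set (\<lambda>x. cmod (f x)) F \<le> C"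
  shows "f \<in> ell2 S" "l2_norm S f \<le> C"
proof -
  have C: "0 \<le> C" using bound[of "{}"] by simp
  have b: "(\<Sum>x\<in>F. (cmod (f x))\<^sup>2) \<le> C\<^sup>2" if "finite F" "F \<subseteq> S" for F
    using bound[OF that] unfolding L2_set_def by (rule sqrt_le_D)
  then have s: "(\<lambda>x. (cmod (f x))\<^sup>2) summable_on S"
    by (intro nonneg_bdd_above_summable_on) (auto intro!: bdd_aboveI)
  then show "f \<in> ell2 S" using assms(1) by (simp add: ell2_def)
  have "(\<Sum>\<^sub>\<infinity>x\<in>S. (cmod (f x))\<^sup>2) \<le> C\<^sup>2" by (rule infsum_le_finite_sums[OF s b])
  then show "l2_norm S f \<le> C" unfolding l2_norm_def using C by (rule real_le_lsqrt[rotated -1]) 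
qed

lemma L2_set_cmod_combination:
  "L2_set (\<lambda>x. cmod (a * f x + g x)) F \<le> cmod a * L2_set (\<lambda>x. cmod (f x)) F + L2_set (\<lambda>x. cmod (g x)) F"
proof -
  have "L2_set (\<lambda>x. cmod (a * f x + g x)) F \<le> L2_set (\<lambda>x. cmod a * cmod (f x) + cmod (g x)) F"
    by (intro L2_set_mono) (auto intro: order_trans[OF norm_triangle_ineq] simp: norm_mult)
  also have "\<dots> \<le> L2_set (\<lambda>x. cmod a * cmod (f x)) F + L2_set (\<lambda>x. cmod (g x)) F"
    by (rule L2_set_triangle_ineq)
  also have "L2_set (\<lambda>x. cmod a * cmod (f x)) F = cmod a * L2_set (\<lambda>x. cmod (f x)) F"
    by (rule L2_set_right_distrib[symmetric]) simp
  finally show ?thesis .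
qed

lemma ell2_combination:
  assumes "f \<in> ell2 S" "g \<in> ell2 S"
  shows "(\<lambda>x. a * f x + g x) \<in> ell2 S" "l2_norm S (\<lambda>x. a * f x + g x) \<le> cmod a * l2_norm S f + l2_norm S g"
proof -
  have b: "L2_set (\<lambda>x. cmod (a * f x + g x)) F \<le> cmod a * l2_norm S f + l2_norm S g"
    if "finite F" "F \<subseteq> S" for F
    using L2_set_cmod_combination[of a f g F] L2_set_le_l2_norm[OF assms(1) that]
      L2_set_le_l2_norm[OF assms(2) that] mult_left_mono[of "L2_set (\<lambda>x. cmod (f x)) F" "l2_norm S f" "cmod a"]
    by simp
  show "(\<lambda>x. a * f x + g x) \<in> ell2 S" "l2_norm S (\<lambda>x. a * f x + g x) \<le> cmod a * l2_norm S f + l2_norm S g"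
    using ell2I[OF _ b] assms by (auto simp: ell2_vanishes)
qed

lemma l2_bounded_op_diff:
  assumes A: "l2_bounded_op S A" and B: "l2_bounded_op S B"
  shows "l2_bounded_op S (\<lambda>f x. A f x + (-1) * B f x)"
    "l2_opnorm S (\<lambda>f x. A f x + (-1) * B f x) \<le> l2_opnorm S A + l2_opnorm S B"
proof -
  have nonneg: "0 \<le> l2_opnorm S T" if T: "l2_bounded_op S T" for T
  proof -
    obtain C where C: "\<And>f. f \<in> ell2 S \<Longrightarrow> l2_norm S (T f) \<le> C * l2_norm S f"
      using T unfolding l2_bounded_op_def by blast
    have "l2_norm S (T f) \<le> max C 0 * l2_norm S f" if "f \<in> ell2 S" for f
      using C[OF that] mult_right_mono[OF max.cobounded1[of C 0] l2_norm_nonneg[of S f]] by linarith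
    then have "{C. 0 \<le> C \<and> (\<forall>f \<in> ell2 S. l2_norm S (T f) \<le> C * l2_norm S f)} \<noteq> {}"
      using max.cobounded2[of 0 C] by blast
    then show ?thesis unfolding l2_opnorm_def by (rule cInf_greatest) auto
  qed
  have eq: "(\<lambda>x. A f x + (-1) * B f x) = (\<lambda>x. (-1) * B f x + A f x)" for f by auto
  have mem: "A f \<in> ell2 S" "B f \<in> ell2 S" if "f \<in> ell2 S" for f
    using A B that unfolding l2_bounded_op_def by blast+
  have b: "l2_norm S (\<lambda>x. A f x + (-1) * B f x) \<le> (l2_opnorm S A + l2_opnorm S B) * l2_norm S f"
    if "f \<in> ell2 S" for f
    using ell2_combination(2)[OF mem(2,1)[OF that], of "-1"] l2_opnorm_bound[OF A that] l2_opnorm_bound[OF B that]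
    unfolding eq by (simp add: algebra_simps)
  have linA: "A (\<lambda>x. c * f x + g x) = (\<lambda>x. c * A f x + A g x)"
    and linB: "B (\<lambda>x. c * f x + g x) = (\<lambda>x. c * B f x + B g x)" if "f \<in> ell2 S" "g \<in> ell2 S" for f g c
    using A B that unfolding l2_bounded_op_def by blast+
  show "l2_bounded_op S (\<lambda>f x. A f x + (-1) * B f x)"
    unfolding l2_bounded_op_def
  proof (intro conjI ballI allI exI[of _ "l2_opnorm S A + l2_opnorm S B"] b)
    fix f assume "f \<in> ell2 S"
    then show "(\<lambda>x. A f x + (-1) * B f x) \<in> ell2 S"
      unfolding eq by (intro ell2_combination mem)
  next
    fix f g c assume "f \<in> ell2 S" "g \<in> ell2 S"
    then show "(\<lambda>x. A (\<lambda>x. c * f x + g x) x + (-1) * B (\<lambda>x. c * f x + g x) x)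
        = (\<lambda>x. c * (A f x + (-1) * B f x) + (A g x + (-1) * B g x))"
      unfolding linA[OF \<open>f \<in> ell2 S\<close> \<open>g \<in> ell2 S\<close>] linB[OF \<open>f \<in> ell2 S\<close> \<open>g \<in> ell2 S\<close>]
      by (simp add: algebra_simps)
  qed
  show "l2_opnorm S (\<lambda>f x. A f x + (-1) * B f x) \<le> l2_opnorm S A + l2_opnorm S B"
    unfolding l2_opnorm_def[of S "\<lambda>f x. A f x + (-1) * B f x"]
  proof (rule cInf_lower)
    show "l2_opnorm S A + l2_opnorm S B \<in> {C. 0 \<le> C \<and> (\<forall>f\<in>ell2 S. l2_norm S (\<lambda>x. A f x + - 1 * B f x) \<le> C * l2_norm S f)}"
      using b nonneg[OF A] nonneg[OF B] by simp
    show "bdd_below {C. 0 \<le> C \<and> (\<forall>f\<in>ell2 S. l2_norm S (\<lambda>x. A f x + - 1 * B f x) \<le> C * l2_norm S f)}"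
      by (rule bdd_belowI[of _ 0]) simp
  qed
qed

context graph_over
begin

text \<open>One operator on all functions of the vertices, whose restrictions to the fibers form an element of
  the algebra: it is bounded by \<open>C\<close> on the square summable functions of each fiber, preserves
  measurability and commutes with the translations. Such operators are closed under the operations
  needed for the logarithm, including norm convergent series.\<close>

definition local_operator :: "real \<Rightarrow> (('v \<Rightarrow> complex) \<Rightarrow> 'v \<Rightarrow> complex) \<Rightarrow> bool" where
  "local_operator C T \<longleftrightarrow> 0 \<le> C
   \<and> (\<forall>\<omega>\<in>units X. \<forall>f\<in>ell2 (fiber X \<omega>).
        (\<forall>x. x \<notin> fiber X \<omega> \<longrightarrow> T f x = 0)
      \<and> (\<forall>F. finite F \<longrightarrow> F \<subseteq> fiber X \<omega> \<longrightarrow> L2_set (\<lambda>x. cmod (T f x)) F \<le> C * l2_norm (fiber X \<omega>) f)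
      \<and> (\<forall>h\<in>ell2 (fiber X \<omega>). \<forall>c x. T (\<lambda>x. c * f x + h x) x = c * T f x + T h x))
   \<and> (\<forall>f\<in>borel_measurable (verts X). T f \<in> borel_measurable (verts X))
   \<and> (\<forall>g\<in>space (arrows X). \<forall>f f'. (\<forall>x\<in>fiber X (gsource X g). f' x = f (act X g x))
        \<longrightarrow> (\<forall>x\<in>fiber X (gsource X g). T f' x = T f (act X g x)))"

lemma local_operatorI:
  assumes "0 \<le> C"
    "\<And>\<omega> f x. \<lbrakk>\<omega> \<in> units X; f \<in> ell2 (fiber X \<omega>); x \<notin> fiber X \<omega>\<rbrakk> \<Longrightarrow> T f x = 0"
    "\<And>\<omega> f F. \<lbrakk>\<omega> \<in> units X; f \<in> ell2 (fiber X \<omega>); finite F; F \<subseteq> fiber X \<omega>\<rbrakk>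
      \<Longrightarrow> L2_set (\<lambda>x. cmod (T f x)) F \<le> C * l2_norm (fiber X \<omega>) f"
    "\<And>\<omega> f h c x. \<lbrakk>\<omega> \<in> units X; f \<in> ell2 (fiber X \<omega>); h \<in> ell2 (fiber X \<omega>)\<rbrakk>
      \<Longrightarrow> T (\<lambda>x. c * f x + h x) x = c * T f x + T h x"
    "\<And>f. f \<in> borel_measurable (verts X) \<Longrightarrow> T f \<in> borel_measurable (verts X)"
    "\<And>g f f' x. \<lbrakk>g \<in> space (arrows X); \<forall>x\<in>fiber X (gsource X g). f' x = f (act X g x);
        x \<in> fiber X (gsource X g)\<rbrakk> \<Longrightarrow> T f' x = T f (act X g x)"
  shows "local_operator C T"
  unfolding local_operator_def using assms(1-5) by (auto intro!: assms(6))

lemma local_operatorD: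
  assumes "local_operator C T"
  shows "0 \<le> C"
    "\<And>\<omega> f x. \<lbrakk>\<omega> \<in> units X; f \<in> ell2 (fiber X \<omega>); x \<notin> fiber X \<omega>\<rbrakk> \<Longrightarrow> T f x = 0"
    "\<And>\<omega> f F. \<lbrakk>\<omega> \<in> units X; f \<in> ell2 (fiber X \<omega>); finite F; F \<subseteq> fiber X \<omega>\<rbrakk>
      \<Longrightarrow> L2_set (\<lambda>x. cmod (T f x)) F \<le> C * l2_norm (fiber X \<omega>) f"
    "\<And>\<omega> f h c x. \<lbrakk>\<omega> \<in> units X; f \<in> ell2 (fiber X \<omega>); h \<in> ell2 (fiber X \<omega>)\<rbrakk>
      \<Longrightarrow> T (\<lambda>x. c * f x + h x) x = c * T f x + T h x"
    "\<And>f. f \<in> borel_measurable (verts X) \<Longrightarrow> T f \<in> borel_measurable (verts X)"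
    "\<And>g f f' x. \<lbrakk>g \<in> space (arrows X); \<forall>x\<in>fiber X (gsource X g). f' x = f (act X g x);
        x \<in> fiber X (gsource X g)\<rbrakk> \<Longrightarrow> T f' x = T f (act X g x)"
  using assms unfolding local_operator_def by simp_all

lemma act_unit:
  assumes "\<omega> \<in> units X" "x \<in> fiber X \<omega>" shows "act X \<omega> x = x" "gsource X \<omega> = \<omega>" "\<omega> \<in> space (arrows X)"
proof -
  show \<omega>: "\<omega> \<in> space (arrows X)" using assms(1) by (simp add: units_def)
  have r: "grange X \<omega> = \<omega>" using assms(1) by (simp add: units_def)
  have "gsource X (\<omega> \<cdot> ginv X \<omega>) = gsource X (ginv X \<omega>)"
    by (rule source_mult) (simp_all add: \<omega> inv_closed)
  then show s: "gsource X \<omega> = \<omega>" using r \<omega> by (simp add: grange_def)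
  have "\<omega> \<cdot> \<omega> = \<omega>" using source_unit[OF \<omega>] s by simp
  then have "act X \<omega> (act X \<omega> x) = act X \<omega> x"
    using act_mult[OF \<omega> \<omega>] assms(2) r s by simp
  then show "act X \<omega> x = x"
    using act_eq_iff[OF \<omega>, of "act X \<omega> x" x] act_fiber[OF \<omega>, of x] assms(2) r s by simp
qed

text \<open>Equivariance under the unit arrow, which acts trivially.\<close>

lemma local_operator_local:
  assumes T: "local_operator C T" and \<omega>: "\<omega> \<in> units X" "\<And>x. x \<in> fiber X \<omega> \<Longrightarrow> f x = f' x" "x \<in> fiber X \<omega>"
  shows "T f x = T f' x"
  using local_operatorD(6)[OF T act_unit(3)[OF \<omega>(1,3)], of f f' x] act_unit[OF \<omega>(1)] \<omega> by simp

lemma local_operator_ell2: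
  assumes T: "local_operator C T" and \<omega>: "\<omega> \<in> units X" and f: "f \<in> ell2 (fiber X \<omega>)"
  shows "T f \<in> ell2 (fiber X \<omega>)" "l2_norm (fiber X \<omega>) (T f) \<le> C * l2_norm (fiber X \<omega>) f"
  using ell2I[OF local_operatorD(2)[OF T \<omega> f] local_operatorD(3)[OF T \<omega> f]] by blast+

lemma local_operator_point:
  assumes T: "local_operator C T" and \<omega>: "\<omega> \<in> units X" and f: "f \<in> ell2 (fiber X \<omega>)"
  shows "cmod (T f x) \<le> C * l2_norm (fiber X \<omega>) f"
proof (cases "x \<in> fiber X \<omega>")
  case True
  then show ?thesis using local_operatorD(3)[OF T \<omega> f, of "{x}"] by (simp add: L2_set_def)
next
  case False
  then have "T f x = 0" by (rule local_operatorD(2)[OF T \<omega> f])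
  then show ?thesis using mult_nonneg_nonneg[OF local_operatorD(1)[OF T] l2_norm_nonneg] by simp
qed

lemma local_operator_identity: "local_operator 1 (\<lambda>f. f)"
  by (rule local_operatorI) (simp_all add: ell2_vanishes L2_set_le_l2_norm)

lemma local_operator_zero: "local_operator 0 (\<lambda>f x. 0)"
  by (rule local_operatorI) (simp_all add: L2_set_def)

lemma local_operator_combination:
  assumes S: "local_operator B S" and T: "local_operator C T"
  shows "local_operator (cmod a * B + C) (\<lambda>f x. a * S f x + T f x)"
proof (rule local_operatorI)
  show "0 \<le> cmod a * B + C" using local_operatorD(1)[OF S] local_operatorD(1)[OF T] by simp
next
  fix \<omega> f x assume "\<omega> \<in> units X" "f \<in> ell2 (fiber X \<omega>)" "x \<notin> fiber X \<omega>"
  then show "a * S f x + T f x = 0"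
    by (simp add: local_operatorD(2)[OF S, of \<omega>] local_operatorD(2)[OF T, of \<omega>])
next
  fix \<omega> f F assume *: "\<omega> \<in> units X" "f \<in> ell2 (fiber X \<omega>)" "finite F" "F \<subseteq> fiber X \<omega>"
  show "L2_set (\<lambda>x. cmod (a * S f x + T f x)) F \<le> (cmod a * B + C) * l2_norm (fiber X \<omega>) f"
    using L2_set_cmod_combination[of a "S f" "T f" F] local_operatorD(3)[OF T *]
      mult_left_mono[OF local_operatorD(3)[OF S *], of "cmod a"] by (simp add: algebra_simps)
next
  fix \<omega> f h c x assume *: "\<omega> \<in> units X" "f \<in> ell2 (fiber X \<omega>)" "h \<in> ell2 (fiber X \<omega>)"
  show "a * S (\<lambda>x. c * f x + h x) x + T (\<lambda>x. c * f x + h x) x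
      = c * (a * S f x + T f x) + (a * S h x + T h x)"
    unfolding local_operatorD(4)[OF S *] local_operatorD(4)[OF T *] by (simp add: algebra_simps)
next
  fix f :: "'v \<Rightarrow> complex" assume "f \<in> borel_measurable (verts X)"
  then show "(\<lambda>x. a * S f x + T f x) \<in> borel_measurable (verts X)"
    using local_operatorD(5)[OF S] local_operatorD(5)[OF T] by measurable
next
  fix g x and f f' :: "'v \<Rightarrow> complex"
  assume *: "g \<in> space (arrows X)" "\<forall>x\<in>fiber X (gsource X g). f' x = f (act X g x)"
    "x \<in> fiber X (gsource X g)"
  show "a * S f' x + T f' x = a * S f (act X g x) + T f (act X g x)"
    using local_operatorD(6)[OF S *] local_operatorD(6)[OF T *] by simp
qed

lemma local_operator_compose:
  assumes S: "local_operator B S" and T: "local_operator C T"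
  shows "local_operator (B * C) (\<lambda>f. S (T f))"
proof (rule local_operatorI)
  show "0 \<le> B * C" using local_operatorD(1)[OF S] local_operatorD(1)[OF T] by simp
next
  fix \<omega> f x assume "\<omega> \<in> units X" "f \<in> ell2 (fiber X \<omega>)" "x \<notin> fiber X \<omega>"
  then show "S (T f) x = 0"
    using local_operatorD(2)[OF S, of \<omega>] local_operator_ell2(1)[OF T, of \<omega>] by blast
next
  fix \<omega> f F assume *: "\<omega> \<in> units X" "f \<in> ell2 (fiber X \<omega>)" "finite F" "F \<subseteq> fiber X \<omega>"
  have "L2_set (\<lambda>x. cmod (S (T f) x)) F \<le> B * l2_norm (fiber X \<omega>) (T f)"
    by (rule local_operatorD(3)[OF S *(1) local_operator_ell2(1)[OF T *(1,2)] *(3,4)])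
  also have "\<dots> \<le> B * (C * l2_norm (fiber X \<omega>) f)"
    by (rule mult_left_mono[OF local_operator_ell2(2)[OF T *(1,2)] local_operatorD(1)[OF S]])
  finally show "L2_set (\<lambda>x. cmod (S (T f) x)) F \<le> B * C * l2_norm (fiber X \<omega>) f" by simp
next
  fix \<omega> f h c x assume *: "\<omega> \<in> units X" "f \<in> ell2 (fiber X \<omega>)" "h \<in> ell2 (fiber X \<omega>)"
  have "T (\<lambda>x. c * f x + h x) = (\<lambda>x. c * T f x + T h x)"
    by (intro ext) (rule local_operatorD(4)[OF T *])
  then show "S (T (\<lambda>x. c * f x + h x)) x = c * S (T f) x + S (T h) x"
    using local_operatorD(4)[OF S *(1) local_operator_ell2(1)[OF T *(1,2)] local_operator_ell2(1)[OF T *(1,3)]]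
    by simp
next
  fix f :: "'v \<Rightarrow> complex" assume "f \<in> borel_measurable (verts X)"
  then show "S (T f) \<in> borel_measurable (verts X)"
    using local_operatorD(5)[OF S] local_operatorD(5)[OF T] by blast
next
  fix g x and f f' :: "'v \<Rightarrow> complex"
  assume *: "g \<in> space (arrows X)" "\<forall>x\<in>fiber X (gsource X g). f' x = f (act X g x)"
    "x \<in> fiber X (gsource X g)"
  show "S (T f') x = S (T f) (act X g x)"
    by (rule local_operatorD(6)[OF S *(1) _ *(3)]) (intro ballI local_operatorD(6)[OF T *(1,2)])
qed

lemma local_operator_power:
  assumes "local_operator C T" shows "local_operator (C ^ k) (T ^^ k)"
proof (induction k)
  case 0
  then show ?case using local_operator_identity by (simp add: id_def)
next
  case (Suc k)
  then show ?case using local_operator_compose[OF assms Suc] by (simp add: comp_def)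
qed

lemma local_operator_sum:
  assumes "\<And>k. local_operator (C k) (T k)"
  shows "local_operator (\<Sum>k<n::nat. C k) (\<lambda>f x. \<Sum>k<n. T k f x)"
proof (induction n)
  case (Suc n)
  show ?case using local_operator_combination[OF Suc assms[of n], of 1] by simp
qed (simp add: local_operator_zero)

lemma local_operator_suminf:
  assumes T: "\<And>k. local_operator (C k) (T k)" and C: "summable C"
  shows "local_operator (suminf C) (\<lambda>f x. \<Sum>k. T k f x)"
proof -
  have C0: "0 \<le> C k" for k by (rule local_operatorD(1)[OF T])
  have s: "summable (\<lambda>k. T k f x)" if "\<omega> \<in> units X" "f \<in> ell2 (fiber X \<omega>)" for \<omega> f x
    by (rule summable_comparison_test'[OF summable_mult2[OF C, of "l2_norm (fiber X \<omega>) f"]])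
      (rule local_operator_point[OF T that])
  show ?thesis
  proof (rule local_operatorI)
    show "0 \<le> suminf C" by (rule suminf_nonneg[OF C C0])
  next
    fix \<omega> f x assume "\<omega> \<in> units X" "f \<in> ell2 (fiber X \<omega>)" "x \<notin> fiber X \<omega>"
    then show "(\<Sum>k. T k f x) = 0" by (simp add: local_operatorD(2)[OF T, of \<omega>])
  next
    fix \<omega> f F assume *: "\<omega> \<in> units X" "f \<in> ell2 (fiber X \<omega>)" "finite F" "F \<subseteq> fiber X \<omega>"
    have "(\<lambda>n. L2_set (\<lambda>x. cmod (\<Sum>k<n. T k f x)) F) \<longlonglongrightarrow> L2_set (\<lambda>x. cmod (\<Sum>k. T k f x)) F"
      unfolding L2_set_def by (intro tendsto_intros summable_LIMSEQ s[OF *(1,2)])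
    moreover have "L2_set (\<lambda>x. cmod (\<Sum>k<n. T k f x)) F \<le> suminf C * l2_norm (fiber X \<omega>) f" for n
      using local_operatorD(3)[OF local_operator_sum[of C T, OF T] *, of n]
        mult_right_mono[OF sum_le_suminf[OF C, of "{..<n}"] l2_norm_nonneg[of "fiber X \<omega>" f]] C0
      by fastforce
    ultimately show "L2_set (\<lambda>x. cmod (\<Sum>k. T k f x)) F \<le> suminf C * l2_norm (fiber X \<omega>) f"
      by (intro LIMSEQ_le_const2) auto
  next
    fix \<omega> f h c x assume *: "\<omega> \<in> units X" "f \<in> ell2 (fiber X \<omega>)" "h \<in> ell2 (fiber X \<omega>)"
    show "(\<Sum>k. T k (\<lambda>x. c * f x + h x) x) = c * (\<Sum>k. T k f x) + (\<Sum>k. T k h x)"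
      by (simp add: local_operatorD(4)[OF T *] suminf_mult[OF s[OF *(1,2)], symmetric]
          suminf_add[OF summable_mult[OF s[OF *(1,2)]] s[OF *(1,3)]])
  next
    fix f :: "'v \<Rightarrow> complex" assume "f \<in> borel_measurable (verts X)"
    then have [measurable]: "T k f \<in> borel_measurable (verts X)" for k by (rule local_operatorD(5)[OF T])
    show "(\<lambda>x. \<Sum>k. T k f x) \<in> borel_measurable (verts X)" by measurable
  next
    fix g x and f f' :: "'v \<Rightarrow> complex"
    assume *: "g \<in> space (arrows X)" "\<forall>x\<in>fiber X (gsource X g). f' x = f (act X g x)"
      "x \<in> fiber X (gsource X g)"
    show "(\<Sum>k. T k f' x) = (\<Sum>k. T k f (act X g x))"
      by (intro suminf_cong) (rule local_operatorD(6)[OF T *])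
  qed
qed

lemma local_operator_bounded:
  assumes T: "local_operator C T" and \<omega>: "\<omega> \<in> units X"
    and A: "\<And>f. f \<in> ell2 (fiber X \<omega>) \<Longrightarrow> A f = T f"
  shows "l2_bounded_op (fiber X \<omega>) A" "l2_opnorm (fiber X \<omega>) A \<le> C"
proof -
  have n: "l2_norm (fiber X \<omega>) (A f) \<le> C * l2_norm (fiber X \<omega>) f" if "f \<in> ell2 (fiber X \<omega>)" for f
    using local_operator_ell2(2)[OF T \<omega> that] A[OF that] by simp
  show "l2_bounded_op (fiber X \<omega>) A"
    unfolding l2_bounded_op_def
  proof (intro conjI ballI allI exI[of _ C] n)
    fix f assume "f \<in> ell2 (fiber X \<omega>)"
    then show "A f \<in> ell2 (fiber X \<omega>)" using local_operator_ell2(1)[OF T \<omega>] A by simp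
  next
    fix f g c assume *: "f \<in> ell2 (fiber X \<omega>)" "g \<in> ell2 (fiber X \<omega>)"
    show "A (\<lambda>x. c * f x + g x) = (\<lambda>x. c * A f x + A g x)"
      by (simp add: A * ell2_combination local_operatorD(4)[OF T \<omega>] fun_eq_iff)
  qed
  show "l2_opnorm (fiber X \<omega>) A \<le> C"
    unfolding l2_opnorm_def
    by (rule cInf_lower) (auto simp: n local_operatorD(1)[OF T] intro!: bdd_belowI[of _ 0])
qed

end

section \<open>The trace as a mean\<close>

lemma sum_words_of_length_Suc:
  fixes f :: "bool list \<Rightarrow> 'a::comm_monoid_add"
  shows "(\<Sum>w | length w = Suc k. f w) = (\<Sum>w | length w = k. f (True # w)) + (\<Sum>w | length w = k. f (False # w))"
proof -
  have "{w. length w = Suc k} = (#) True ` {w. length w = k} \<union> (#) False ` {w. length w = k}"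
  proof (intro set_eqI iffI)
    fix w :: "bool list" assume "w \<in> {w. length w = Suc k}"
    then obtain b v where "w = b # v" "length v = k" by (auto simp: length_Suc_conv)
    then show "w \<in> (#) True ` {w. length w = k} \<union> (#) False ` {w. length w = k}" by (cases b) auto
  qed auto
  then have "(\<Sum>w | length w = Suc k. f w)
      = sum f ((#) True ` {w. length w = k}) + sum f ((#) False ` {w. length w = k})"
    by (simp only:, intro sum.union_disjoint) (auto intro: finite_words_of_length)
  then show ?thesis by (simp add: sum.reindex)
qed

lemma infsum_conv_nn_integral:
  fixes k :: "'a \<Rightarrow> real"
  assumes "(\<lambda>x. \<bar>k x\<bar>) summable_on S"
  shows "(\<Sum>\<^sub>\<infinity>x\<in>S. k x) = enn2real (\<integral>\<^sup>+x. ennreal (k x) \<partial>count_space S)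
    - enn2real (\<integral>\<^sup>+x. ennreal (- k x) \<partial>count_space S)"
proof -
  have a: "Infinite_Set_Sum.abs_summable_on k S"
    unfolding abs_summable_equivalent[symmetric] using assms by simp
  then have i: "integrable (count_space S) k" by (simp add: Infinite_Set_Sum.abs_summable_on_def)
  have "(\<Sum>\<^sub>\<infinity>x\<in>S. k x) = integral\<^sup>L (count_space S) k"
    using infsetsum_infsum[OF a] by (simp add: infsetsum_def)
  then show ?thesis using real_lebesgue_integral_def[OF i] by simp
qed

lemma summable_on_conv_nn_integral:
  fixes k :: "'a \<Rightarrow> real"
  assumes "\<And>x. 0 \<le> k x"
  shows "k summable_on S \<longleftrightarrow> (\<integral>\<^sup>+x. ennreal (k x) \<partial>count_space S) < \<infinity>"
proof
  assume "k summable_on S"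
  then have "Infinite_Set_Sum.abs_summable_on k S"
    unfolding abs_summable_equivalent[symmetric] using assms by simp
  then have "integrable (count_space S) k" by (simp add: Infinite_Set_Sum.abs_summable_on_def)
  then show "(\<integral>\<^sup>+x. ennreal (k x) \<partial>count_space S) < \<infinity>"
    using assms by (simp add: integrable_iff_bounded)
next
  assume "(\<integral>\<^sup>+x. ennreal (k x) \<partial>count_space S) < \<infinity>"
  with infsum_ennreal_count_space(1)[of S k] assms show "k summable_on S" by simp
qed

lemma borel_measurable_completion_AE:
  fixes f g :: "'a \<Rightarrow> 'b::topological_space"
  assumes f: "f \<in> borel_measurable M" and eq: "AE x in M. f x = g x"
  shows "g \<in> borel_measurable (completion M)"
proof (rule measurableI)
  fix A :: "'b set" assume A: "A \<in> sets borel"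
  have s: "f -` A \<inter> space M \<in> sets (completion M)"
    using measurable_sets[OF f A] by (rule sets_completionI_sets)
  have ae: "AE x in completion M. x \<in> f -` A \<inter> space M \<longleftrightarrow> x \<in> g -` A \<inter> space M"
    using AE_completion[OF eq] by eventually_elim simp
  show "g -` A \<inter> space (completion M) \<in> sets (completion M)"
    by (rule completion.in_sets_AE[OF _ s]) (use ae in auto)
qed auto

context measure_graph
begin

text \<open>A total version of the sum of \<open>k\<close> over a fiber that depends measurably on the unit; it agrees with
  the sum wherever that converges absolutely.\<close>

definition fiber_sum :: "('v \<Rightarrow> complex) \<Rightarrow> 'g \<Rightarrow> complex" where
  "fiber_sum k \<omega> = Complex
     (enn2real (\<integral>\<^sup>+x. ennreal (Re (k x)) \<partial>\<eta> \<omega>)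
       - enn2real (\<integral>\<^sup>+x. ennreal (- Re (k x)) \<partial>\<eta> \<omega>))
     (enn2real (\<integral>\<^sup>+x. ennreal (Im (k x)) \<partial>\<eta> \<omega>)
       - enn2real (\<integral>\<^sup>+x. ennreal (- Im (k x)) \<partial>\<eta> \<omega>))"

lemma fiber_nn_measurable:
  fixes r :: "'v \<Rightarrow> real"
  assumes "r \<in> borel_measurable (verts X)"
  shows "(\<lambda>\<omega>. \<integral>\<^sup>+x. ennreal (r x) \<partial>\<eta> \<omega>) \<in> borel_measurable (base_measure X)"
  by (rule nn_integral_vertex_measure(2)) (use assms in measurable)

lemma measurable_fiber_sum:
  assumes [measurable]: "k \<in> borel_measurable (verts X)"
  shows "fiber_sum k \<in> borel_measurable (base_measure X)"
proof -
  have [measurable]: "(\<lambda>x. Re (k x)) \<in> borel_measurable (verts X)" "(\<lambda>x. Im (k x)) \<in> borel_measurable (verts X)"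
    "(\<lambda>x. - Re (k x)) \<in> borel_measurable (verts X)" "(\<lambda>x. - Im (k x)) \<in> borel_measurable (verts X)"
    by measurable
  note [measurable] = fiber_nn_measurable[of "\<lambda>x. Re (k x)"] fiber_nn_measurable[of "\<lambda>x. - Re (k x)"]
    fiber_nn_measurable[of "\<lambda>x. Im (k x)"] fiber_nn_measurable[of "\<lambda>x. - Im (k x)"]
  show ?thesis
    unfolding borel_measurable_complex_iff fiber_sum_def by simp
qed

lemma fiber_sum_eq:
  assumes "(\<lambda>x. cmod (k x)) summable_on fiber X \<omega>"
  shows "(\<Sum>\<^sub>\<infinity>x\<in>fiber X \<omega>. k x) = fiber_sum k \<omega>"
proof -
  have s: "k summable_on fiber X \<omega>" by (rule abs_summable_summable) (use assms in simp)
  have "(\<lambda>x. \<bar>Re (k x)\<bar>) summable_on fiber X \<omega>"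
    by (rule summable_on_comparison_test[OF assms]) (auto simp: abs_Re_le_cmod)
  moreover have "(\<lambda>x. \<bar>Im (k x)\<bar>) summable_on fiber X \<omega>"
    by (rule summable_on_comparison_test[OF assms]) (auto simp: abs_Im_le_cmod)
  ultimately show ?thesis
    by (intro complex_eqI)
      (simp_all add: fiber_sum_def infsum_Re[OF s, symmetric] infsum_Im[OF s, symmetric] infsum_conv_nn_integral)
qed

lemma integral_fiber_part:
  fixes r :: "'v \<Rightarrow> real"
  assumes r: "integrable (vertex_measure X) r"
  shows "integrable (base_measure X) (\<lambda>\<omega>. enn2real (\<integral>\<^sup>+x. ennreal (r x) \<partial>\<eta> \<omega>))"
    and "(LINT \<omega>|base_measure X. enn2real (\<integral>\<^sup>+x. ennreal (r x) \<partial>\<eta> \<omega>))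
      = enn2real (\<integral>\<^sup>+x. ennreal (r x) \<partial>vertex_measure X)"
proof -
  let ?a = "\<lambda>\<omega>. \<integral>\<^sup>+x. ennreal (r x) \<partial>\<eta> \<omega>"
  have rm: "r \<in> borel_measurable (verts X)" using borel_measurable_integrable[OF r] by (simp add: borel_vertex)
  have am [measurable]: "?a \<in> borel_measurable (base_measure X)" by (rule fiber_nn_measurable[OF rm])
  have int: "(\<integral>\<^sup>+\<omega>. ?a \<omega> \<partial>base_measure X) = (\<integral>\<^sup>+x. ennreal (r x) \<partial>vertex_measure X)"
    by (rule nn_integral_vertex_measure(1)[symmetric]) (use rm in measurable)
  have "(\<integral>\<^sup>+x. ennreal (r x) \<partial>vertex_measure X) \<le> (\<integral>\<^sup>+x. ennreal (norm (r x)) \<partial>vertex_measure X)"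
    by (intro nn_integral_mono ennreal_leI) simp
  also have "\<dots> < \<infinity>" using r by (simp add: integrable_iff_bounded)
  finally have fin: "(\<integral>\<^sup>+\<omega>. ?a \<omega> \<partial>base_measure X) < \<infinity>" using int by simp
  have ae: "AE \<omega> in base_measure X. ?a \<omega> \<noteq> \<infinity>"
    by (rule nn_integral_PInf_AE[OF am]) (use fin in simp)
  have eq: "(\<integral>\<^sup>+\<omega>. ennreal (enn2real (?a \<omega>)) \<partial>base_measure X) = (\<integral>\<^sup>+\<omega>. ?a \<omega> \<partial>base_measure X)"
    by (rule nn_integral_cong_AE, use ae in eventually_elim) (simp add: top.not_eq_extremum)
  show "integrable (base_measure X) (\<lambda>\<omega>. enn2real (?a \<omega>))"
    using eq fin by (intro integrableI_nonneg) auto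
  show "(LINT \<omega>|base_measure X. enn2real (?a \<omega>)) = enn2real (\<integral>\<^sup>+x. ennreal (r x) \<partial>vertex_measure X)"
    using eq int by (subst integral_eq_nn_integral) auto
qed

lemma integral_fiber_sum:
  fixes k :: "'v \<Rightarrow> complex"
  assumes k: "integrable (vertex_measure X) k"
  shows "(LINT \<omega>|base_measure X. fiber_sum k \<omega>) = (LINT x|vertex_measure X. k x)"
    and "AE \<omega> in base_measure X. (\<Sum>\<^sub>\<infinity>x\<in>fiber X \<omega>. k x) = fiber_sum k \<omega>"
proof -
  have ri: "integrable (vertex_measure X) (\<lambda>x. Re (k x))" "integrable (vertex_measure X) (\<lambda>x. Im (k x))"
    "integrable (vertex_measure X) (\<lambda>x. - Re (k x))" "integrable (vertex_measure X) (\<lambda>x. - Im (k x))"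
    using k by auto
  have km: "k \<in> borel_measurable (verts X)" using borel_measurable_integrable[OF k] by (simp add: borel_vertex)
  note p = integral_fiber_part[OF ri(1)] integral_fiber_part[OF ri(2)]
    integral_fiber_part[OF ri(3)] integral_fiber_part[OF ri(4)]
  have re: "(LINT \<omega>|base_measure X. Re (fiber_sum k \<omega>)) = (LINT x|vertex_measure X. Re (k x))"
    unfolding real_lebesgue_integral_def[OF ri(1)] by (simp add: fiber_sum_def p)
  have im: "(LINT \<omega>|base_measure X. Im (fiber_sum k \<omega>)) = (LINT x|vertex_measure X. Im (k x))"
    unfolding real_lebesgue_integral_def[OF ri(2)] by (simp add: fiber_sum_def p)
  have i: "integrable (base_measure X) (fiber_sum k)"
  proof -
    have "integrable (base_measure X) (\<lambda>\<omega>. complex_of_real (Re (fiber_sum k \<omega>)) + \<i> * complex_of_real (Im (fiber_sum k \<omega>)))"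
      by (intro Bochner_Integration.integrable_add integrable_mult_right integrable_of_real)
        (simp_all add: fiber_sum_def p)
    then show ?thesis by (simp flip: complex_eq)
  qed
  show "(LINT \<omega>|base_measure X. fiber_sum k \<omega>) = (LINT x|vertex_measure X. k x)"
    using re im by (intro complex_eqI) (simp_all add: integral_Re[OF i] integral_Im[OF i] integral_Re[OF k] integral_Im[OF k])
  have "AE \<omega> in base_measure X. (\<integral>\<^sup>+x. ennreal (cmod (k x)) \<partial>\<eta> \<omega>) \<noteq> \<infinity>"
  proof (rule nn_integral_PInf_AE)
    show "(\<lambda>\<omega>. \<integral>\<^sup>+x. ennreal (cmod (k x)) \<partial>\<eta> \<omega>) \<in> borel_measurable (base_measure X)"
      using km by (intro fiber_nn_measurable) measurable
    have "(\<integral>\<^sup>+\<omega>. \<integral>\<^sup>+x. ennreal (cmod (k x)) \<partial>\<eta> \<omega> \<partial>base_measure X)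
        = (\<integral>\<^sup>+x. ennreal (cmod (k x)) \<partial>vertex_measure X)"
      by (rule nn_integral_vertex_measure(1)[symmetric]) (use km in measurable)
    then show "(\<integral>\<^sup>+\<omega>. \<integral>\<^sup>+x. ennreal (cmod (k x)) \<partial>\<eta> \<omega> \<partial>base_measure X) \<noteq> \<infinity>"
      using k by (auto simp: integrable_iff_bounded)
  qed
  then show "AE \<omega> in base_measure X. (\<Sum>\<^sub>\<infinity>x\<in>fiber X \<omega>. k x) = fiber_sum k \<omega>"
  proof eventually_elim
    case (elim \<omega>)
    then have "(\<lambda>x. cmod (k x)) summable_on fiber X \<omega>"
      by (subst summable_on_conv_nn_integral) (auto simp: top.not_eq_extremum)
    then show ?case by (rule fiber_sum_eq)
  qed
qed

lemma translation_ell2: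
  assumes g: "g \<in> space (arrows X)" and f: "f \<in> ell2 (fiber X (grange X g))"
  shows "translation X (ginv X g) f \<in> ell2 (fiber X (gsource X g))"
proof (rule ell2I(1))
  have t: "translation X (ginv X g) f x = (if x \<in> fiber X (gsource X g) then f (act X g x) else 0)" for x
    by (simp add: translation_def l2_restrict_def g inv_inv)
  show "x \<notin> fiber X (gsource X g) \<Longrightarrow> translation X (ginv X g) f x = 0" for x by (simp add: t)
  fix F assume F: "finite F" "F \<subseteq> fiber X (gsource X g)"
  have inj: "inj_on (act X g) F"
    by (rule inj_on_subset[OF bij_betw_imp_inj_on[OF act_bij[OF g]] F(2)])
  have "L2_set (\<lambda>x. cmod (translation X (ginv X g) f x)) F = L2_set (\<lambda>x. cmod (f (act X g x))) F"
    by (rule L2_set_cong) (use F in \<open>auto simp: t\<close>)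
  also have "\<dots> = L2_set (\<lambda>x. cmod (f x)) (act X g ` F)"
    by (simp add: L2_set_def sum.reindex[OF inj])
  also have "\<dots> \<le> l2_norm (fiber X (grange X g)) f"
    using F act_fiber[OF g] by (intro L2_set_le_l2_norm f) auto
  finally show "L2_set (\<lambda>x. cmod (translation X (ginv X g) f x)) F \<le> l2_norm (fiber X (grange X g)) f" .
qed

text \<open>The inner product is the sum of \<open>cnj (h x) * T f x\<close> over the fiber, and \<open>T f\<close> is a measurable
  function on all vertices; on each fiber it can be computed from the restriction of \<open>f\<close>.\<close>

lemma local_operator_in_vn_algebra:
  assumes T: "local_operator C T"
    and A: "\<And>\<omega> f. \<omega> \<in> units X \<Longrightarrow> f \<in> ell2 (fiber X \<omega>) \<Longrightarrow> A \<omega> f = T f"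
  shows "A \<in> vn_algebra X"
  unfolding vn_algebra_def
proof (intro CollectI conjI ballI impI)
  fix \<omega> assume \<omega>: "\<omega> \<in> units X"
  show "l2_bounded_op (fiber X \<omega>) (A \<omega>)" by (rule local_operator_bounded(1)[OF T \<omega> A[OF \<omega>]])
next
  have "AE \<omega> in base_measure X. l2_opnorm (fiber X \<omega>) (A \<omega>) \<le> C"
    by (rule AE_I2) (simp add: space_base local_operator_bounded(2)[OF T _ A])
  then show "\<exists>C. AE \<omega> in base_measure X. l2_opnorm (fiber X \<omega>) (A \<omega>) \<le> C" ..
next
  fix f h :: "'v \<Rightarrow> complex"
  assume [measurable]: "f \<in> borel_measurable (verts X)" "h \<in> borel_measurable (verts X)"
  have Tf: "T f \<in> borel_measurable (verts X)" by (rule local_operatorD(5)[OF T]) measurable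
  have "(\<lambda>x. cnj (h x)) \<in> borel_measurable (verts X)" by (simp add: borel_measurable_complex_iff)
  from borel_measurable_times[OF this Tf]
  have km: "(\<lambda>x. cnj (h x) * T f x) \<in> borel_measurable (verts X)" .
  define c where "c \<omega> \<longleftrightarrow> (\<integral>\<^sup>+x. ennreal ((cmod (f x))\<^sup>2) \<partial>\<eta> \<omega>) < \<infinity>
      \<and> (\<integral>\<^sup>+x. ennreal ((cmod (h x))\<^sup>2) \<partial>\<eta> \<omega>) < \<infinity>" for \<omega>
  let ?k = "\<lambda>x. cnj (h x) * T f x"
  have ell2_restrict: "l2_restrict (fiber X \<omega>) f' \<in> ell2 (fiber X \<omega>)
      \<longleftrightarrow> (\<integral>\<^sup>+x. ennreal ((cmod (f' x))\<^sup>2) \<partial>\<eta> \<omega>) < \<infinity>" for f' \<omega>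
  proof -
    have "l2_restrict (fiber X \<omega>) f' \<in> ell2 (fiber X \<omega>) \<longleftrightarrow> (\<lambda>x. (cmod (f' x))\<^sup>2) summable_on fiber X \<omega>"
      by (auto simp: ell2_def l2_restrict_def intro!: summable_on_cong)
    then show ?thesis by (simp add: summable_on_conv_nn_integral)
  qed
  have [measurable]: "Measurable.pred (base_measure X) c"
  proof -
    have [measurable]: "(\<lambda>x. (cmod (f x))\<^sup>2) \<in> borel_measurable (verts X)" "(\<lambda>x. (cmod (h x))\<^sup>2) \<in> borel_measurable (verts X)"
      by measurable
    note [measurable] = fiber_nn_measurable[of "\<lambda>x. (cmod (f x))\<^sup>2"] fiber_nn_measurable[of "\<lambda>x. (cmod (h x))\<^sup>2"]
    show ?thesis unfolding c_def by measurable
  qed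
  have [measurable]: "fiber_sum ?k \<in> borel_measurable (base_measure X)"
    by (rule measurable_fiber_sum[OF km])
  have "(\<lambda>\<omega>. if c \<omega> then fiber_sum ?k \<omega> else 0) \<in> borel_measurable (base_measure X)" by measurable
  then show "(\<lambda>\<omega>. let f' = l2_restrict (fiber X \<omega>) f; h' = l2_restrict (fiber X \<omega>) h in
           if f' \<in> ell2 (fiber X \<omega>) \<and> h' \<in> ell2 (fiber X \<omega>)
           then l2_inner (fiber X \<omega>) h' (A \<omega> f') else 0) \<in> borel_measurable (base_measure X)"
  proof (rule iffD1[OF measurable_cong, rotated])
    fix \<omega> assume "\<omega> \<in> space (base_measure X)"
    then have \<omega>: "\<omega> \<in> units X" by (simp add: space_base)
    let ?f = "l2_restrict (fiber X \<omega>) f" and ?h = "l2_restrict (fiber X \<omega>) h"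
    have "l2_inner (fiber X \<omega>) ?h (A \<omega> ?f) = fiber_sum ?k \<omega>" if "?f \<in> ell2 (fiber X \<omega>)" "?h \<in> ell2 (fiber X \<omega>)"
    proof -
      have Tf: "T ?f x = T f x" if "x \<in> fiber X \<omega>" for x
        by (rule local_operator_local[OF T \<omega>]) (auto simp: l2_restrict_def that)
      have hx: "?h x = h x" if "x \<in> fiber X \<omega>" for x using that by (simp add: l2_restrict_def)
      have "T ?f \<in> ell2 (fiber X \<omega>)" by (rule local_operator_ell2(1)[OF T \<omega> that(1)])
      then have s: "(\<lambda>x. (cmod (?h x))\<^sup>2 + (cmod (T ?f x))\<^sup>2) summable_on fiber X \<omega>"
        using that(2) by (intro summable_on_add) (auto simp: ell2_def)
      have "(\<lambda>x. cmod (?k x)) summable_on fiber X \<omega>"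
      proof (rule summable_on_comparison_test[OF s])
        fix x assume x: "x \<in> fiber X \<omega>"
        have "2 * cmod (h x) * cmod (T f x) \<le> (cmod (h x))\<^sup>2 + (cmod (T f x))\<^sup>2"
          by (rule sum_squares_bound)
        moreover have "0 \<le> cmod (h x) * cmod (T f x)" by simp
        ultimately have "cmod (h x) * cmod (T f x) \<le> (cmod (h x))\<^sup>2 + (cmod (T f x))\<^sup>2" by linarith
        then show "cmod (?k x) \<le> (cmod (?h x))\<^sup>2 + (cmod (T ?f x))\<^sup>2"
          using x by (simp add: Tf hx norm_mult)
      qed simp
      note fs = fiber_sum_eq[OF this]
      have "(\<Sum>\<^sub>\<infinity>x\<in>fiber X \<omega>. cnj (?h x) * T ?f x) = (\<Sum>\<^sub>\<infinity>x\<in>fiber X \<omega>. ?k x)"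
        by (intro infsum_cong) (simp add: Tf hx)
      then show ?thesis by (simp only: l2_inner_def A[OF \<omega> that(1)] fs)
    qed
    then show "(if c \<omega> then fiber_sum ?k \<omega> else 0) = (let f' = ?f; h' = ?h in
           if f' \<in> ell2 (fiber X \<omega>) \<and> h' \<in> ell2 (fiber X \<omega>)
           then l2_inner (fiber X \<omega>) h' (A \<omega> f') else 0)"
      by (simp add: c_def ell2_restrict Let_def)
  qed
next
  fix g f assume g: "g \<in> space (arrows X)" and f: "f \<in> ell2 (fiber X (grange X g))"
  let ?f = "translation X (ginv X g) f"
  have "T ?f x = T f (act X g x)" if "x \<in> fiber X (gsource X g)" for x
    by (rule local_operatorD(6)[OF T g _ that])
      (simp add: translation_def l2_restrict_def g inv_inv)
  moreover have "T f x = 0" if "x \<notin> fiber X (grange X g)" for x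
    by (rule local_operatorD(2)[OF T grange_units[OF g] f that])
  ultimately show "A (grange X g) f = translation X g (A (gsource X g) ?f)"
    unfolding A[OF grange_units[OF g] f] A[OF gsource_units[OF g] translation_ell2[OF g f]]
    by (intro ext) (simp add: translation_def[of X g] l2_restrict_def act_ginv_fiber[OF g] act_act_ginv[OF g])
qed

lemma vn_norm_local_operator_le:
  assumes T: "local_operator C T"
    and A: "\<And>\<omega> f. \<omega> \<in> units X \<Longrightarrow> f \<in> ell2 (fiber X \<omega>) \<Longrightarrow> A \<omega> f = T f"
  shows "vn_norm X A \<le> C"
  unfolding vn_norm_def
proof (rule cInf_lower)
  show "C \<in> {C. 0 \<le> C \<and> (AE \<omega> in base_measure X. l2_opnorm (fiber X \<omega>) (A \<omega>) \<le> C)}"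
    using local_operatorD(1)[OF T]
    by (auto simp: space_base local_operator_bounded(2)[OF T _ A] intro!: AE_I2)
qed (auto intro!: bdd_belowI[of _ 0])

end

context averaged_measure_graph
begin

text \<open>The trace sees the diagonal only, and this only up to null sets of units. So it equals
  the mean as soon as the diagonal is given almost everywhere by a function on the vertices.\<close>

lemma vn_trace_eq_mean:
  fixes t :: "'v \<Rightarrow> complex"
  assumes t: "t \<in> borel_measurable (verts X)" "\<And>x. x \<in> space (verts X) \<Longrightarrow> cmod (t x) \<le> B"
    and A: "AE \<omega> in base_measure X. \<forall>x\<in>fiber X \<omega>. A \<omega> (l2_delta x) x = t x"
  shows "vn_trace X u A = mean t"
proof -
  let ?w = "\<lambda>x. enn2real (u x)"
  define k where "k x = ?w x *\<^sub>R t x" for x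
  \<comment> \<open>Since \<open>u\<close> is integrable, replacing it by a real function changes it on a null set only.\<close>
  have u_fin: "AE x in vertex_measure X. u x \<noteq> \<infinity>"
    by (rule nn_integral_PInf_AE) (use u_finite in \<open>auto simp: borel_vertex\<close>)
  have weight: "weight = density (vertex_measure X) (\<lambda>x. ennreal (?w x))"
    unfolding weight_def
    by (rule density_cong, simp_all add: borel_vertex, use u_fin in eventually_elim)
      (simp add: top.not_eq_extremum)
  have tm: "t \<in> borel_measurable (vertex_measure X)" "?w \<in> borel_measurable (vertex_measure X)"
    using t(1) u_measurable by (auto simp: borel_vertex)
  have k: "integrable (vertex_measure X) k"
  proof -
    have "integrable weight t" using t by (rule integrable_weight)
    then show ?thesis unfolding weight k_def using tm by (subst (asm) integrable_density) auto
  qed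
  have mean: "mean t = (LINT x|vertex_measure X. k x)"
    unfolding weight k_def by (rule integral_density) (auto intro: tm)
  have "AE \<omega> in base_measure X. fiber_sum k \<omega> = weighted_diagonal X u A \<omega>"
    using integral_fiber_sum(2)[OF k] A
  proof eventually_elim
    case (elim \<omega>)
    have "weighted_diagonal X u A \<omega> = (\<Sum>\<^sub>\<infinity>x\<in>fiber X \<omega>. k x)"
      unfolding weighted_diagonal_def k_def scaleR_conv_of_real
      by (rule infsum_cong) (use elim(2) in \<open>simp add: l2_delta(3)\<close>)
    then show ?case using elim(1) by simp
  qed
  note eq = this
  have km: "k \<in> borel_measurable (verts X)" using borel_measurable_integrable[OF k] by (simp add: borel_vertex)
  note fm = measurable_fiber_sum[OF km]
  have "vn_trace X u A = (LINT \<omega>|completion (base_measure X). fiber_sum k \<omega>)"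
    unfolding vn_trace_def
    by (rule integral_cong_AE[OF borel_measurable_completion_AE[OF fm eq] measurable_completion[OF fm]])
      (use AE_completion[OF eq] in eventually_elim, simp)
  also have "\<dots> = (LINT \<omega>|base_measure X. fiber_sum k \<omega>)" by (rule integral_completion[OF fm])
  also have "\<dots> = mean t" unfolding mean by (rule integral_fiber_sum(1)[OF k])
  finally show ?thesis .
qed

end

section \<open>The logarithm of the determinant\<close>

text \<open>An absolutely convergent sum may be grouped by any statistic with finite level sets; the words are
  grouped by length for the determinant and by weight for the zeta function.\<close>

lemma sums_partition_finite:
  fixes f :: "'a \<Rightarrow> complex" and g :: "'a \<Rightarrow> nat"
  assumes f: "f summable_on UNIV" and fin: "\<And>n. finite {w. g w = n}"
  shows "(\<lambda>n. \<Sum>w | g w = n. f w) sums (\<Sum>\<^sub>\<infinity>w. f w)"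
proof -
  have img: "(\<lambda>w. (g w, w)) ` UNIV = (SIGMA n:UNIV. {w. g w = n})" by auto
  have "((\<lambda>p. f (snd p)) has_sum (\<Sum>\<^sub>\<infinity>w. f w)) (SIGMA n:UNIV. {w. g w = n})"
    unfolding img[symmetric] using f
    by (subst has_sum_reindex) (auto simp: inj_on_def o_def)
  then have "((\<lambda>n. \<Sum>w | g w = n. f w) has_sum (\<Sum>\<^sub>\<infinity>w. f w)) UNIV"
    by (rule has_sum_SigmaD) (simp add: has_sum_finite fin)
  then show ?thesis by (rule has_sum_imp_sums)
qed

lemma even_power_sums:
  fixes z :: complex
  assumes "cmod z < 1"
  shows "(\<lambda>n. of_bool (even (Suc n)) * z ^ Suc n / of_nat (Suc n)) sums (- ln (1 - z\<^sup>2) / 2)"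
proof -
  let ?f = "\<lambda>n. of_bool (even n) * z ^ n / of_nat n"
  have z2: "cmod (- z\<^sup>2) < 1"
    using assms power_less_one_iff[of "cmod z" 2] by (simp add: norm_power)
  \<comment> \<open>The terms with index 0 vanish, being quotients by 0.\<close>
  have "(\<lambda>n. - ((z\<^sup>2) ^ n) / of_nat n) sums ln (1 - z\<^sup>2)"
    using Ln_series'[OF z2] by simp
  from sums_mult[OF this, of "- 1 / 2"]
  have "(\<lambda>n. ?f (2 * n)) sums (- 1 / 2 * ln (1 - z\<^sup>2))"
    by (rule sums_cong[THEN iffD1, rotated]) (simp add: power_mult)
  then have "(\<lambda>n. ?f (2 * n)) sums (- ln (1 - z\<^sup>2) / 2)" by simp
  then have "?f sums (- ln (1 - z\<^sup>2) / 2)"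
    by (subst (asm) sums_mono_reindex[where f = ?f]) (auto simp: strict_mono_def elim!: evenE)
  then show ?thesis by (subst sums_Suc_iff[where f = ?f]) simp
qed

context averaged_measure_graph
begin

text \<open>The operator \<open>B = z A - z\<^sup>2 Q\<close>, which is the identity minus the operator of the theorem.\<close>

definition hop :: "complex \<Rightarrow> ('v \<Rightarrow> complex) \<Rightarrow> 'v \<Rightarrow> complex" where
  "hop z f x = z * (\<Sum>y\<in>nbrs x. f y) + (- z\<^sup>2) * (of_real (degree x - 1) * f x)"

lemma degree_sum_swap:
  fixes f :: "'v \<Rightarrow> real"
  assumes F: "finite F" and f: "\<And>x. 0 \<le> f x"
  shows "(\<Sum>x\<in>F. \<Sum>y\<in>nbrs x. f y) \<le> max_deg * (\<Sum>y\<in>(\<Union>x\<in>F. nbrs x). f y)"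
proof -
  let ?G = "\<Union>x\<in>F. nbrs x"
  have G: "finite ?G" using F by simp
  have "(\<Sum>x\<in>F. \<Sum>y\<in>nbrs x. f y) = (\<Sum>x\<in>F. \<Sum>y\<in>?G. of_bool ((x, y) \<in> edges X) * f y)"
  proof (rule sum.cong[OF refl])
    fix x assume "x \<in> F"
    then show "(\<Sum>y\<in>nbrs x. f y) = (\<Sum>y\<in>?G. of_bool ((x, y) \<in> edges X) * f y)"
      by (intro sum.mono_neutral_cong_left G) auto
  qed
  also have "\<dots> = (\<Sum>y\<in>?G. \<Sum>x\<in>F. of_bool ((x, y) \<in> edges X) * f y)" by (rule sum.swap)
  also have "\<dots> \<le> (\<Sum>y\<in>?G. max_deg * f y)"
  proof (rule sum_mono)
    fix y
    have "(\<Sum>x\<in>F. of_bool ((x, y) \<in> edges X)) = real (card {x \<in> F. (x, y) \<in> edges X})"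
      using F by (simp add: Int_def)
    also have "\<dots> \<le> degree y"
      unfolding degree_def by (intro of_nat_mono card_mono) (auto dest: edge_sym[THEN iffD1])
    also have "\<dots> \<le> max_deg" by (rule degree_le)
    finally show "(\<Sum>x\<in>F. of_bool ((x, y) \<in> edges X) * f y) \<le> max_deg * f y"
      unfolding sum_distrib_right[symmetric] by (rule mult_right_mono[OF _ f])
  qed
  finally show ?thesis by (simp add: sum_distrib_left)
qed

text \<open>By the Cauchy--Schwarz inequality at each vertex, and because each vertex is a neighbour of at most
  \<open>max_deg\<close> others.\<close>

lemma local_operator_neighbours: "local_operator max_deg (\<lambda>f x. \<Sum>y\<in>nbrs x. f y)"
proof (rule local_operatorI)
  show "0 \<le> max_deg" by (rule max_deg_nonneg)
next
  fix \<omega> f x assume *: "\<omega> \<in> units X" "f \<in> ell2 (fiber X \<omega>)" "x \<notin> fiber X \<omega>"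
  have "f y = 0" if "(x, y) \<in> edges X" for y
  proof (rule ell2_vanishes[OF *(2)])
    have "(y, x) \<in> edges X" using that edge_sym by blast
    then show "y \<notin> fiber X \<omega>" using neighbours_fiber[of y \<omega>] *(3) by auto
  qed
  then show "(\<Sum>y\<in>nbrs x. f y) = 0" by simp
next
  fix \<omega> f F assume *: "\<omega> \<in> units X" "f \<in> ell2 (fiber X \<omega>)" "finite F" "F \<subseteq> fiber X \<omega>"
  let ?G = "\<Union>x\<in>F. nbrs x"
  have G: "finite ?G" "?G \<subseteq> fiber X \<omega>" using * neighbours_fiber by auto
  have "(\<Sum>x\<in>F. (cmod (\<Sum>y\<in>nbrs x. f y))\<^sup>2) \<le> (\<Sum>x\<in>F. max_deg * (\<Sum>y\<in>nbrs x. (cmod (f y))\<^sup>2))"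
  proof (rule sum_mono)
    fix x
    have "(cmod (\<Sum>y\<in>nbrs x. f y))\<^sup>2 \<le> (\<Sum>y\<in>nbrs x. cmod (f y))\<^sup>2"
      by (intro power_mono norm_sum) simp
    also have "\<dots> \<le> (\<Sum>y\<in>nbrs x. (cmod (f y))\<^sup>2) * card (nbrs x)"
      by (rule sum_squared_le_sum_of_squares)
    also have "\<dots> \<le> (\<Sum>y\<in>nbrs x. (cmod (f y))\<^sup>2) * max_deg"
      using degree_le[of x] by (intro mult_left_mono sum_nonneg) (auto simp: degree_def)
    finally show "(cmod (\<Sum>y\<in>nbrs x. f y))\<^sup>2 \<le> max_deg * (\<Sum>y\<in>nbrs x. (cmod (f y))\<^sup>2)"
      by (simp add: mult.commute)
  qed
  also have "\<dots> = max_deg * (\<Sum>x\<in>F. \<Sum>y\<in>nbrs x. (cmod (f y))\<^sup>2)"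
    by (simp add: sum_distrib_left)
  also have "\<dots> \<le> max_deg * (max_deg * (\<Sum>y\<in>?G. (cmod (f y))\<^sup>2))"
    by (intro mult_left_mono degree_sum_swap * max_deg_nonneg) simp
  finally have "L2_set (\<lambda>x. cmod (\<Sum>y\<in>nbrs x. f y)) F \<le> sqrt (max_deg\<^sup>2 * (\<Sum>y\<in>?G. (cmod (f y))\<^sup>2))"
    unfolding L2_set_def by (intro real_sqrt_le_mono) (simp add: power2_eq_square mult.assoc)
  also have "\<dots> = max_deg * L2_set (\<lambda>y. cmod (f y)) ?G"
    using max_deg_nonneg by (simp add: L2_set_def real_sqrt_mult)
  also have "\<dots> \<le> max_deg * l2_norm (fiber X \<omega>) f"
    by (intro mult_left_mono L2_set_le_l2_norm *(2) G max_deg_nonneg)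
  finally show "L2_set (\<lambda>x. cmod (\<Sum>y\<in>nbrs x. f y)) F \<le> max_deg * l2_norm (fiber X \<omega>) f" .
next
  fix f h :: "'v \<Rightarrow> complex" and c x
  show "(\<Sum>y\<in>nbrs x. c * f y + h y) = c * (\<Sum>y\<in>nbrs x. f y) + (\<Sum>y\<in>nbrs x. h y)"
    by (simp only: sum.distrib sum_distrib_left)
next
  fix f :: "'v \<Rightarrow> complex" assume "f \<in> borel_measurable (verts X)"
  then show "(\<lambda>x. \<Sum>y\<in>nbrs x. f y) \<in> borel_measurable (verts X)" by (rule neighbour_sum_complex)
next
  fix g x and f f' :: "'v \<Rightarrow> complex"
  assume *: "g \<in> space (arrows X)" "\<forall>x\<in>fiber X (gsource X g). f' x = f (act X g x)" "x \<in> fiber X (gsource X g)"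
  show "(\<Sum>y\<in>nbrs x. f' y) = (\<Sum>y\<in>nbrs (act X g x). f y)"
    unfolding sum_neighbours_act[OF *(1,3)]
    using neighbours_fiber[OF *(3)] *(2) by (intro sum.cong) auto
qed

text \<open>At an isolated vertex the factor is \<open>-1\<close>; this is where \<open>1 \<le> max_deg\<close> enters.\<close>

lemma local_operator_q:
  assumes "1 \<le> max_deg"
  shows "local_operator max_deg (\<lambda>f x. of_real (degree x - 1) * f x)"
proof (rule local_operatorI)
  fix \<omega> f F assume *: "\<omega> \<in> units X" "f \<in> ell2 (fiber X \<omega>)" "finite F" "F \<subseteq> fiber X \<omega>"
  have "L2_set (\<lambda>x. cmod (of_real (degree x - 1) * f x)) F \<le> L2_set (\<lambda>x. max_deg * cmod (f x)) F"
    unfolding norm_mult norm_of_real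
    by (intro L2_set_mono mult_right_mono abs_q_le assms) auto
  also have "\<dots> = max_deg * L2_set (\<lambda>x. cmod (f x)) F"
    by (rule L2_set_right_distrib[symmetric, OF max_deg_nonneg])
  also have "\<dots> \<le> max_deg * l2_norm (fiber X \<omega>) f"
    by (intro mult_left_mono L2_set_le_l2_norm * max_deg_nonneg)
  finally show "L2_set (\<lambda>x. cmod (of_real (degree x - 1) * f x)) F \<le> max_deg * l2_norm (fiber X \<omega>) f" .
qed (auto simp: max_deg_nonneg ell2_vanishes degree_act algebra_simps)

definition hop_bound :: "complex \<Rightarrow> real" where
  "hop_bound z = cmod z * max_deg + (cmod z)\<^sup>2 * max_deg"

lemma hop_bound_nonneg: "0 \<le> hop_bound z"
  by (simp add: hop_bound_def max_deg_nonneg)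

lemma local_operator_hop:
  assumes "1 \<le> max_deg" shows "local_operator (hop_bound z) (hop z)"
proof -
  have "local_operator (cmod (- z\<^sup>2) * max_deg + 0) (\<lambda>f x. (- z\<^sup>2) * (of_real (degree x - 1) * f x) + 0)"
    by (rule local_operator_combination[OF local_operator_q[OF assms] local_operator_zero])
  from local_operator_combination[OF local_operator_neighbours this, of z]
  show ?thesis by (simp add: hop_bound_def hop_def[abs_def] norm_power)
qed

lemma hop_power_delta:
  "(hop z ^^ k) (l2_delta y) x = (\<Sum>w | length w = k. z ^ word_weight w * of_real (word_kernel w x y))"
proof (induction k arbitrary: x)
  case 0
  then show ?case by (simp add: l2_delta_def)
next
  case (Suc k)
  have "(hop z ^^ Suc k) (l2_delta y) x
      = z * (\<Sum>a\<in>nbrs x. \<Sum>w | length w = k. z ^ word_weight w * of_real (word_kernel w a y))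
       + (- z\<^sup>2) * (of_real (degree x - 1) * (\<Sum>w | length w = k. z ^ word_weight w * of_real (word_kernel w x y)))"
    by (simp add: hop_def Suc.IH)
  also have "(\<Sum>a\<in>nbrs x. \<Sum>w | length w = k. z ^ word_weight w * of_real (word_kernel w a y))
      = (\<Sum>w | length w = k. z ^ word_weight w * of_real (\<Sum>a\<in>nbrs x. word_kernel w a y))"
    by (subst sum.swap) (simp add: sum_distrib_left)
  also have "z * \<dots> = (\<Sum>w | length w = k. z ^ word_weight (True # w) * of_real (word_kernel (True # w) x y))"
    by (simp add: sum_distrib_left letter_weight_def mult_ac)
  also have "(- z\<^sup>2) * (of_real (degree x - 1) * (\<Sum>w | length w = k. z ^ word_weight w * of_real (word_kernel w x y)))
      = (\<Sum>w | length w = k. z ^ word_weight (False # w) * of_real (word_kernel (False # w) x y))"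
    unfolding sum_distrib_left by (intro sum.cong refl) (simp add: letter_weight_def power2_eq_square algebra_simps)
  finally show ?case by (simp add: sum_words_of_length_Suc)
qed

lemma ihara_op_apply:
  assumes "f \<in> ell2 (fiber X \<omega>)"
  shows "op_diff op_id (ihara_op X z) \<omega> f = hop z f"
proof
  fix x
  have supp: "(\<Sum>y\<in>nbrs x. f y) = 0 \<and> f x = 0" if "x \<notin> fiber X \<omega>"
  proof -
    have "f y = 0" if "(x, y) \<in> edges X" for y
    proof (rule ell2_vanishes[OF assms])
      have "(y, x) \<in> edges X" using that edge_sym by blast
      then show "y \<notin> fiber X \<omega>" using neighbours_fiber[of y \<omega>] \<open>x \<notin> fiber X \<omega>\<close> by auto
    qed
    then show ?thesis using ell2_vanishes[OF assms that] by simp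
  qed
  show "op_diff op_id (ihara_op X z) \<omega> f x = hop z f x"
    using supp
    by (cases "x \<in> fiber X \<omega>")
      (simp_all add: op_diff_def op_add_def op_scale_def op_id_def ihara_op_def Q_op_def adjacency_op_def
        degree_op_def l2_restrict_def vertex_degree_def hop_def degree_def algebra_simps)
qed

lemma op_power_apply:
  assumes D: "1 \<le> max_deg" and \<omega>: "\<omega> \<in> units X" and f: "f \<in> ell2 (fiber X \<omega>)"
  shows "op_power (op_diff op_id (ihara_op X z)) k \<omega> f = (hop z ^^ k) f"
proof (induction k)
  case 0
  then show ?case by (simp add: op_power_def)
next
  case (Suc k)
  have "(hop z ^^ k) f \<in> ell2 (fiber X \<omega>)"
    by (rule local_operator_ell2(1)[OF local_operator_power[OF local_operator_hop[OF D]] \<omega> f])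
  then show ?case using Suc ihara_op_apply by (simp add: op_power_def)
qed

text \<open>The terms of the logarithm series for \<open>I - B\<close>; \<open>k\<close> is one less than the power of \<open>B\<close>.\<close>

definition log_term :: "complex \<Rightarrow> nat \<Rightarrow> ('v \<Rightarrow> complex) \<Rightarrow> 'v \<Rightarrow> complex" where
  "log_term z k f x = (- 1 / of_nat (Suc k)) * (hop z ^^ Suc k) f x"

definition log_bound :: "complex \<Rightarrow> nat \<Rightarrow> real" where
  "log_bound z k = 1 / real (Suc k) * hop_bound z ^ Suc k"

lemma local_operator_log_term:
  assumes "1 \<le> max_deg" shows "local_operator (log_bound z k) (log_term z k)"
proof -
  have n: "cmod (- 1 / of_nat (Suc k)) = 1 / real (Suc k)"
    by (simp add: norm_divide del: of_nat_Suc)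
  have "local_operator (cmod (- 1 / of_nat (Suc k)) * hop_bound z ^ Suc k + 0)
      (\<lambda>f x. (- 1 / of_nat (Suc k)) * (hop z ^^ Suc k) f x + 0)"
    by (rule local_operator_combination[OF local_operator_power[OF local_operator_hop[OF assms]] local_operator_zero])
  then show ?thesis unfolding n log_term_def[abs_def] log_bound_def by simp
qed

lemma log_bound_le: "log_bound z k \<le> hop_bound z ^ Suc k"
proof -
  have "1 / real (Suc k) * hop_bound z ^ Suc k \<le> 1 * hop_bound z ^ Suc k"
    by (intro mult_right_mono zero_le_power hop_bound_nonneg) simp
  then show ?thesis by (simp add: log_bound_def)
qed

lemma summable_log_bound:
  assumes "hop_bound z < 1" shows "summable (log_bound z)"
proof (rule summable_comparison_test')
  have "summable (\<lambda>k. hop_bound z ^ k)" using assms hop_bound_nonneg by (intro summable_geometric) simp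
  then show "summable (\<lambda>k. hop_bound z ^ Suc k)" by (subst summable_Suc_iff)
  show "norm (log_bound z k) \<le> hop_bound z ^ Suc k" for k
    using log_bound_le[of z k] hop_bound_nonneg[of z] by (simp add: log_bound_def)
qed

lemma op_log_sum_apply:
  assumes "1 \<le> max_deg" "\<omega> \<in> units X" "f \<in> ell2 (fiber X \<omega>)"
  shows "op_log_sum (ihara_op X z) n \<omega> f = (\<lambda>x. \<Sum>k<n. log_term z k f x)"
proof
  fix x
  have "op_log_sum (ihara_op X z) n \<omega> f x = - (\<Sum>k=1..n. 1 / of_nat k * (hop z ^^ k) f x)"
    by (simp add: op_log_sum_def op_power_apply[OF assms])
  also have "(\<Sum>k=1..n. 1 / of_nat k * (hop z ^^ k) f x) = (\<Sum>k<n. 1 / of_nat (Suc k) * (hop z ^^ Suc k) f x)"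
    using sum.shift_bounds_cl_Suc_ivl[of "\<lambda>k. 1 / of_nat k * (hop z ^^ k) f x" 0] 
    by (simp add: sum.atLeast1_atMost_eq del: funpow.simps)
  finally show "op_log_sum (ihara_op X z) n \<omega> f x = (\<Sum>k<n. log_term z k f x)"
    by (simp add: log_term_def sum_negf[symmetric] del: funpow.simps of_nat_Suc)
qed

definition hop_log :: "complex \<Rightarrow> ('v \<Rightarrow> complex) \<Rightarrow> 'v \<Rightarrow> complex" where
  "hop_log z f x = (\<Sum>k. log_term z k f x)"

lemma summable_log_term:
  assumes "1 \<le> max_deg" "hop_bound z < 1" "\<omega> \<in> units X" "f \<in> ell2 (fiber X \<omega>)"
  shows "summable (\<lambda>k. log_term z k f x)"
  by (rule summable_comparison_test'[OF summable_mult2[OF summable_log_bound[OF assms(2)], of "l2_norm (fiber X \<omega>) f"]])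
    (rule local_operator_point[OF local_operator_log_term[OF assms(1)] assms(3,4)])

lemma log_remainder_apply:
  assumes "1 \<le> max_deg" "hop_bound z < 1" "\<omega> \<in> units X" "f \<in> ell2 (fiber X \<omega>)"
  shows "op_diff (\<lambda>_. hop_log z) (op_log_sum (ihara_op X z) n) \<omega> f = (\<lambda>x. \<Sum>k. log_term z (k + n) f x)"
proof
  fix x
  show "op_diff (\<lambda>_. hop_log z) (op_log_sum (ihara_op X z) n) \<omega> f x = (\<Sum>k. log_term z (k + n) f x)"
    using suminf_split_initial_segment[OF summable_log_term[OF assms], of x n]
    by (simp add: op_diff_def op_add_def op_scale_def op_log_sum_apply[OF assms(1,3,4)] hop_log_def)
qed

lemma vn_norm_nonneg:
  assumes "AE \<omega> in base_measure X. l2_opnorm (fiber X \<omega>) (A \<omega>) \<le> C" "0 \<le> C"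
  shows "0 \<le> vn_norm X A"
  unfolding vn_norm_def by (rule cInf_greatest) (use assms in auto)

text \<open>The slack \<open>\<epsilon>\<close> avoids the question whether the infimum defining the norm is attained.\<close>

lemma AE_opnorm_le_vn_norm:
  assumes "AE \<omega> in base_measure X. l2_opnorm (fiber X \<omega>) (A \<omega>) \<le> C" "0 \<le> C" "0 < \<epsilon>"
  shows "AE \<omega> in base_measure X. l2_opnorm (fiber X \<omega>) (A \<omega>) \<le> vn_norm X A + \<epsilon>"
proof -
  let ?B = "{C. 0 \<le> C \<and> (AE \<omega> in base_measure X. l2_opnorm (fiber X \<omega>) (A \<omega>) \<le> C)}"
  have ne: "?B \<noteq> {}" using assms(1,2) by auto
  have "Inf ?B < vn_norm X A + \<epsilon>" using assms(3) by (simp add: vn_norm_def)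
  from cInf_lessD[OF ne this] obtain C' where C': "C' \<in> ?B" "C' < vn_norm X A + \<epsilon>" by auto
  from C'(1) have "AE \<omega> in base_measure X. l2_opnorm (fiber X \<omega>) (A \<omega>) \<le> C'" by simp
  then show ?thesis by eventually_elim (use C'(2) in simp)
qed

context
  fixes z :: complex
  assumes max_deg_ge_1: "1 \<le> max_deg" and hop_bound_less: "hop_bound z < 1"
begin

lemma ihara_op_in_vn_algebra: "ihara_op X z \<in> vn_algebra X"
proof (rule local_operator_in_vn_algebra)
  show "local_operator (cmod (-1) * hop_bound z + 1) (\<lambda>f x. (-1) * hop z f x + f x)"
    by (rule local_operator_combination[OF local_operator_hop[OF max_deg_ge_1] local_operator_identity])
  fix \<omega> f assume "\<omega> \<in> units X" "f \<in> ell2 (fiber X \<omega>)"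
  then show "ihara_op X z \<omega> f = (\<lambda>x. (-1) * hop z f x + f x)"
    using fun_cong[OF ihara_op_apply[of f \<omega> z]] by (auto simp: op_diff_def op_add_def op_scale_def op_id_def fun_eq_iff algebra_simps)
qed

lemma vn_norm_ihara_op: "vn_norm X (op_diff op_id (ihara_op X z)) < 1"
  using vn_norm_local_operator_le[OF local_operator_hop[OF max_deg_ge_1] ihara_op_apply]
    hop_bound_less by (rule le_less_trans)

text \<open>The remainders are again local operators, bounded by the tails of a convergent series.\<close>

lemma hop_log_is_log:
  "(\<lambda>_. hop_log z) \<in> vn_algebra X
    \<and> (\<lambda>n. vn_norm X (op_diff (\<lambda>_. hop_log z) (op_log_sum (ihara_op X z) n))) \<longlonglongrightarrow> 0"
proof
  have lt: "local_operator (log_bound z k) (log_term z k)" for k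
    by (rule local_operator_log_term[OF max_deg_ge_1])
  note sb = summable_log_bound[OF hop_bound_less]
  show "(\<lambda>_. hop_log z) \<in> vn_algebra X"
    using local_operator_suminf[of "log_bound z" "log_term z", OF lt sb]
    by (rule local_operator_in_vn_algebra) (simp add: hop_log_def[abs_def])
  have rem: "local_operator (\<Sum>k. log_bound z (k + n)) (\<lambda>f x. \<Sum>k. log_term z (k + n) f x)" for n
    by (rule local_operator_suminf[of "\<lambda>k. log_bound z (k + n)" "\<lambda>k. log_term z (k + n)"])
      (simp_all add: lt sb summable_ignore_initial_segment)
  let ?A = "\<lambda>n. op_diff (\<lambda>_. hop_log z) (op_log_sum (ihara_op X z) n)"
  have app: "?A n \<omega> f = (\<lambda>x. \<Sum>k. log_term z (k + n) f x)"
    if "\<omega> \<in> units X" "f \<in> ell2 (fiber X \<omega>)" for n \<omega> f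
    by (rule log_remainder_apply[OF max_deg_ge_1 hop_bound_less that])
  have up: "vn_norm X (?A n) \<le> (\<Sum>k. log_bound z (k + n))" for n
    by (rule vn_norm_local_operator_le[OF rem app])
  have low: "0 \<le> vn_norm X (?A n)" for n
    by (rule vn_norm_nonneg[OF _ local_operatorD(1)[OF rem]], rule AE_I2)
      (rule local_operator_bounded(2)[OF rem _ app], simp_all add: space_base)
  have "(\<Sum>k. log_bound z (k + n)) = suminf (log_bound z) - (\<Sum>k<n. log_bound z k)" for n
    using suminf_split_initial_segment[OF sb, of n] by simp
  moreover have "(\<lambda>n. suminf (log_bound z) - (\<Sum>k<n. log_bound z k)) \<longlonglongrightarrow> suminf (log_bound z) - suminf (log_bound z)"
    by (intro tendsto_diff tendsto_const summable_LIMSEQ sb)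
  ultimately have "(\<lambda>n. \<Sum>k. log_bound z (k + n)) \<longlonglongrightarrow> 0" by simp
  then show "(\<lambda>n. vn_norm X (?A n)) \<longlonglongrightarrow> 0"
    by (rule tendsto_sandwich[OF always_eventually always_eventually tendsto_const, rotated -1]) (use up low in blast)+
qed

text \<open>The logarithm is an arbitrary choice among the norm limits. Norm convergence controls each diagonal
  entry on almost every fiber, so every choice has the same diagonal there as \<open>hop_log\<close>.\<close>

lemma vn_log_diagonal:
  "AE \<omega> in base_measure X. \<forall>x\<in>fiber X \<omega>. vn_log X (ihara_op X z) \<omega> (l2_delta x) x = hop_log z (l2_delta x) x"
proof -
  define L where "L = vn_log X (ihara_op X z)"
  let ?S = "op_log_sum (ihara_op X z)"
  have "L \<in> vn_algebra X \<and> (\<lambda>n. vn_norm X (op_diff L (?S n))) \<longlonglongrightarrow> 0"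
    unfolding L_def vn_log_def
    by (rule someI[of "\<lambda>L. L \<in> vn_algebra X \<and> (\<lambda>n. vn_norm X (op_diff L (?S n))) \<longlonglongrightarrow> 0"])
      (rule hop_log_is_log)
  then have L: "L \<in> vn_algebra X" and lim: "(\<lambda>n. vn_norm X (op_diff L (?S n))) \<longlonglongrightarrow> 0" by auto
  have sum: "local_operator (\<Sum>k<n. log_bound z k) (\<lambda>f x. \<Sum>k<n. log_term z k f x)" for n
    by (rule local_operator_sum) (rule local_operator_log_term[OF max_deg_ge_1])
  have S: "l2_bounded_op (fiber X \<omega>) (?S n \<omega>)" "l2_opnorm (fiber X \<omega>) (?S n \<omega>) \<le> (\<Sum>k<n. log_bound z k)"
    if "\<omega> \<in> units X" for \<omega> n
    using local_operator_bounded[OF sum that op_log_sum_apply[OF max_deg_ge_1 that]] by blast+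
  have diff: "op_diff L (?S n) \<omega> = (\<lambda>f x. L \<omega> f x + (-1) * ?S n \<omega> f x)" for n \<omega>
    by (simp add: op_diff_def op_add_def op_scale_def)
  have bd: "l2_bounded_op (fiber X \<omega>) (op_diff L (?S n) \<omega>)" if "\<omega> \<in> units X" for \<omega> n
    unfolding diff by (rule l2_bounded_op_diff(1)[OF vn_op[OF u_measurable u_finite L that] S(1)[OF that]])
  obtain C where C: "0 \<le> C" "AE \<omega> in base_measure X. l2_opnorm (fiber X \<omega>) (L \<omega>) \<le> C"
    using vn_bounded[OF u_measurable u_finite L] .
  have "AE \<omega> in base_measure X. l2_opnorm (fiber X \<omega>) (op_diff L (?S n) \<omega>)
      \<le> vn_norm X (op_diff L (?S n)) + 1 / real (Suc n)" for n
  proof (rule AE_opnorm_le_vn_norm)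
    show "AE \<omega> in base_measure X. l2_opnorm (fiber X \<omega>) (op_diff L (?S n) \<omega>) \<le> C + (\<Sum>k<n. log_bound z k)"
      using C(2) AE_space
    proof eventually_elim
      case (elim \<omega>)
      then have \<omega>: "\<omega> \<in> units X" by (simp add: space_base)
      show ?case
        using l2_bounded_op_diff(2)[OF vn_op[OF u_measurable u_finite L \<omega>] S(1)[OF \<omega>, of n]] S(2)[OF \<omega>, of n] elim(1)
        unfolding diff by linarith
    qed
    show "0 \<le> C + (\<Sum>k<n. log_bound z k)" using C(1) local_operatorD(1)[OF sum] by simp
  qed simp
  then have "AE \<omega> in base_measure X. \<forall>n. l2_opnorm (fiber X \<omega>) (op_diff L (?S n) \<omega>)
      \<le> vn_norm X (op_diff L (?S n)) + 1 / real (Suc n)"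
    by (simp only: AE_all_countable) blast
  then show ?thesis
    unfolding L_def[symmetric] using AE_space
  proof eventually_elim
    case (elim \<omega>)
    then have \<omega>: "\<omega> \<in> units X" by (simp add: space_base)
    show ?case
    proof
      fix x assume x: "x \<in> fiber X \<omega>"
      note \<delta> = l2_delta(1,2)[OF x]
      let ?d = "\<lambda>n. L \<omega> (l2_delta x) x - (\<Sum>k<n. log_term z k (l2_delta x) x)"
      have "norm (?d n) \<le> vn_norm X (op_diff L (?S n)) + 1 / real (Suc n)" for n
      proof -
        have "?d n = op_diff L (?S n) \<omega> (l2_delta x) x"
          by (simp add: diff op_log_sum_apply[OF max_deg_ge_1 \<omega> \<delta>(1)])
        moreover have "cmod (op_diff L (?S n) \<omega> (l2_delta x) x) \<le> l2_norm (fiber X \<omega>) (op_diff L (?S n) \<omega> (l2_delta x))"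
          using bd[OF \<omega>, of n] \<delta>(1) x unfolding l2_bounded_op_def by (intro l2_norm_ge_component) blast
        moreover have "\<dots> \<le> l2_opnorm (fiber X \<omega>) (op_diff L (?S n) \<omega>)"
          using l2_opnorm_bound[OF bd[OF \<omega>, of n] \<delta>(1)] \<delta>(2) by simp
        ultimately show ?thesis using elim(1)[rule_format, of n] by simp
      qed
      moreover have "(\<lambda>n. vn_norm X (op_diff L (?S n)) + 1 / real (Suc n)) \<longlonglongrightarrow> 0 + 0"
        by (intro tendsto_add lim LIMSEQ_Suc[OF lim_1_over_n])
      ultimately have "?d \<longlonglongrightarrow> 0"
        by (intro Lim_null_comparison[of ?d]) (auto intro: always_eventually)
      moreover have "?d \<longlonglongrightarrow> L \<omega> (l2_delta x) x - hop_log z (l2_delta x) x"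
        unfolding hop_log_def
        by (intro tendsto_diff tendsto_const summable_LIMSEQ summable_log_term[OF max_deg_ge_1 hop_bound_less \<omega> \<delta>(1)])
      ultimately show "L \<omega> (l2_delta x) x = hop_log z (l2_delta x) x"
        using LIMSEQ_unique by fastforce
    qed
  qed
qed

section \<open>Comparison of the two series\<close>

text \<open>The empty word does not contribute, because the quotient by its length 0 is 0.\<close>

definition word_term :: "bool list \<Rightarrow> complex" where
  "word_term w = z ^ word_weight w * of_real (word_trace w) / of_nat (length w)"

lemma integrable_word_kernel: "complex_integrable weight (\<lambda>x. complex_of_real (word_kernel w x x))"
  by (intro integrable_of_real bounded_measurable_integrable bounded_measurable_diagonal admissible_word_kernel)

lemma log_term_delta:
  "log_term z k (l2_delta x) x
    = (- 1 / of_nat (Suc k)) * (\<Sum>w | length w = Suc k. z ^ word_weight w * of_real (word_kernel w x x))"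
  unfolding log_term_def hop_power_delta by (rule refl)

lemma mean_log_term:
  "complex_integrable weight (\<lambda>x. log_term z k (l2_delta x) x)"
  "mean (\<lambda>x. log_term z k (l2_delta x) x) = - (\<Sum>w | length w = Suc k. word_term w)"
proof -
  show "complex_integrable weight (\<lambda>x. log_term z k (l2_delta x) x)"
    unfolding log_term_delta
    by (intro integrable_mult_right Bochner_Integration.integrable_sum integrable_word_kernel)
  have "mean (\<lambda>x. \<Sum>w | length w = Suc k. z ^ word_weight w * complex_of_real (word_kernel w x x))
      = (\<Sum>w | length w = Suc k. mean (\<lambda>x. z ^ word_weight w * complex_of_real (word_kernel w x x)))"
    by (intro Bochner_Integration.integral_sum integrable_mult_right integrable_word_kernel)
  also have "\<dots> = (\<Sum>w | length w = Suc k. z ^ word_weight w * of_real (word_trace w))"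
    by (simp add: word_trace_def integral_complex_of_real)
  finally show "mean (\<lambda>x. log_term z k (l2_delta x) x) = - (\<Sum>w | length w = Suc k. word_term w)"
    unfolding log_term_delta
    by (simp add: word_term_def sum_divide_distrib[symmetric] del: of_nat_Suc cong: sum.cong)
      (simp add: sum_divide_distrib del: of_nat_Suc)
qed

lemma log_term_delta_bound:
  assumes "x \<in> space (verts X)"
  shows "cmod (log_term z k (l2_delta x) x) \<le> log_bound z k"
  using local_operator_point[OF local_operator_log_term[OF max_deg_ge_1] proj_units[OF assms]
      l2_delta(1)[OF fiber_proj[OF assms]], of z k x] l2_delta(2)[OF fiber_proj[OF assms]] by simp

lemma vn_trace_vn_log: "(\<lambda>k. \<Sum>w | length w = Suc k. word_term w) sums (- vn_trace X u (vn_log X (ihara_op X z)))"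
proof -
  note sb = summable_log_bound[OF hop_bound_less]
  have s: "summable (\<lambda>k. cmod (log_term z k (l2_delta x) x))" if "x \<in> space (verts X)" for x
    by (rule summable_comparison_test'[OF sb]) (simp add: log_term_delta_bound[OF that])
  have m: "(\<lambda>x. log_term z k (l2_delta x) x) \<in> borel_measurable (verts X)" for k
    using borel_measurable_integrable[OF mean_log_term(1)[of k]] by (simp add: borel_weight)
  have tm: "(\<lambda>x. hop_log z (l2_delta x) x) \<in> borel_measurable (verts X)"
    unfolding hop_log_def using m by measurable
  have tb: "cmod (hop_log z (l2_delta x) x) \<le> suminf (log_bound z)" if "x \<in> space (verts X)" for x
    unfolding hop_log_def
    by (rule order_trans[OF summable_norm[OF s[OF that]] suminf_le[OF log_term_delta_bound[OF that] s[OF that] sb]])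
  have trace: "vn_trace X u (vn_log X (ihara_op X z)) = mean (\<lambda>x. \<Sum>k. log_term z k (l2_delta x) x)"
    using vn_trace_eq_mean[where t = "\<lambda>x. hop_log z (l2_delta x) x" and A = "vn_log X (ihara_op X z)"
        and B = "suminf (log_bound z)", OF tm tb vn_log_diagonal]
    unfolding hop_log_def .
  have "(\<lambda>k. mean (\<lambda>x. log_term z k (l2_delta x) x)) sums mean (\<lambda>x. \<Sum>k. log_term z k (l2_delta x) x)"
  proof (rule sums_integral)
    show "integrable weight (\<lambda>x. log_term z k (l2_delta x) x)" for k by (rule mean_log_term(1))
    show "AE x in weight. summable (\<lambda>k. norm (log_term z k (l2_delta x) x))"
      by (rule AE_I2) (simp add: s)
    show "summable (\<lambda>k. LINT x|weight. norm (log_term z k (l2_delta x) x))"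
    proof (rule summable_comparison_test'[OF summable_mult2[OF sb, of "measure weight (space weight)"]])
      fix k
      interpret finite_measure weight by (rule finite_measure_weight)
      have "(LINT x|weight. norm (log_term z k (l2_delta x) x)) \<le> (LINT x|weight. log_bound z k)"
        by (intro integral_mono integrable_norm mean_log_term(1)) (simp_all add: log_term_delta_bound)
      then show "norm (LINT x|weight. norm (log_term z k (l2_delta x) x)) \<le> log_bound z k * measure weight (space weight)"
        by (simp add: mult.commute)
    qed
  qed
  then have "(\<lambda>k. - (\<Sum>w | length w = Suc k. word_term w)) sums vn_trace X u (vn_log X (ihara_op X z))"
    unfolding trace mean_log_term(2) .
  from sums_minus[OF this] show ?thesis by simp
qed

lemma sum_word_bound: "(\<Sum>w | length w = k. cmod z ^ word_weight w * max_deg ^ length w) = hop_bound z ^ k"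
proof (induction k)
  case (Suc k)
  have "(\<Sum>w | length w = Suc k. cmod z ^ word_weight w * max_deg ^ length w)
      = (cmod z * max_deg) * (\<Sum>w | length w = k. cmod z ^ word_weight w * max_deg ^ length w)
       + ((cmod z)\<^sup>2 * max_deg) * (\<Sum>w | length w = k. cmod z ^ word_weight w * max_deg ^ length w)"
    unfolding sum_words_of_length_Suc sum_distrib_left
    by (intro arg_cong2[where f="(+)"] sum.cong refl) (simp_all add: letter_weight_def power2_eq_square mult_ac)
  also have "\<dots> = hop_bound z * hop_bound z ^ k"
    unfolding Suc hop_bound_def by (rule distrib_right[symmetric])
  finally show ?case by simp
qed simp

lemma word_term_bound:
  "cmod (word_term w) \<le> measure weight (space weight) * (cmod z ^ word_weight w * max_deg ^ length w)"
proof -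
  interpret finite_measure weight by (rule finite_measure_weight)
  let ?E = "measure weight (space weight)"
  have i: "integrable weight (\<lambda>x. word_kernel w x x)"
    by (intro bounded_measurable_integrable bounded_measurable_diagonal admissible_word_kernel)
  have "\<bar>word_trace w\<bar> \<le> (LINT x|weight. \<bar>word_kernel w x x\<bar>)"
    unfolding word_trace_def using integral_norm_bound[of weight "\<lambda>x. word_kernel w x x"] by simp
  also have "\<dots> \<le> (LINT x|weight. max_deg ^ length w)"
    by (intro integral_mono integrable_abs i) (simp_all add: abs_word_kernel_le[OF max_deg_ge_1])
  finally have T: "\<bar>word_trace w\<bar> \<le> ?E * max_deg ^ length w" by simp
  have "cmod (word_term w) \<le> cmod z ^ word_weight w * \<bar>word_trace w\<bar>"
  proof (cases "w = []")
    case False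
    then have "1 \<le> real (length w)" by (cases w) auto
    then have "cmod z ^ word_weight w * \<bar>word_trace w\<bar> / real (length w) \<le> cmod z ^ word_weight w * \<bar>word_trace w\<bar> / 1"
      by (intro divide_left_mono) auto
    then show ?thesis by (simp add: word_term_def norm_mult norm_divide norm_power)
  qed (simp add: word_term_def)
  also have "\<dots> \<le> cmod z ^ word_weight w * (?E * max_deg ^ length w)"
    by (intro mult_left_mono T) simp
  finally show ?thesis by (simp add: mult_ac)
qed

lemma word_term_summable: "word_term summable_on UNIV"
proof (rule abs_summable_summable, rule nonneg_bdd_above_summable_on)
  let ?E = "measure weight (space weight)"
  let ?b = "\<lambda>w. cmod z ^ word_weight w * max_deg ^ length w"
  have b0: "0 \<le> ?b w" for w using max_deg_nonneg by simp
  have sg: "summable (\<lambda>k. hop_bound z ^ k)" using hop_bound_less hop_bound_nonneg by (intro summable_geometric) simp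
  have "(\<Sum>w\<in>F. cmod (word_term w)) \<le> ?E * (\<Sum>k. hop_bound z ^ k)" if finF: "finite F" for F
  proof -
    obtain N where N: "\<And>w. w \<in> F \<Longrightarrow> length w < N"
      using finite_nat_set_iff_bounded[THEN iffD1, OF finite_imageI[OF finF, of length]] by blast
    have "(\<Sum>w\<in>F. cmod (word_term w)) \<le> (\<Sum>w\<in>F. ?E * ?b w)"
      by (rule sum_mono) (rule word_term_bound)
    also have "\<dots> = ?E * (\<Sum>w\<in>F. ?b w)" by (rule sum_distrib_left[symmetric])
    also have "(\<Sum>w\<in>F. ?b w) = (\<Sum>k<N. \<Sum>w\<in>{w \<in> F. length w = k}. ?b w)"
      by (rule sum.group[symmetric]) (use finF N in auto)
    also have "\<dots> \<le> (\<Sum>k<N. \<Sum>w | length w = k. ?b w)"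
      by (intro sum_mono sum_mono2) (auto simp: finite_words_of_length max_deg_nonneg)
    also have "\<dots> = (\<Sum>k<N. hop_bound z ^ k)" by (simp only: sum_word_bound)
    also have "\<dots> \<le> (\<Sum>k. hop_bound z ^ k)"
      by (rule sum_le_suminf[OF sg]) (auto simp: hop_bound_nonneg)
    finally show ?thesis by (simp add: mult_left_mono)
  qed
  then show "bdd_above (sum (\<lambda>w. cmod (word_term w)) ` {F. F \<subseteq> UNIV \<and> finite F})"
    by (intro bdd_aboveI[of _ "?E * (\<Sum>k. hop_bound z ^ k)"]) auto
qed simp

lemma word_term_Nil: "word_term [] = 0" by (simp add: word_term_def)

text \<open>Grouping the words by length recovers the powers of \<open>B\<close> in the logarithm.\<close>

lemma infsum_word_term: "(\<Sum>\<^sub>\<infinity>w. word_term w) = - vn_trace X u (vn_log X (ihara_op X z))"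
proof -
  have "{w :: bool list. length w = 0} = {[]}" by auto
  then have "(\<Sum>w | length w = 0. word_term w) = 0" by (simp only: sum.insert[of "{}"] word_term_Nil) (simp add: word_term_Nil)
  then have "(\<lambda>k. \<Sum>w | length w = Suc k. word_term w) sums (\<Sum>\<^sub>\<infinity>w. word_term w)"
    using sums_partition_finite[OF word_term_summable finite_words_of_length]
    by (subst sums_Suc_iff[where f = "\<lambda>k. \<Sum>w | length w = k. word_term w"]) simp
  then show ?thesis using vn_trace_vn_log sums_unique2 by blast
qed

lemma euler_char_eq: "euler_char X u = of_real (mean (\<lambda>x. 2 - degree x)) / 2"
proof -
  have bm: "bounded_measurable (\<lambda>x. 2 - degree x)"
    by (intro bounded_measurable_diff bounded_measurable_const bounded_measurable_degree)
  then obtain B where B: "\<And>x. \<bar>2 - degree x\<bar> \<le> B" unfolding bounded_measurable_def by blast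
  have "vn_trace X u (op_diff op_id (Q_op X)) = mean (\<lambda>x. complex_of_real (2 - degree x))"
  proof (rule vn_trace_eq_mean)
    show "(\<lambda>x. complex_of_real (2 - degree x)) \<in> borel_measurable (verts X)"
      using bm unfolding bounded_measurable_def by (auto intro!: borel_measurable_of_real)
    show "cmod (complex_of_real (2 - degree x)) \<le> B" for x using B unfolding norm_of_real .
    show "AE \<omega> in base_measure X. \<forall>x\<in>fiber X \<omega>.
        op_diff op_id (Q_op X) \<omega> (l2_delta x) x = complex_of_real (2 - degree x)"
      by (rule AE_I2) (simp add: op_diff_def op_add_def op_scale_def op_id_def Q_op_def degree_op_def
          l2_restrict_def l2_delta_def vertex_degree_def degree_def)
  qed
  then show ?thesis unfolding euler_char_def integral_complex_of_real by simp
qed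

lemma mean_num_reduced_closed_eq: "mean_num_reduced_closed X u j = ennreal (mean_closed j)"
proof -
  have bm: "bounded_measurable (\<lambda>x. real (num_reduced_closed (edges X) j x))"
    by (rule bounded_measurable_num_reduced_closed)
  then have m: "(\<lambda>x. ennreal (real (num_reduced_closed (edges X) j x))) \<in> borel_measurable (verts X)"
    unfolding bounded_measurable_def by (intro measurable_compose[OF _ measurable_ennreal]) blast
  have "mean_num_reduced_closed X u j = (\<integral>\<^sup>+x. ennreal (real (num_reduced_closed (edges X) j x)) \<partial>weight)"
    unfolding mean_num_reduced_closed_def nn_integral_weight[OF m]
    by (simp add: ennreal_of_nat_eq_real_of_nat mult.commute)
  also have "\<dots> = ennreal (mean_closed j)"
    unfolding mean_closed_def
    by (rule nn_integral_eq_integral[OF bounded_measurable_integrable[OF bm]]) simp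
  finally show ?thesis .
qed

lemma mean_closed_nonneg: "0 \<le> mean_closed j"
  unfolding mean_closed_def by (rule Bochner_Integration.integral_nonneg) simp

lemma cmod_z_less_1: "cmod z < 1"
proof -
  have "cmod z * 1 \<le> cmod z * max_deg" by (intro mult_left_mono max_deg_ge_1) simp
  moreover have "0 \<le> (cmod z)\<^sup>2 * max_deg" using max_deg_nonneg by simp
  ultimately show ?thesis using hop_bound_less unfolding hop_bound_def by linarith
qed

text \<open>Grouping the words by weight recovers the coefficients of the zeta function, up to the terms of even
  degree, which form the logarithm of \<open>1 - z\<^sup>2\<close>.\<close>

lemma zeta_term_sums:
  "(\<lambda>j. zeta_term X u z (Suc j)) sums
     (- vn_trace X u (vn_log X (ihara_op X z)) + euler_char X u * ln (1 - z\<^sup>2))"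
proof -
  let ?\<kappa> = "complex_of_real (mean (\<lambda>x. 2 - degree x))"
  have eq: "zeta_term X u z (Suc j) = (\<Sum>w | word_weight w = Suc j. word_term w)
      - ?\<kappa> * (of_bool (even (Suc j)) * z ^ Suc j / of_nat (Suc j))" for j
  proof -
    let ?n = "Suc j"
    have "zeta_term X u z ?n = of_real (mean_closed ?n) / of_nat ?n * z ^ ?n"
      by (simp add: zeta_term_def mean_num_reduced_closed_eq mean_closed_nonneg)
    also have "of_real (mean_closed ?n) =
        (\<Sum>w | word_weight w = ?n. of_nat ?n / of_nat (length w) * complex_of_real (word_trace w)) - of_bool (even ?n) * ?\<kappa>"
      unfolding mean_closed_words[of ?n, OF zero_less_Suc] by (simp del: of_nat_Suc even_Suc)
    also have "\<dots> / of_nat ?n * z ^ ?n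
        = (\<Sum>w | word_weight w = ?n. of_nat ?n / of_nat (length w) * complex_of_real (word_trace w)) / of_nat ?n * z ^ ?n
         - ?\<kappa> * (of_bool (even ?n) * z ^ ?n / of_nat ?n)"
      by (simp add: diff_divide_distrib left_diff_distrib del: of_nat_Suc even_Suc)
    also have "(\<Sum>w | word_weight w = ?n. of_nat ?n / of_nat (length w) * complex_of_real (word_trace w)) / of_nat ?n * z ^ ?n
        = (\<Sum>w | word_weight w = ?n. word_term w)"
      unfolding sum_divide_distrib sum_distrib_right
      by (intro sum.cong refl) (simp add: word_term_def del: of_nat_Suc)
    finally show ?thesis .
  qed
  have "(\<Sum>w | word_weight w = 0. word_term w) = 0" by (simp add: words_of_weight_0 word_term_Nil)
  then have "(\<lambda>j. \<Sum>w | word_weight w = Suc j. word_term w) sums (\<Sum>\<^sub>\<infinity>w. word_term w)"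
    using sums_partition_finite[OF word_term_summable finite_words_of_weight]
    by (subst sums_Suc_iff[where f = "\<lambda>k. \<Sum>w | word_weight w = k. word_term w"]) simp
  from sums_diff[OF this sums_mult[OF even_power_sums[OF cmod_z_less_1], of ?\<kappa>]]
  have "(\<lambda>j. zeta_term X u z (Suc j)) sums ((\<Sum>\<^sub>\<infinity>w. word_term w) - ?\<kappa> * (- ln (1 - z\<^sup>2) / 2))"
    unfolding eq .
  then show ?thesis by (simp add: infsum_word_term euler_char_eq)
qed

theorem ihara_formula:
  "inverse (ihara_zeta X u z) = (1 - z\<^sup>2) powr (- euler_char X u) * vn_det X u (ihara_op X z)"
proof -
  have "z\<^sup>2 \<noteq> 1"
  proof
    assume "z\<^sup>2 = 1"
    then have "(cmod z)\<^sup>2 = 1" by (metis norm_one norm_power)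
    then show False using cmod_z_less_1 power_less_one_iff[of "cmod z" 2] by simp
  qed
  then have pw: "(1 - z\<^sup>2) powr (- euler_char X u) = exp (- euler_char X u * ln (1 - z\<^sup>2))"
    by (simp add: powr_def)
  show ?thesis
    unfolding ihara_zeta_def sums_unique[OF zeta_term_sums, symmetric] vn_det_def pw
    by (simp add: exp_minus[symmetric] exp_add[symmetric])
qed

end
end

text \<open>The inverse of \<open>R\<close> is the positive root of \<open>D t + D t\<^sup>2 = 1\<close>.\<close>

lemma quadratic_bound_of_radius:
  fixes D R t :: real
  assumes D: "1 \<le> D" and R: "R = (D + sqrt (D\<^sup>2 + 4 * D)) / 2" and t: "0 \<le> t" "t < inverse R"
  shows "t * D + t\<^sup>2 * D < 1"
proof -
  have s: "0 \<le> sqrt (D\<^sup>2 + 4 * D)" "(sqrt (D\<^sup>2 + 4 * D))\<^sup>2 = D\<^sup>2 + 4 * D" using D by auto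
  have "0 < D + sqrt (D\<^sup>2 + 4 * D)" using D s(1) by linarith
  then have Rpos: "0 < R" unfolding R by simp
  have R2: "R\<^sup>2 = D * R + D"
    unfolding R using s(2) by (simp add: power2_eq_square field_simps)
  have "inverse R * D + (inverse R)\<^sup>2 * D = (D * R + D) / R\<^sup>2"
    using Rpos by (simp add: field_simps power2_eq_square)
  also have "\<dots> = 1" using Rpos by (simp flip: R2)
  finally have one: "inverse R * D + (inverse R)\<^sup>2 * D = 1" .
  have "t * D < inverse R * D" using t D by (intro mult_strict_right_mono) auto
  moreover have "t\<^sup>2 * D \<le> (inverse R)\<^sup>2 * D" using t D by (intro mult_right_mono power_mono) auto
  ultimately show ?thesis using one by linarith
qed

section \<open>The determinant formula\<close>

theorem theorem3p11:
  fixes X :: "('g, 'v) measure_graph" and u :: "'v \<Rightarrow> ennreal"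
    and D :: nat and R :: real and z :: complex
  assumes "measure_graph X"
    and "averaging_function X u"
    and "D = max_degree (space (verts X)) (edges X)"
    and "1 \<le> D"
    and "R = (real D + sqrt ((real D)\<^sup>2 + 4 * real D)) / 2"
    and "cmod z < inverse R"
  shows "(\<forall>j. mean_num_reduced_closed X u j < \<infinity>)
    \<and> summable (\<lambda>j. zeta_term X u z (Suc j))
    \<and> ihara_op X z \<in> vn_algebra X
    \<and> vn_norm X (op_diff op_id (ihara_op X z)) < 1
    \<and> inverse (ihara_zeta X u z)
        = (1 - z\<^sup>2) powr (- euler_char X u) * vn_det X u (ihara_op X z)"
proof -
  interpret averaged_measure_graph X u
    using assms(1,2) by (simp add: averaged_measure_graph_def averaged_measure_graph_axioms_def)
  have D: "max_deg = real D" "1 \<le> max_deg" using assms(3,4) by (auto simp: max_deg_def)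
  have b: "hop_bound z < 1"
    unfolding hop_bound_def D(1)
    by (rule quadratic_bound_of_radius[OF _ assms(5) _ assms(6)]) (use assms(4) in simp_all)
  show ?thesis
    using mean_num_reduced_closed_eq[OF D(2) b] sums_summable[OF zeta_term_sums[OF D(2) b]]
      ihara_op_in_vn_algebra[OF D(2) b] vn_norm_ihara_op[OF D(2) b] ihara_formula[OF D(2) b]
    by simp
qed

end
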